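(* Let $n\ge 2$, let $0<a\le\infty$ be an extended real number, and let $I=[0,a)$. Suppose that $\varphi:I\to[0,\infty)$ is convex with $\varphi(0)=0$. If $K,L$ are compact convex sets in $\mathbb{R}^n$ with $o\in\operatorname{int}K$, $o\in L$, and $L\subset\operatorname{int}(aK)$, then $$\frac{1}{nV(K)}\int_{S^{n-1}}\varphi\left(\frac{h_L(u)}{h_K(u)}\right)h_K(u)\,dS(K,u)\ge\varphi\left(\left(\frac{V(L)}{V(K)}\right)^{1/n}\right).$$ If $\varphi$ is strictly convex, equality holds if and only if $K$ and $L$ are dilatates or $L=\{o\}$.
   Context: $V$ is $n$-dimensional volume, $h_K(x)=\sup\{x\cdot y:y\in K\}$ is the support function, and $S(K,\cdot)$ is the surface area measure of $K$ on $S^{n-1}$. $K$ and $L$ are dilatates if $L=tK$ for some $t>0$. When $a=\infty$, $aK$ is understood as $\mathbb{R}^n$, so that the condition $L\subset\operatorname{int}(aK)$ is no restriction. *)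

theory Defs
  imports "HOL-Analysis.Analysis"
begin

definition support_fun :: "'a::euclidean_space set \<Rightarrow> 'a \<Rightarrow> real" where
  "support_fun K x = (SUP y\<in>K. x \<bullet> y)"

text \<open>
  Hausdorff (outer) measure of integer dimension, normalized by the factor
  \<open>\<omega>\<^sub>k / 2\<^sup>k\<close>, where \<open>\<omega>\<^sub>k\<close> is the volume of the unit ball of dimension \<open>k\<close>.  With this
  normalization it coincides with \<open>k\<close>-dimensional Lebesgue measure on \<open>k\<close>-dimensional affine
  subspaces, which is the convention needed for surface area.
  The case distinction on \<open>U i = {}\<close> matters only for \<open>k = 0\<close>, where \<open>0 ^ 0 = 1\<close>; the
  boundedness condition is needed because the library's diameter is unspecified for
  unbounded sets.
\<close>

definition hausdorff_content :: "nat \<Rightarrow> real \<Rightarrow> 'a::euclidean_space set \<Rightarrow> ennreal" where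
  "hausdorff_content k \<delta> A =
     (INF U\<in>{U :: nat \<Rightarrow> 'a set.
               A \<subseteq> (\<Union>i. U i) \<and> (\<forall>i. bounded (U i) \<and> diameter (U i) \<le> \<delta>)}.
        \<Sum>i. if U i = {} then 0
            else ennreal (unit_ball_vol (real k) * (diameter (U i) / 2) ^ k))"

definition hausdorff_measure :: "nat \<Rightarrow> 'a::euclidean_space set \<Rightarrow> ennreal" where
  "hausdorff_measure k A = (SUP \<delta>\<in>{0<..}. hausdorff_content k \<delta> A)"

definition reverse_spherical_image :: "'a::euclidean_space set \<Rightarrow> 'a set \<Rightarrow> 'a set" where
  "reverse_spherical_image K \<omega> =
     {x \<in> frontier K. \<exists>u\<in>\<omega>. x \<bullet> u = support_fun K u}"

text \<open>
  The surface area measure \<open>S(K, \<cdot>)\<close>: a Borel set \<open>\<omega>\<close> of unit vectors has as its measure the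
  \<open>(n - 1)\<close>-dimensional Hausdorff measure of the set of boundary points of \<open>K\<close> that have an
  outer unit normal in \<open>\<omega>\<close>.  For a compact convex \<open>K\<close> with interior points this set function
  is a finite measure on the Borel sets of the sphere (the boundary points with more than
  one outer unit normal form a null set), so that the degenerate case of \<open>measure_of\<close>, the
  null measure, does not arise.
\<close>

definition surface_area_measure :: "'a::euclidean_space set \<Rightarrow> 'a measure" where
  "surface_area_measure K =
     measure_of (sphere 0 1) (sets (restrict_space borel (sphere 0 1)))
       (\<lambda>\<omega>. hausdorff_measure (DIM('a) - 1) (reverse_spherical_image K \<omega>))"

definition dilatates :: "'a::real_vector set \<Rightarrow> 'a set \<Rightarrow> bool" where
  "dilatates K L \<longleftrightarrow> (\<exists>t>0. L = (*\<^sub>R) t ` K)"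

text \<open>The dilate \<open>aK\<close> for extended real \<open>a > 0\<close>, with \<open>\<infinity> K\<close> the whole space.\<close>

definition ext_dilate :: "ereal \<Rightarrow> 'a::real_vector set \<Rightarrow> 'a set" where
  "ext_dilate a K = (if a = \<infinity> then UNIV else (*\<^sub>R) (real_of_ereal a) ` K)"

definition strictly_convex_on :: "real set \<Rightarrow> (real \<Rightarrow> real) \<Rightarrow> bool" where
  "strictly_convex_on I f \<longleftrightarrow> convex I \<and>
     (\<forall>x\<in>I. \<forall>y\<in>I. \<forall>t. x \<noteq> y \<longrightarrow> 0 < t \<longrightarrow> t < 1 \<longrightarrow>
        f ((1 - t) * x + t * y) < (1 - t) * f x + t * f y)"

end

theory Submission
  imports Defs
begin

text \<open>
  Write \<open>g\<close> for the gauge of \<open>K\<close> and \<open>\<nu> x\<close> for the outer unit normal of \<open>K\<close> at \<open>x / g x\<close>, which is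
  unique for almost every \<open>x\<close>.  The central fact is that \<open>h\<^sub>K / n \<cdot> S(K, \<cdot>)\<close> is the image of Lebesgue
  measure on \<open>K\<close> under \<open>\<nu>\<close>.  Where the normals are close to a fixed \<open>u\<close>, central projection to a
  hyperplane orthogonal to \<open>u\<close> is nearly a similarity, so the Hausdorff measure of a piece of the
  boundary is compared with the volume of the cone over its flat image.  On hyperplanes Hausdorff and
  Lebesgue measure agree by the isodiametric inequality (from Brunn--Minkowski) and self-similarity of
  the cube.  Integrals against \<open>S(K, \<cdot>)\<close> thus become averages over \<open>K\<close> of functions of \<open>\<nu>\<close>.

  With \<open>r = h\<^sub>L(\<nu>) / h\<^sub>K(\<nu>)\<close> every point \<open>z\<close> of \<open>(1 - t) K + t L\<close> satisfies \<open>g z \<le> 1 + t (r z - 1)\<close>, so that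
  the volume of this set is at most \<open>\<integral>\<^sub>K (1 + t (r - 1))\<^sup>n\<close>.  Comparing with Brunn--Minkowski as \<open>t \<rightarrow> 0\<close>
  gives that the mean of \<open>r\<close> is at least \<open>d = (V(L) / V(K))\<^sup>1\<^sup>/\<^sup>n\<close>; a supporting line of \<open>\<phi>\<close> at \<open>d\<close> yields the
  inequality.  No equality case of Brunn--Minkowski is needed: equality forces \<open>r = d\<close> almost everywhere,
  hence \<open>L \<subseteq> d K\<close>, and the two sets have the same volume.
\<close>

section \<open>The Brunn--Minkowski inequality\<close>

text \<open>The surface area measure is built by \<open>measure_of\<close> from a set function, so
  nothing can be integrated against it before that set function is shown to be countably additive.
  The obstacle is that reverse spherical images of disjoint sets may overlap, that those of Borel
  sets have no evident measurability, and that Hausdorff measure enters as an outer measure. The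
  equality is therefore squeezed: the bound from above is proved for every Borel set of directions,
  the bound from below only for the whole sphere, where disjoint compact pieces of the boundary can
  be used, and finiteness then forces equality on every Borel set. Brunn--Minkowski appears at
  midpoints and in product form. Repeated halving produces small weights, and the product form gives
  a logarithmic first variation that loses nothing when V(L) = V(K); homogeneity in L reduces the
  general case to that one.\<close>

lemma compact_inner_approx_lborel:
  fixes A :: "'a::euclidean_space set"
  assumes A: "A \<in> sets borel" and c: "c < emeasure lborel A"
  obtains T where "compact T" "T \<subseteq> A" "c < emeasure lborel T"
proof -
  \<comment> \<open>Inner regularity is applied to a finite measure, so \<open>A\<close> is first
    cut down to a ball; \<open>M\<close> below is Lebesgue measure on that ball.\<close>
  have "(SUP n::nat. emeasure lborel (A \<inter> cball 0 (real n))) = emeasure lborel (\<Union>n::nat. A \<inter> cball 0 (real n))"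
    using A by (intro SUP_emeasure_incseq) (auto simp: incseq_def)
  also have "(\<Union>n::nat. A \<inter> cball 0 (real n)) = A"
    using real_arch_simple by fastforce
  finally have "c < (SUP n::nat. emeasure lborel (A \<inter> cball 0 (real n)))"
    using c by simp
  then obtain n :: nat where n: "c < emeasure lborel (A \<inter> cball 0 (real n))"
    unfolding less_SUP_iff by blast
  define M where "M = density lborel (indicator (cball (0::'a) (real n)))"
  have M: "emeasure M B = emeasure lborel (B \<inter> cball 0 (real n))" if "B \<in> sets borel" for B
    using that unfolding M_def
    by (subst emeasure_density) (auto simp: indicator_inter_arith[symmetric] mult.commute Int_commute intro!: borel_measurable_indicator)
  have "emeasure M A = (SUP K \<in> {K. K \<subseteq> A \<and> compact K}. emeasure M K)"
  proof (rule inner_regular)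
    show "emeasure M (space M) \<noteq> \<infinity>"
      using M[of UNIV] emeasure_lborel_cball_finite[of "0::'a" "real n"] by (simp add: M_def)
  qed (auto simp: M_def A)
  with n M[OF A] have "c < (SUP K \<in> {K. K \<subseteq> A \<and> compact K}. emeasure M K)" by simp
  then obtain T where T: "T \<subseteq> A" "compact T" "c < emeasure M T"
    unfolding less_SUP_iff by blast
  have "emeasure M T \<le> emeasure lborel T"
    using T(2) M[of T] by (auto intro!: emeasure_mono simp: borel_compact)
  with T that show ?thesis by force
qed

lemma emeasure_lborel_inner_compact:
  fixes A :: "'a::euclidean_space set"
  assumes "A \<in> sets borel"
  shows "emeasure lborel A = (SUP T\<in>{T. compact T \<and> T \<subseteq> A}. emeasure lborel T)"
proof (rule antisym)
  show "emeasure lborel A \<le> (SUP T\<in>{T. compact T \<and> T \<subseteq> A}. emeasure lborel T)"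
  proof (rule dense_le)
    fix c assume "c < emeasure lborel A"
    then obtain T where "compact T" "T \<subseteq> A" "c < emeasure lborel T"
      using compact_inner_approx_lborel assms by metis
    then show "c \<le> (SUP T\<in>{T. compact T \<and> T \<subseteq> A}. emeasure lborel T)"
      by (intro SUP_upper2[of T]) auto
  qed
qed (use assms in \<open>auto intro!: SUP_least emeasure_mono\<close>)

text \<open>With a = max A and b = min B, the translates \<open>b + A\<close> and
  \<open>a + B\<close> lie on opposite sides of \<open>a + b\<close> and meet only there, so their
  measures add up inside \<open>C\<close>.\<close>

lemma emeasure_lborel_plus_compact:
  fixes A B C :: "real set"
  assumes "compact A" "compact B" "A \<noteq> {}" "B \<noteq> {}" and C: "C \<in> sets borel"
    and sub: "\<And>a b. a \<in> A \<Longrightarrow> b \<in> B \<Longrightarrow> a + b \<in> C"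
  shows "emeasure lborel A + emeasure lborel B \<le> emeasure lborel C"
proof -
  obtain a where a: "a \<in> A" "\<And>x. x \<in> A \<Longrightarrow> x \<le> a"
    using compact_attains_sup[OF assms(1,3)] by blast
  obtain b where b: "b \<in> B" "\<And>x. x \<in> B \<Longrightarrow> b \<le> x"
    using compact_attains_inf[OF assms(2,4)] by blast
  let ?A = "(+) b ` A" and ?B = "(+) a ` B"
  have tr: "emeasure lborel ((+) t ` S) = emeasure lborel S" if "compact S" for t and S :: "real set"
  proof -
    have "emeasure lborel ((+) t ` S) = emeasure (distr lborel borel ((+) (-t))) S"
      using that by (subst emeasure_distr)
        (auto intro!: arg_cong[where f="emeasure lborel"] image_eqI[where x="_ - t"] simp: borel_compact)
    then show ?thesis using lborel_distr_plus[of "-t"] by simp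
  qed
  have mA: "?A \<in> sets borel" and mB: "?B \<in> sets borel"
    using assms(1,2) by (auto intro!: borel_compact compact_translation)
  have "emeasure lborel A + emeasure lborel B = emeasure lborel ?A + emeasure lborel ?B"
    by (simp add: tr assms)
  also have "\<dots> = emeasure lborel (?A - {a+b}) + emeasure lborel ?B"
    using mA by (subst emeasure_Diff_null_set) (auto simp: )
  also have "\<dots> = emeasure lborel ((?A - {a+b}) \<union> ?B)"
  proof (rule plus_emeasure)
    show "(?A - {a+b}) \<inter> ?B = {}" using a b by fastforce
  qed (use mA mB in auto)
  also have "\<dots> \<le> emeasure lborel C"
    using sub[OF _ b(1)] sub[OF a(1)] C by (intro emeasure_mono) (auto simp: add.commute)
  finally show ?thesis .
qed

text \<open>\<open>C\<close> is any Borel set containing the midpoints, because the sumset of two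
  Borel sets need not be Borel. Inner regularity, used in one factor after the other, passes from
  compact to Borel sets.\<close>

lemma emeasure_lborel_midpoint:
  fixes A B C :: "real set"
  assumes A: "A \<in> sets borel" "A \<noteq> {}" and B: "B \<in> sets borel" "B \<noteq> {}" and C: "C \<in> sets borel"
    and sub: "\<And>a b. a \<in> A \<Longrightarrow> b \<in> B \<Longrightarrow> (a + b) / 2 \<in> C"
  shows "emeasure lborel A + emeasure lborel B \<le> 2 * emeasure lborel C"
proof -
  define D where "D = {x. x / 2 \<in> C}"
  have D: "D \<in> sets borel" unfolding D_def using C by measurable
  have eD: "emeasure lborel D = 2 * emeasure lborel C"
  proof -
    have "emeasure lborel C = emeasure (density (distr lborel borel (\<lambda>x. 0 + (1/2) * x)) (\<lambda>_. ennreal \<bar>1/2\<bar>)) C"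
      by (subst lborel_real_affine[of "1/2" 0, symmetric]) auto
    also have "\<dots> = ennreal (1/2) * emeasure (distr lborel borel (\<lambda>x. 0 + (1/2) * x)) C"
      using C by (subst emeasure_density_const) (auto simp del: ennreal_half)
    also have "emeasure (distr lborel borel (\<lambda>x. 0 + (1/2) * x)) C = emeasure lborel D"
      using C by (subst emeasure_distr) (auto simp: D_def vimage_def)
    finally have "2 * emeasure lborel C = 2 * (ennreal (1/2) * emeasure lborel D)" by simp
    also have "\<dots> = ennreal 2 * ennreal (1/2) * emeasure lborel D" by (simp add: mult.assoc)
    also have "\<dots> = emeasure lborel D"
      by (subst ennreal_mult'[symmetric]) auto
    finally show ?thesis by simp
  qed
  obtain a0 b0 where ab: "a0 \<in> A" "b0 \<in> B" using A B by auto
  have key: "emeasure lborel S + emeasure lborel T \<le> emeasure lborel D"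
    if "compact S" "compact T" "S \<subseteq> A" "T \<subseteq> B" for S T
  proof -
    \<comment> \<open>Adding one point keeps both compact sets nonempty.\<close>
    have "emeasure lborel S + emeasure lborel T \<le> emeasure lborel (insert a0 S) + emeasure lborel (insert b0 T)"
      using that by (intro add_mono emeasure_mono) (auto simp: borel_compact)
    also have "\<dots> \<le> emeasure lborel D"
      using that ab sub by (intro emeasure_lborel_plus_compact) (use D in \<open>auto simp: D_def compact_insert\<close>)
    finally show ?thesis .
  qed
  have ne: "{S. compact S \<and> S \<subseteq> X} \<noteq> {}" for X :: "real set" by blast
  have "emeasure lborel A + emeasure lborel T \<le> emeasure lborel D" if "compact T" "T \<subseteq> B" for T
    unfolding emeasure_lborel_inner_compact[OF A(1)]
    by (subst ennreal_SUP_add_left[symmetric, OF ne]) (auto intro!: SUP_least key that)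
  then have "emeasure lborel A + (SUP T\<in>{T. compact T \<and> T \<subseteq> B}. emeasure lborel T) \<le> emeasure lborel D"
    by (subst ennreal_SUP_add_right[OF ne]) (auto intro!: SUP_least)
  then show ?thesis by (simp add: eD emeasure_lborel_inner_compact[OF B(1)])
qed


section \<open>The Prekopa--Leindler inequality\<close>

text \<open>Cutting at 1 restricts the levels to (0, 1), where the superlevel sets of functions with
  supremum 1 are nonempty.\<close>

lemma nn_integral_min_1_layer_cake:
  fixes f :: "real \<Rightarrow> ennreal"
  assumes [measurable]: "f \<in> borel_measurable borel"
  shows "(\<integral>\<^sup>+x. min 1 (f x) \<partial>lborel) = (\<integral>\<^sup>+s. indicator {0<..<1} s * emeasure lborel {x. ennreal s < f x} \<partial>lborel)"
proof -
  have [measurable]: "{x. ennreal s < f x} \<in> sets borel" for s by measurable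
  have slice: "min 1 (f x) = (\<integral>\<^sup>+s. indicator {0<..<1} s * indicator {x. ennreal s < f x} x \<partial>lborel)" for x
  proof -
    define r where "r = enn2real (min 1 (f x))"
    have "min 1 (f x) < top" by (rule le_less_trans[of _ 1]) auto
    then have r: "min 1 (f x) = ennreal r" "0 \<le> r" "r \<le> 1"
      using enn2real_mono[of "min 1 (f x)" 1] by (auto simp: r_def)
    have "indicator {0<..<1} s * indicator {x. ennreal s < f x} x = (indicator {0<..<r} s :: ennreal)" for s
    proof (cases "0 < s \<and> s < 1")
      case True
      have "ennreal s < f x \<longleftrightarrow> ennreal s < min 1 (f x)"
        using True by (auto simp: ennreal_less_one_iff)
      also have "\<dots> \<longleftrightarrow> s < r" using r True by (auto simp: ennreal_less_iff)
      finally show ?thesis using True by (auto simp: indicator_def)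
    qed (use r in \<open>auto simp: indicator_def\<close>)
    then show ?thesis using r by simp
  qed
  have "(\<integral>\<^sup>+x. min 1 (f x) \<partial>lborel) = (\<integral>\<^sup>+x. (\<integral>\<^sup>+s. indicator {0<..<1} s * indicator {x. ennreal s < f x} x \<partial>lborel) \<partial>lborel)"
    by (simp add: slice)
  also have "\<dots> = (\<integral>\<^sup>+s. (\<integral>\<^sup>+x. indicator {0<..<1} s * indicator {x. ennreal s < f x} x \<partial>lborel) \<partial>lborel)"
    by (intro lborel_pair.Fubini') (auto simp: indicator_def)
  also have "\<dots> = (\<integral>\<^sup>+s. indicator {0<..<1} s * emeasure lborel {x. ennreal s < f x} \<partial>lborel)"
    by (intro nn_integral_cong) (simp add: nn_integral_cmult)
  finally show ?thesis .
qed

text \<open>For s < 1 both superlevel sets are nonempty, and values above s at two points force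
  \<open>h\<close> above s at their midpoint. The one-dimensional sumset bound is then integrated
  over the levels; equal suprema are what allows the additive conclusion.\<close>

lemma prekopa_leindler_normalized:
  fixes f g h :: "real \<Rightarrow> ennreal"
  assumes [measurable]: "f \<in> borel_measurable borel" "g \<in> borel_measurable borel" "h \<in> borel_measurable borel"
    and f1: "(SUP x. f x) = 1" and g1: "(SUP x. g x) = 1"
    and fgh: "\<And>x y. f x * g y \<le> (h ((x + y) / 2))\<^sup>2"
  shows "(\<integral>\<^sup>+x. f x \<partial>lborel) + (\<integral>\<^sup>+x. g x \<partial>lborel) \<le> 2 * (\<integral>\<^sup>+x. h x \<partial>lborel)"
proof -
  let ?L = "\<lambda>f s. emeasure lborel {x. ennreal s < f x}"
  have f_le: "f x \<le> 1" for x using f1 by (metis SUP_upper UNIV_I)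
  have g_le: "g x \<le> 1" for x using g1 by (metis SUP_upper UNIV_I)
  have [measurable]: "{x. ennreal s < f x} \<in> sets borel" "{x. ennreal s < g x} \<in> sets borel"
    "{x. ennreal s < h x} \<in> sets borel" for s by measurable
  have level: "?L f s + ?L g s \<le> 2 * ?L h s" if s: "0 < s" "s < 1" for s
  proof (rule emeasure_lborel_midpoint)
    have "ennreal s < (SUP x. f x)" "ennreal s < (SUP x. g x)"
      using s f1 g1 by (auto simp: ennreal_less_one_iff)
    then show "{x. ennreal s < f x} \<noteq> {}" "{x. ennreal s < g x} \<noteq> {}"
      by (auto simp: less_SUP_iff)
    fix a b assume ab: "a \<in> {x. ennreal s < f x}" "b \<in> {x. ennreal s < g x}"
    obtain p where p: "f a = ennreal p" "0 \<le> p" using f_le[of a] by (cases "f a") (auto simp: top_unique)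
    obtain q where q: "g b = ennreal q" "0 \<le> q" using g_le[of b] by (cases "g b") (auto simp: top_unique)
    have "s < p" "s < q" using ab p q s by (auto simp: ennreal_less_iff)
    then have *: "s * s < p * q" using s by (intro mult_strict_mono) auto
    show "(a + b) / 2 \<in> {x. ennreal s < h x}"
    proof (rule ccontr)
      assume "\<not> ?thesis"
      then have "h ((a + b) / 2) \<le> ennreal s" by simp
      then have "(h ((a + b) / 2))\<^sup>2 \<le> (ennreal s)\<^sup>2" by (intro power_mono) auto
      with fgh[of a b] have "f a * g b \<le> (ennreal s)\<^sup>2" by (rule order_trans)
      then have "ennreal (p * q) \<le> ennreal (s * s)"
        using p q s by (simp add: ennreal_mult power2_eq_square)
      then have "p * q \<le> s * s" using s by (subst (asm) ennreal_le_iff) auto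
      with * show False by simp
    qed
  qed measurable
  have "(\<integral>\<^sup>+x. f x \<partial>lborel) + (\<integral>\<^sup>+x. g x \<partial>lborel)
      = (\<integral>\<^sup>+x. min 1 (f x) \<partial>lborel) + (\<integral>\<^sup>+x. min 1 (g x) \<partial>lborel)"
    using f_le g_le by (simp add: min_absorb2)
  also have "\<dots> = (\<integral>\<^sup>+s. indicator {0<..<1} s * ?L f s + indicator {0<..<1} s * ?L g s \<partial>lborel)"
    by (subst nn_integral_add) (auto simp: nn_integral_min_1_layer_cake)
  also have "\<dots> \<le> (\<integral>\<^sup>+s. 2 * (indicator {0<..<1} s * ?L h s) \<partial>lborel)"
    using level by (intro nn_integral_mono) (auto simp: indicator_def)
  also have "\<dots> = 2 * (\<integral>\<^sup>+x. min 1 (h x) \<partial>lborel)"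
    by (subst nn_integral_cmult) (auto simp: nn_integral_min_1_layer_cake)
  also have "\<dots> \<le> 2 * (\<integral>\<^sup>+x. h x \<partial>lborel)"
    by (intro mult_left_mono nn_integral_mono) auto
  finally show ?thesis .
qed

lemma ennreal_mult_le_square:
  fixes p q r :: ennreal
  assumes "p + q \<le> 2 * r"
  shows "p * q \<le> r\<^sup>2"
proof (cases r)
  case (real r')
  have "p \<noteq> top" "q \<noteq> top" using assms real
    by (auto simp: ennreal_mult_eq_top_iff top_unique)
  then obtain p' q' where pq: "p = ennreal p'" "0 \<le> p'" "q = ennreal q'" "0 \<le> q'"
    by (cases p; cases q) auto
  have "ennreal (p' + q') \<le> ennreal (2 * r')"
    using assms pq real by (simp add: ennreal_mult)
  then have "p' + q' \<le> 2 * r'" using real by (subst (asm) ennreal_le_iff) auto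
  then have "(p' + q')\<^sup>2 \<le> (2 * r')\<^sup>2" using pq by (intro power_mono) auto
  moreover have "4 * (p' * q') \<le> (p' + q')\<^sup>2"
    using zero_le_power2[of "p' - q'"] by (simp add: power2_eq_square algebra_simps)
  ultimately have "p' * q' \<le> r'\<^sup>2" by (simp add: power_mult_distrib)
  then show ?thesis using pq real
    by (simp add: ennreal_mult[symmetric] ennreal_power)
qed (simp add: power2_eq_square)

text \<open>Dividing by the suprema \<open>a\<close>, \<open>b\<close> and by
  \<open>sqrt (a * b)\<close> reduces to the normalized case; the arithmetic-geometric mean
  inequality turns the sum into a product, and the factors cancel.\<close>

lemma prekopa_leindler_bounded:
  fixes f g h :: "real \<Rightarrow> ennreal"
  assumes [measurable]: "f \<in> borel_measurable borel" "g \<in> borel_measurable borel" "h \<in> borel_measurable borel"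
    and bf: "\<And>x. f x \<le> ennreal k" and bg: "\<And>x. g x \<le> ennreal k"
    and fgh: "\<And>x y. f x * g y \<le> (h ((x + y) / 2))\<^sup>2"
  shows "(\<integral>\<^sup>+x. f x \<partial>lborel) * (\<integral>\<^sup>+x. g x \<partial>lborel) \<le> (\<integral>\<^sup>+x. h x \<partial>lborel)\<^sup>2"
proof -
  have "(SUP x. f x) \<le> ennreal k" "(SUP x. g x) \<le> ennreal k" using bf bg by (auto intro: SUP_least)
  then have "(SUP x. f x) \<noteq> top" "(SUP x. g x) \<noteq> top"
    using ennreal_less_top[of k] by (metis leD)+
  then obtain a b where a: "(SUP x. f x) = ennreal a" "0 \<le> a" and b: "(SUP x. g x) = ennreal b" "0 \<le> b"
    by (metis ennreal_cases)
  consider "a = 0" | "b = 0" | "0 < a" "0 < b" using a b by force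
  then show ?thesis
  proof cases
    case 1
    then have "f x = 0" for x using a SUP_upper[of x UNIV f] by simp
    then show ?thesis by simp
  next
    case 2
    then have "g x = 0" for x using b SUP_upper[of x UNIV g] by simp
    then show ?thesis by simp
  next
    case 3
    define c where "c = sqrt (a * b)"
    have c: "0 < c" "c\<^sup>2 = a * b" using 3 by (auto simp: c_def)
    let ?a = "ennreal (1/a)" and ?b = "ennreal (1/b)" and ?c = "ennreal (1/c)"
    have "(\<integral>\<^sup>+x. ?a * f x \<partial>lborel) + (\<integral>\<^sup>+x. ?b * g x \<partial>lborel) \<le> 2 * (\<integral>\<^sup>+x. ?c * h x \<partial>lborel)"
    proof (rule prekopa_leindler_normalized)
      show "(SUP x. ?a * f x) = 1" "(SUP x. ?b * g x) = 1"
        using a b 3 by (simp_all add: SUP_mult_left_ennreal[symmetric] ennreal_mult'[symmetric])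
      fix x y
      have abc: "?a * ?b = ?c\<^sup>2" using 3 c
        by (simp add: ennreal_mult'[symmetric] ennreal_power power_one_over)
      have "?a * f x * (?b * g y) = ?a * ?b * (f x * g y)" by (simp add: mult_ac)
      also have "\<dots> \<le> ?c\<^sup>2 * (h ((x + y) / 2))\<^sup>2" unfolding abc by (intro mult_left_mono fgh) auto
      finally show "?a * f x * (?b * g y) \<le> (?c * h ((x + y) / 2))\<^sup>2" by (simp add: power_mult_distrib)
    qed measurable
    then have "(\<integral>\<^sup>+x. ?a * f x \<partial>lborel) * (\<integral>\<^sup>+x. ?b * g x \<partial>lborel) \<le> (\<integral>\<^sup>+x. ?c * h x \<partial>lborel)\<^sup>2"
      by (rule ennreal_mult_le_square)
    then have "ennreal (c\<^sup>2) * ((?a * (\<integral>\<^sup>+x. f x \<partial>lborel)) * (?b * (\<integral>\<^sup>+x. g x \<partial>lborel)))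
        \<le> ennreal (c\<^sup>2) * (?c * (\<integral>\<^sup>+x. h x \<partial>lborel))\<^sup>2"
      by (intro mult_left_mono) (simp_all add: nn_integral_cmult)
    moreover have "ennreal (c\<^sup>2) * ((?a * F) * (?b * G)) = F * G" for F G
    proof -
      have "ennreal (c\<^sup>2) * ((?a * F) * (?b * G)) = (ennreal (c\<^sup>2) * ?a * ?b) * (F * G)" by (simp add: mult_ac)
      also have "ennreal (c\<^sup>2) * ?a * ?b = 1" using 3 c by (simp add: ennreal_mult'[symmetric])
      finally show ?thesis by simp
    qed
    moreover have "ennreal (c\<^sup>2) * (?c * F)\<^sup>2 = F\<^sup>2" for F
    proof -
      have "ennreal (c\<^sup>2) * (?c * F)\<^sup>2 = (ennreal (c\<^sup>2) * ?c\<^sup>2) * F\<^sup>2" by (simp add: power_mult_distrib mult_ac)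
      also have "ennreal (c\<^sup>2) * ?c\<^sup>2 = 1"
        using c(1) by (simp add: ennreal_mult'[symmetric] ennreal_power power_one_over)
      finally show ?thesis by simp
    qed
    ultimately show ?thesis by simp
  qed
qed

text \<open>Truncation at constants, with independent cutoffs for \<open>f\<close> and
  \<open>g\<close> so that the two suprema can be taken one after the other.\<close>

lemma prekopa_leindler_real:
  fixes f g h :: "real \<Rightarrow> ennreal"
  assumes [measurable]: "f \<in> borel_measurable borel" "g \<in> borel_measurable borel" "h \<in> borel_measurable borel"
    and fgh: "\<And>x y. f x * g y \<le> (h ((x + y) / 2))\<^sup>2"
  shows "(\<integral>\<^sup>+x. f x \<partial>lborel) * (\<integral>\<^sup>+x. g x \<partial>lborel) \<le> (\<integral>\<^sup>+x. h x \<partial>lborel)\<^sup>2"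
proof -
  have trunc: "(\<integral>\<^sup>+x. f x \<partial>lborel) = (SUP k::nat. \<integral>\<^sup>+x. min (f x) (of_nat k) \<partial>lborel)"
    if [measurable]: "f \<in> borel_measurable borel" for f :: "real \<Rightarrow> ennreal"
  proof -
    have "(SUP k::nat. min (f x) (of_nat k)) = f x" for x
    proof -
      have "(SUP k::nat. inf (f x) (of_nat k)) = inf (f x) (SUP k::nat. of_nat k)" by (rule inf_SUP[symmetric])
      then show ?thesis by (simp add: inf_min ennreal_SUP_of_nat_eq_top)
    qed
    then show ?thesis
      by (subst nn_integral_monotone_convergence_SUP[symmetric])
        (auto simp: incseq_def le_fun_def min_def intro: order_trans[OF _ of_nat_mono])
  qed
  have "(\<integral>\<^sup>+x. min (f x) (of_nat j) \<partial>lborel) * (\<integral>\<^sup>+x. min (g x) (of_nat k) \<partial>lborel) \<le> (\<integral>\<^sup>+x. h x \<partial>lborel)\<^sup>2" for j k :: nat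
  proof (rule prekopa_leindler_bounded[where k="real (max j k)"])
    show "min (f x) (of_nat j) \<le> ennreal (real (max j k))" for x
      by (auto simp: ennreal_of_nat_eq_real_of_nat intro!: min.coboundedI2 ennreal_leI)
    show "min (g x) (of_nat k) \<le> ennreal (real (max j k))" for x
      by (auto simp: ennreal_of_nat_eq_real_of_nat intro!: min.coboundedI2 ennreal_leI)
    show "min (f x) (of_nat j) * min (g y) (of_nat k) \<le> (h ((x + y) / 2))\<^sup>2" for x y
      by (rule order_trans[OF mult_mono fgh]) auto
  qed measurable
  then show ?thesis
    unfolding trunc[OF assms(1)] trunc[OF assms(2)] SUP_mult_left_ennreal SUP_mult_right_ennreal
    by (intro SUP_least)
qed

text \<open>With all but one coordinate fixed, the one-dimensional inequality says that the partial
  integrals satisfy the hypothesis again, so the induction integrates out one variable at a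
  time.\<close>

lemma prekopa_leindler_PiM:
  fixes f g h :: "('i \<Rightarrow> real) \<Rightarrow> ennreal"
  assumes "finite I"
    and "f \<in> borel_measurable (Pi\<^sub>M I (\<lambda>_. lborel))" "g \<in> borel_measurable (Pi\<^sub>M I (\<lambda>_. lborel))"
      "h \<in> borel_measurable (Pi\<^sub>M I (\<lambda>_. lborel))"
    and "\<And>x y. x \<in> extensional I \<Longrightarrow> y \<in> extensional I \<Longrightarrow> f x * g y \<le> (h (\<lambda>i\<in>I. (x i + y i) / 2))\<^sup>2"
  shows "(\<integral>\<^sup>+x. f x \<partial>Pi\<^sub>M I (\<lambda>_. lborel)) * (\<integral>\<^sup>+x. g x \<partial>Pi\<^sub>M I (\<lambda>_. lborel))
      \<le> (\<integral>\<^sup>+x. h x \<partial>Pi\<^sub>M I (\<lambda>_. lborel))\<^sup>2"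
  using assms
proof (induction I arbitrary: f g h rule: finite_induct)
  case empty
  interpret product_sigma_finite "\<lambda>_::'i. lborel :: real measure" by standard
  \<comment> \<open>The product over the empty index set is a unit mass at the function that is
    constantly \<open>undefined\<close>.\<close>
  show ?case
    using empty.prems(4)[of "\<lambda>_. undefined" "\<lambda>_. undefined"] by (simp add: nn_integral_empty)
next
  case (insert i I)
  interpret product_sigma_finite "\<lambda>_::'i. lborel :: real measure" by standard
  note [measurable] = insert.prems(1-3)
  have sect: "(\<lambda>y. F (x(i := y))) \<in> borel_measurable borel"
    if [measurable]: "F \<in> borel_measurable (Pi\<^sub>M (insert i I) (\<lambda>_. lborel))" and x: "x \<in> extensional I"
    for F :: "('i \<Rightarrow> real) \<Rightarrow> ennreal" and x
  proof -
    have [measurable]: "x \<in> space (Pi\<^sub>M I (\<lambda>_. lborel))" using x by (auto simp: space_PiM PiE_def)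
    have "(\<lambda>y. x(i := y)) \<in> measurable lborel (Pi\<^sub>M (insert i I) (\<lambda>_. lborel))" by measurable
    then show ?thesis using measurable_compose[OF _ that(1)] by fastforce
  qed
  have outer: "(\<lambda>x. \<integral>\<^sup>+y. F (x(i := y)) \<partial>lborel) \<in> borel_measurable (Pi\<^sub>M I (\<lambda>_. lborel))"
    if [measurable]: "F \<in> borel_measurable (Pi\<^sub>M (insert i I) (\<lambda>_. lborel))"
    for F :: "('i \<Rightarrow> real) \<Rightarrow> ennreal"
    by measurable
  have "(\<integral>\<^sup>+x. \<integral>\<^sup>+s. f (x(i := s)) \<partial>lborel \<partial>Pi\<^sub>M I (\<lambda>_. lborel)) * (\<integral>\<^sup>+x. \<integral>\<^sup>+s. g (x(i := s)) \<partial>lborel \<partial>Pi\<^sub>M I (\<lambda>_. lborel))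
      \<le> (\<integral>\<^sup>+x. \<integral>\<^sup>+s. h (x(i := s)) \<partial>lborel \<partial>Pi\<^sub>M I (\<lambda>_. lborel))\<^sup>2"
  proof (rule insert.IH)
    fix x y :: "'i \<Rightarrow> real" assume x: "x \<in> extensional I" and y: "y \<in> extensional I"
    let ?m = "\<lambda>i\<in>I. (x i + y i) / 2"
    show "(\<integral>\<^sup>+s. f (x(i := s)) \<partial>lborel) * (\<integral>\<^sup>+s. g (y(i := s)) \<partial>lborel) \<le> (\<integral>\<^sup>+s. h (?m(i := s)) \<partial>lborel)\<^sup>2"
    proof (rule prekopa_leindler_real)
      fix s t
      have "f (x(i := s)) * g (y(i := t)) \<le> (h (\<lambda>j\<in>insert i I. ((x(i := s)) j + (y(i := t)) j) / 2))\<^sup>2"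
        using x y by (intro insert.prems) (auto simp: extensional_def)
      also have "(\<lambda>j\<in>insert i I. ((x(i := s)) j + (y(i := t)) j) / 2) = ?m(i := (s + t) / 2)"
        using insert.hyps by (auto simp: fun_eq_iff)
      finally show "f (x(i := s)) * g (y(i := t)) \<le> (h (?m(i := (s + t) / 2)))\<^sup>2" .
    qed (use x y sect insert.prems in auto)
  qed (fact outer[OF insert.prems(1)] outer[OF insert.prems(2)] outer[OF insert.prems(3)])+
  then show ?case
    using insert.hyps by (simp add: product_nn_integral_insert)
qed

text \<open>Prekopa--Leindler for indicator functions. The product form carries no n-th root and
  covers empty sets, which make the left side 0.\<close>

theorem brunn_minkowski_midpoint:
  fixes A B D :: "'a::euclidean_space set"
  assumes [measurable]: "A \<in> sets borel" "B \<in> sets borel" "D \<in> sets borel"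
    and AB: "\<And>x y. x \<in> A \<Longrightarrow> y \<in> B \<Longrightarrow> (1/2) *\<^sub>R (x + y) \<in> D"
  shows "emeasure lborel A * emeasure lborel B \<le> (emeasure lborel D)\<^sup>2"
proof -
  let ?T = "\<lambda>f. \<Sum>b\<in>(Basis::'a set). f b *\<^sub>R b"
  have T: "?T \<in> measurable (Pi\<^sub>M Basis (\<lambda>_. lborel)) borel" by measurable
  have em: "emeasure lborel S = (\<integral>\<^sup>+x. indicator S (?T x) \<partial>Pi\<^sub>M Basis (\<lambda>_. lborel))"
    if [measurable]: "S \<in> sets borel" for S :: "'a set"
  proof -
    have "emeasure lborel S = (\<integral>\<^sup>+x. indicator S x \<partial>distr (Pi\<^sub>M Basis (\<lambda>_. lborel)) borel ?T)"
      by (subst lborel_eq[symmetric]) simp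
    then show ?thesis by (subst (asm) nn_integral_distr) auto
  qed
  have T_mid: "?T (\<lambda>i\<in>Basis. (x i + y i) / 2) = (1/2) *\<^sub>R (?T x + ?T y)" for x y
    by (simp add: sum.distrib[symmetric] scaleR_sum_right scaleR_add_left[symmetric] scaleR_add_right[symmetric])
  show ?thesis
    unfolding em[OF assms(1)] em[OF assms(2)] em[OF assms(3)]
  proof (rule prekopa_leindler_PiM)
    fix x y :: "'a \<Rightarrow> real"
    show "indicator A (?T x) * indicator B (?T y) \<le> (indicator D (?T (\<lambda>i\<in>Basis. (x i + y i) / 2)) :: ennreal)\<^sup>2"
      unfolding T_mid using AB[of "?T x" "?T y"] by (auto simp: indicator_def)
  qed (use T in auto)
qed

section \<open>Hausdorff measure\<close>

definition hausdorff_cover :: "real \<Rightarrow> 'a::euclidean_space set \<Rightarrow> (nat \<Rightarrow> 'a set) \<Rightarrow> bool" where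
  "hausdorff_cover \<delta> A U \<longleftrightarrow> A \<subseteq> (\<Union>i. U i) \<and> (\<forall>i. bounded (U i) \<and> diameter (U i) \<le> \<delta>)"

definition ball_content :: "nat \<Rightarrow> 'a::euclidean_space set \<Rightarrow> ennreal" where
  "ball_content k U = (if U = {} then 0 else ennreal (unit_ball_vol (real k) * (diameter U / 2) ^ k))"

lemma hausdorff_content_eq:
  "hausdorff_content k \<delta> A = (INF U\<in>{U. hausdorff_cover \<delta> A U}. \<Sum>i. ball_content k (U i))"
  unfolding hausdorff_content_def hausdorff_cover_def ball_content_def by simp

lemma ball_content_empty [simp]: "ball_content k {} = 0"
  by (simp add: ball_content_def)

lemma hausdorff_content_le: "hausdorff_cover \<delta> A U \<Longrightarrow> hausdorff_content k \<delta> A \<le> (\<Sum>i. ball_content k (U i))"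
  unfolding hausdorff_content_eq by (intro INF_lower) simp

lemma hausdorff_content_greatest:
  "(\<And>U. hausdorff_cover \<delta> A U \<Longrightarrow> c \<le> (\<Sum>i. ball_content k (U i))) \<Longrightarrow> c \<le> hausdorff_content k \<delta> A"
  unfolding hausdorff_content_eq by (intro INF_greatest) simp

lemma hausdorff_content_approx:
  assumes "hausdorff_content k \<delta> A \<noteq> top" "0 < e"
  obtains U where "hausdorff_cover \<delta> A U" "(\<Sum>i. ball_content k (U i)) < hausdorff_content k \<delta> A + ennreal e"
proof -
  have "hausdorff_content k \<delta> A < hausdorff_content k \<delta> A + ennreal e"
    using assms by (cases "hausdorff_content k \<delta> A") (auto simp: ennreal_less_iff simp flip: ennreal_plus)
  then have "(INF U\<in>{U. hausdorff_cover \<delta> A U}. \<Sum>i. ball_content k (U i)) < hausdorff_content k \<delta> A + ennreal e"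
    by (simp add: hausdorff_content_eq)
  then show ?thesis using that unfolding INF_less_iff by blast
qed

lemma hausdorff_content_mono: "A \<subseteq> B \<Longrightarrow> hausdorff_content k \<delta> A \<le> hausdorff_content k \<delta> B"
  by (intro hausdorff_content_greatest hausdorff_content_le) (auto simp: hausdorff_cover_def)

lemma hausdorff_content_antimono:
  assumes "\<delta> \<le> \<delta>'"
  shows "hausdorff_content k \<delta>' A \<le> hausdorff_content k \<delta> A"
proof (intro hausdorff_content_greatest hausdorff_content_le)
  fix U assume "hausdorff_cover \<delta> A U"
  then show "hausdorff_cover \<delta>' A U"
    unfolding hausdorff_cover_def using assms order_trans by blast
qed

lemma hausdorff_content_le_ball_content:
  assumes "bounded A" "diameter A \<le> \<delta>" "0 \<le> \<delta>"
  shows "hausdorff_content k \<delta> A \<le> ball_content k A"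
proof -
  have "hausdorff_content k \<delta> A \<le> (\<Sum>i::nat. ball_content k (if i = 0 then A else {}))"
    using assms by (intro hausdorff_content_le) (auto simp: hausdorff_cover_def)
  also have "\<dots> = (\<Sum>i\<in>{0::nat}. ball_content k (if i = 0 then A else {}))"
    by (intro suminf_finite) auto
  finally show ?thesis by simp
qed

lemma hausdorff_content_empty [simp]: "0 \<le> \<delta> \<Longrightarrow> hausdorff_content k \<delta> {} = 0"
  using hausdorff_content_le_ball_content[of "{}" \<delta> k] by simp

lemma hausdorff_content_countable_subadditive:
  "hausdorff_content k \<delta> (\<Union>i::nat. A i) \<le> (\<Sum>i. hausdorff_content k \<delta> (A i))"
proof (cases "\<exists>i. hausdorff_content k \<delta> (A i) = top")
  case True
  then obtain i where "hausdorff_content k \<delta> (A i) = top" by blast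
  moreover have "sum (\<lambda>j. hausdorff_content k \<delta> (A j)) {i} \<le> (\<Sum>j. hausdorff_content k \<delta> (A j))"
    by (intro sum_le_suminf) auto
  ultimately show ?thesis by (simp add: top_unique)
next
  case False
  show ?thesis
  proof (rule ennreal_le_epsilon)
    fix e :: real assume e: "0 < e"
    have "\<exists>U. hausdorff_cover \<delta> (A i) U \<and>
      (\<Sum>j. ball_content k (U j)) \<le> hausdorff_content k \<delta> (A i) + ennreal (e * (1/2) ^ Suc i)" for i
      using False e hausdorff_content_approx[of k \<delta> "A i" "e * (1/2) ^ Suc i"]
      by (metis less_imp_le zero_less_power mult_pos_pos half_gt_zero_iff zero_less_one)
    then obtain U where U: "\<And>i. hausdorff_cover \<delta> (A i) (U i)"
      "\<And>i. (\<Sum>j. ball_content k (U i j)) \<le> hausdorff_content k \<delta> (A i) + ennreal (e * (1/2) ^ Suc i)"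
      by metis
    define V where "V n = (case prod_decode n of (i, j) \<Rightarrow> U i j)" for n
    have "hausdorff_cover \<delta> (\<Union>i. A i) V"
      unfolding hausdorff_cover_def
    proof (intro conjI allI subsetI)
      fix x assume "x \<in> (\<Union>i. A i)"
      then obtain i where "x \<in> A i" by blast
      then obtain j where "x \<in> U i j" using U(1)[of i] by (auto simp: hausdorff_cover_def)
      then have "x \<in> V (prod_encode (i, j))" by (simp add: V_def)
      then show "x \<in> (\<Union>n. V n)" by blast
    qed (use U(1) in \<open>auto simp: V_def hausdorff_cover_def split: prod.split\<close>)
    then have "hausdorff_content k \<delta> (\<Union>i. A i) \<le> (\<Sum>n. ball_content k (V n))"
      by (rule hausdorff_content_le)
    also have "\<dots> = (\<Sum>i. \<Sum>j. ball_content k (U i j))"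
    proof -
      have "(\<Sum>n. (\<lambda>(i, j). ball_content k (U i j)) (prod_decode n)) = (\<Sum>i. \<Sum>j. ball_content k (U i j))"
        by (rule suminf_ennreal_2dimen) simp
      then show ?thesis by (simp add: V_def case_prod_beta)
    qed
    also have "\<dots> \<le> (\<Sum>i. hausdorff_content k \<delta> (A i) + ennreal (e * (1/2) ^ Suc i))"
      by (intro suminf_le U) auto
    also have "\<dots> = (\<Sum>i. hausdorff_content k \<delta> (A i)) + (\<Sum>i. ennreal (e * (1/2) ^ Suc i))"
      by (intro suminf_add[symmetric]) auto
    also have "(\<Sum>i. ennreal (e * (1/2) ^ Suc i)) = ennreal e"
    proof -
      have "(\<lambda>i. e * (1/2) ^ Suc i) sums (e * 1)" by (intro sums_mult power_half_series)
      then show ?thesis using e by (intro suminf_ennreal_eq) auto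
    qed
    finally show "hausdorff_content k \<delta> (\<Union>i. A i) \<le> (\<Sum>i. hausdorff_content k \<delta> (A i)) + ennreal e" .
  qed
qed

lemma hausdorff_content_Un:
  assumes "0 \<le> \<delta>"
  shows "hausdorff_content k \<delta> (A \<union> B) \<le> hausdorff_content k \<delta> A + hausdorff_content k \<delta> B"
proof -
  let ?S = "\<lambda>i::nat. if i = 0 then A else if i = 1 then B else {}"
  have "hausdorff_content k \<delta> (A \<union> B) \<le> hausdorff_content k \<delta> (\<Union>i. ?S i)"
    by (intro hausdorff_content_mono) (force split: if_splits)
  also have "\<dots> \<le> (\<Sum>i. hausdorff_content k \<delta> (?S i))"
    by (rule hausdorff_content_countable_subadditive)
  also have "\<dots> = (\<Sum>i\<in>{0, 1}. hausdorff_content k \<delta> (?S i))"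
    using assms by (intro suminf_finite) auto
  finally show ?thesis by simp
qed

lemma hausdorff_content_finite_subadditive:
  assumes "0 \<le> \<delta>" "finite I"
  shows "hausdorff_content k \<delta> (\<Union>i\<in>I. A i) \<le> (\<Sum>i\<in>I. hausdorff_content k \<delta> (A i))"
  using assms(2)
proof (induction I rule: finite_induct)
  case (insert i I)
  then show ?case
    using hausdorff_content_Un[OF assms(1), of k "A i" "\<Union>i\<in>I. A i"]
    by (auto intro: order_trans add_left_mono)
qed (use assms(1) in simp)

lemma diameter_Lipschitz_image:
  fixes f :: "'a::euclidean_space \<Rightarrow> 'b::euclidean_space"
  assumes "bounded U" "L-lipschitz_on (U \<inter> A) f" "U \<inter> A \<noteq> {}"
  shows "diameter (f ` (U \<inter> A)) \<le> L * diameter U"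
proof (rule diameter_le)
  fix x y assume "x \<in> f ` (U \<inter> A)" "y \<in> f ` (U \<inter> A)"
  then obtain a b where ab: "a \<in> U \<inter> A" "b \<in> U \<inter> A" "x = f a" "y = f b" by blast
  have "norm (x - y) \<le> L * dist a b"
    using lipschitz_onD[OF assms(2) ab(1,2)] ab by (simp add: dist_norm)
  also have "\<dots> \<le> L * diameter U"
    using ab assms lipschitz_on_nonneg[OF assms(2)]
    by (intro mult_left_mono diameter_bounded_bound) auto
  finally show "norm (x - y) \<le> L * diameter U" .
qed (use assms in auto)

text \<open>The covering sets are cut down to \<open>A\<close>, the only place where
  \<open>f\<close> is controlled. The factor is moved to the left as \<open>1 / L ^ k\<close>, so
  that the infimum over covers stands alone on the right and can be tested cover by cover.\<close>

lemma hausdorff_content_lipschitz_image: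
  fixes f :: "'a::euclidean_space \<Rightarrow> 'b::euclidean_space"
  assumes f: "L-lipschitz_on A f" and L: "0 < L" and d: "0 \<le> \<delta>"
  shows "hausdorff_content k (L * \<delta>) (f ` A) \<le> ennreal (L ^ k) * hausdorff_content k \<delta> A"
proof -
  have "ennreal (1 / L ^ k) * hausdorff_content k (L * \<delta>) (f ` A) \<le> hausdorff_content k \<delta> A"
  proof (rule hausdorff_content_greatest)
    fix U assume U: "hausdorff_cover \<delta> A U"
    let ?V = "\<lambda>i. f ` (U i \<inter> A)"
    have diam: "diameter (?V i) \<le> L * diameter (U i)" if "U i \<inter> A \<noteq> {}" for i
      using U that by (intro diameter_Lipschitz_image lipschitz_on_subset[OF f]) (auto simp: hausdorff_cover_def)
    have bnd: "bounded (?V i)" for i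
    proof -
      have "uniformly_continuous_on (U i \<inter> A) f"
        by (rule lipschitz_on_uniformly_continuous[OF lipschitz_on_subset[OF f]]) auto
      then show ?thesis
        using U by (intro bounded_uniformly_continuous_image) (auto simp: hausdorff_cover_def)
    qed
    have "hausdorff_cover (L * \<delta>) (f ` A) ?V"
      unfolding hausdorff_cover_def
    proof (intro conjI allI bnd)
      show "f ` A \<subseteq> (\<Union>i. ?V i)" using U unfolding hausdorff_cover_def by blast
      show "diameter (?V i) \<le> L * \<delta>" for i
      proof (cases "U i \<inter> A = {}")
        case False
        have "diameter (U i) \<le> \<delta>" using U by (auto simp: hausdorff_cover_def)
        then show ?thesis using diam[OF False] L by (meson mult_left_mono less_imp_le order_trans)
      qed (use L d in auto)
    qed
    then have "hausdorff_content k (L * \<delta>) (f ` A) \<le> (\<Sum>i. ball_content k (?V i))"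
      by (rule hausdorff_content_le)
    also have "\<dots> \<le> (\<Sum>i. ennreal (L ^ k) * ball_content k (U i))"
    proof (intro suminf_le)
      fix i
      show "ball_content k (?V i) \<le> ennreal (L ^ k) * ball_content k (U i)"
      proof (cases "U i \<inter> A = {}")
        case False
        have "(diameter (?V i) / 2) ^ k \<le> (L * diameter (U i) / 2) ^ k"
          using diam[OF False] bnd[of i] by (intro power_mono divide_right_mono) (auto simp: diameter_ge_0)
        then have "unit_ball_vol (real k) * (diameter (?V i) / 2) ^ k
            \<le> L ^ k * (unit_ball_vol (real k) * (diameter (U i) / 2) ^ k)"
          using unit_ball_vol_nonneg[of "real k"]
          using mult_left_mono[of "(diameter (?V i) / 2) ^ k" "(L * diameter (U i) / 2) ^ k" "unit_ball_vol (real k)"]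
          by (simp add: power_divide power_mult_distrib mult_ac)
        then show ?thesis using False L
          by (auto simp: ball_content_def ennreal_mult'[symmetric] intro!: ennreal_leI)
      qed simp
    qed auto
    also have "\<dots> = ennreal (L ^ k) * (\<Sum>i. ball_content k (U i))" by simp
    finally have "ennreal (1 / L ^ k) * hausdorff_content k (L * \<delta>) (f ` A)
        \<le> ennreal (1 / L ^ k) * (ennreal (L ^ k) * (\<Sum>i. ball_content k (U i)))"
      by (rule mult_left_mono) simp
    also have "\<dots> = (\<Sum>i. ball_content k (U i))"
      using L by (simp add: mult.assoc[symmetric] ennreal_mult'[symmetric])
    finally show "ennreal (1 / L ^ k) * hausdorff_content k (L * \<delta>) (f ` A) \<le> (\<Sum>i. ball_content k (U i))" .
  qed
  then have "ennreal (L ^ k) * (ennreal (1 / L ^ k) * hausdorff_content k (L * \<delta>) (f ` A))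
      \<le> ennreal (L ^ k) * hausdorff_content k \<delta> A"
    by (rule mult_left_mono) simp
  then show ?thesis
    using L by (simp add: mult.assoc[symmetric] ennreal_mult'[symmetric])
qed

section \<open>Passage from contents at a fixed scale to the measure\<close>

lemma hausdorff_content_le_measure: "0 < \<delta> \<Longrightarrow> hausdorff_content k \<delta> A \<le> hausdorff_measure k A"
  unfolding hausdorff_measure_def by (intro SUP_upper) simp

lemma hausdorff_measure_least:
  "(\<And>\<delta>. 0 < \<delta> \<Longrightarrow> hausdorff_content k \<delta> A \<le> c) \<Longrightarrow> hausdorff_measure k A \<le> c"
  unfolding hausdorff_measure_def by (intro SUP_least) simp

lemma hausdorff_measure_mono: "A \<subseteq> B \<Longrightarrow> hausdorff_measure k A \<le> hausdorff_measure k B"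
  by (intro hausdorff_measure_least order_trans[OF hausdorff_content_mono hausdorff_content_le_measure])

lemma hausdorff_measure_countable_subadditive:
  "hausdorff_measure k (\<Union>i::nat. A i) \<le> (\<Sum>i. hausdorff_measure k (A i))"
proof (rule hausdorff_measure_least)
  fix \<delta> :: real assume "0 < \<delta>"
  then show "hausdorff_content k \<delta> (\<Union>i. A i) \<le> (\<Sum>i. hausdorff_measure k (A i))"
    by (intro order_trans[OF hausdorff_content_countable_subadditive] suminf_le hausdorff_content_le_measure) auto
qed

lemma hausdorff_measure_Un: "hausdorff_measure k (A \<union> B) \<le> hausdorff_measure k A + hausdorff_measure k B"
  by (intro hausdorff_measure_least order_trans[OF hausdorff_content_Un] add_mono hausdorff_content_le_measure) auto

lemma hausdorff_measure_finite_subadditive: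
  assumes "finite I"
  shows "hausdorff_measure k (\<Union>i\<in>I. A i) \<le> (\<Sum>i\<in>I. hausdorff_measure k (A i))"
  by (intro hausdorff_measure_least order_trans[OF hausdorff_content_finite_subadditive]
      sum_mono hausdorff_content_le_measure) (use assms in auto)

lemma hausdorff_measure_lipschitz_image:
  fixes f :: "'a::euclidean_space \<Rightarrow> 'b::euclidean_space"
  assumes f: "L-lipschitz_on A f" and L: "0 < L"
  shows "hausdorff_measure k (f ` A) \<le> ennreal (L ^ k) * hausdorff_measure k A"
proof (rule hausdorff_measure_least)
  fix \<delta> :: real assume d: "0 < \<delta>"
  have "hausdorff_content k (L * (\<delta> / L)) (f ` A) \<le> ennreal (L ^ k) * hausdorff_content k (\<delta> / L) A"
    using d L by (intro hausdorff_content_lipschitz_image f) auto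
  also have "\<dots> \<le> ennreal (L ^ k) * hausdorff_measure k A"
    using d L by (intro mult_left_mono hausdorff_content_le_measure) auto
  finally show "hausdorff_content k \<delta> (f ` A) \<le> ennreal (L ^ k) * hausdorff_measure k A"
    using L by simp
qed

lemma hausdorff_measure_isometric_image:
  fixes f :: "'a::euclidean_space \<Rightarrow> 'b::euclidean_space"
  assumes f: "\<And>x y. x \<in> A \<Longrightarrow> y \<in> A \<Longrightarrow> dist (f x) (f y) = dist x y"
  shows "hausdorff_measure k (f ` A) = hausdorff_measure k A"
proof (rule antisym)
  have "1-lipschitz_on A f" using f by (intro lipschitz_onI) auto
  from hausdorff_measure_lipschitz_image[OF this]
  show "hausdorff_measure k (f ` A) \<le> hausdorff_measure k A" by simp
  have inj: "inj_on f A" using f by (intro inj_onI) (metis dist_eq_0_iff)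
  have "1-lipschitz_on (f ` A) (inv_into A f)"
    using f inj by (intro lipschitz_onI) auto
  from hausdorff_measure_lipschitz_image[OF this]
  show "hausdorff_measure k A \<le> hausdorff_measure k (f ` A)"
    using inj by (simp add: inv_into_image_cancel)
qed

text \<open>A set of diameter below \<open>d\<close> meets at most one of \<open>A\<close> and
  \<open>B\<close>, so a fine cover of the union splits into covers of the two parts that share no
  nonempty member.\<close>

lemma hausdorff_measure_Un_separated:
  assumes d: "0 < d" "\<And>x y. x \<in> A \<Longrightarrow> y \<in> B \<Longrightarrow> d \<le> dist x y"
  shows "hausdorff_measure k A + hausdorff_measure k B \<le> hausdorff_measure k (A \<union> B)"
proof -
  have sep: "hausdorff_content k \<delta> A + hausdorff_content k \<delta> B \<le> hausdorff_content k \<delta> (A \<union> B)"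
    if \<delta>: "0 < \<delta>" "\<delta> < d" for \<delta>
  proof (rule hausdorff_content_greatest)
    fix U assume U: "hausdorff_cover \<delta> (A \<union> B) U"
    let ?V = "\<lambda>X i. if U i \<inter> X \<noteq> {} then U i else {}"
    have cover: "hausdorff_cover \<delta> X (?V X)" if "X \<subseteq> A \<union> B" for X
      unfolding hausdorff_cover_def
    proof (intro conjI subsetI allI)
      fix x assume "x \<in> X"
      then have "x \<in> (\<Union>i. U i)" using that U unfolding hausdorff_cover_def by blast
      then obtain i where "x \<in> U i" by blast
      with \<open>x \<in> X\<close> have "x \<in> ?V X i" by auto
      then show "x \<in> (\<Union>i. ?V X i)" by blast
    qed (use U \<delta> in \<open>auto simp: hausdorff_cover_def\<close>)
    have excl: "U i \<inter> A = {} \<or> U i \<inter> B = {}" for i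
    proof (rule ccontr)
      assume "\<not> ?thesis"
      then obtain x y where "x \<in> U i" "x \<in> A" "y \<in> U i" "y \<in> B" by blast
      moreover have "dist x y \<le> diameter (U i)"
        using U \<open>x \<in> U i\<close> \<open>y \<in> U i\<close> by (intro diameter_bounded_bound) (auto simp: hausdorff_cover_def)
      moreover have "diameter (U i) \<le> \<delta>" using U by (auto simp: hausdorff_cover_def)
      ultimately show False using d(2)[of x y] \<delta> by simp
    qed
    have "hausdorff_content k \<delta> A + hausdorff_content k \<delta> B
        \<le> (\<Sum>i. ball_content k (?V A i)) + (\<Sum>i. ball_content k (?V B i))"
      by (intro add_mono hausdorff_content_le cover) auto
    also have "\<dots> = (\<Sum>i. ball_content k (?V A i) + ball_content k (?V B i))"
      by (intro suminf_add) auto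
    also have "\<dots> \<le> (\<Sum>i. ball_content k (U i))"
      using excl by (intro suminf_le) auto
    finally show "hausdorff_content k \<delta> A + hausdorff_content k \<delta> B \<le> (\<Sum>i. ball_content k (U i))" .
  qed
  have 1: "hausdorff_content k \<delta> A + hausdorff_content k \<delta>' B \<le> hausdorff_measure k (A \<union> B)"
    if "0 < \<delta>" "0 < \<delta>'" for \<delta> \<delta>'
  proof -
    \<comment> \<open>Contents grow as the scale shrinks, so one scale below \<open>d\<close> serves
      both suprema.\<close>
    define e where "e = min (min \<delta> \<delta>') (d / 2)"
    have e: "0 < e" "e < d" "e \<le> \<delta>" "e \<le> \<delta>'" using that d by (auto simp: e_def)
    have "hausdorff_content k \<delta> A + hausdorff_content k \<delta>' B \<le> hausdorff_content k e A + hausdorff_content k e B"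
      using e by (intro add_mono hausdorff_content_antimono)
    also have "\<dots> \<le> hausdorff_content k e (A \<union> B)" using e by (intro sep)
    also have "\<dots> \<le> hausdorff_measure k (A \<union> B)" using e by (intro hausdorff_content_le_measure)
    finally show ?thesis .
  qed
  have ne: "{0::real<..} \<noteq> {}" by auto
  show ?thesis
    unfolding hausdorff_measure_def[of k A] hausdorff_measure_def[of k B]
    by (subst ennreal_SUP_add_left[OF ne, symmetric], rule SUP_least,
        subst ennreal_SUP_add_right[OF ne], rule SUP_least) (use 1 in auto)
qed

text \<open>Disjoint compact sets have positive distance. This superadditivity later supplies the
  lower bound for the total area of the boundary.\<close>

lemma hausdorff_measure_disjoint_compact:
  assumes "finite I" "\<And>i. i \<in> I \<Longrightarrow> compact (A i)" "disjoint_family_on A I"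
  shows "(\<Sum>i\<in>I. hausdorff_measure k (A i)) \<le> hausdorff_measure k (\<Union>i\<in>I. A i)"
  using assms
proof (induction I rule: finite_induct)
  case (insert i I)
  let ?B = "\<Union>j\<in>I. A j"
  have cB: "compact ?B" using insert by (intro compact_UN) auto
  have disj: "A i \<inter> ?B = {}" using insert.prems(2) insert.hyps by (auto simp: disjoint_family_on_def)
  obtain d where d: "0 < d" "\<And>x y. x \<in> A i \<Longrightarrow> y \<in> ?B \<Longrightarrow> d \<le> dist x y"
    using separate_compact_closed[OF _ compact_imp_closed[OF cB] disj] insert.prems(1) by blast
  have "(\<Sum>j\<in>insert i I. hausdorff_measure k (A j)) = hausdorff_measure k (A i) + (\<Sum>j\<in>I. hausdorff_measure k (A j))"
    using insert.hyps by simp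
  also have "\<dots> \<le> hausdorff_measure k (A i) + hausdorff_measure k ?B"
    using insert.prems by (intro add_left_mono insert.IH) (auto intro: disjoint_family_on_mono)
  also have "\<dots> \<le> hausdorff_measure k (A i \<union> ?B)" using d by (intro hausdorff_measure_Un_separated)
  finally show ?case by simp
qed simp

section \<open>The isodiametric inequality and Hausdorff measure on hyperplanes\<close>

text \<open>Measure on a hyperplane is encoded as n-dimensional volume: for \<open>P\<close>
  orthogonal to the unit vector \<open>b\<close>, the cylinder of height 1 over \<open>P\<close> has
  the (n-1)-dimensional Lebesgue measure of \<open>P\<close> as its volume.\<close>

definition slab :: "'a::euclidean_space \<Rightarrow> 'a set \<Rightarrow> real \<Rightarrow> real \<Rightarrow> 'a set" where
  "slab b P s t = {x. x - (x \<bullet> b) *\<^sub>R b \<in> P \<and> s \<le> x \<bullet> b \<and> x \<bullet> b \<le> t}"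

lemma slab_measurable [measurable]:
  assumes "P \<in> sets borel"
  shows "slab b P s t \<in> sets borel"
proof -
  have "slab b P s t = (\<lambda>x. x - (x \<bullet> b) *\<^sub>R b) -` P \<inter> ({x. s \<le> x \<bullet> b} \<inter> {x. x \<bullet> b \<le> t})"
    by (auto simp: slab_def)
  moreover have "(\<lambda>x. x - (x \<bullet> b) *\<^sub>R b) -` P \<in> sets borel"
    by (rule measurable_sets_borel[OF _ assms]) measurable
  moreover have "closed {x. s \<le> x \<bullet> b}" "closed {x. x \<bullet> b \<le> t}"
    by (intro closed_Collect_le continuous_intros)+
  ultimately show ?thesis by (auto intro: borel_closed)
qed

lemma slab_eq_image:
  assumes "norm b = 1" "\<And>p. p \<in> P \<Longrightarrow> p \<bullet> b = 0"
  shows "slab b P s t = (\<lambda>(p, r). p + r *\<^sub>R b) ` (P \<times> {s..t})"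
proof (intro equalityI subsetI)
  fix x assume "x \<in> slab b P s t"
  then show "x \<in> (\<lambda>(p, r). p + r *\<^sub>R b) ` (P \<times> {s..t})"
    by (intro image_eqI[of _ _ "(x - (x \<bullet> b) *\<^sub>R b, x \<bullet> b)"]) (auto simp: slab_def)
next
  fix x assume "x \<in> (\<lambda>(p, r). p + r *\<^sub>R b) ` (P \<times> {s..t})"
  then obtain p r where "x = p + r *\<^sub>R b" "p \<in> P" "s \<le> r" "r \<le> t" by auto
  then show "x \<in> slab b P s t"
    using assms by (auto simp: slab_def inner_add_left norm_eq_1)
qed

lemma compact_slab:
  assumes "norm b = 1" "\<And>p. p \<in> P \<Longrightarrow> p \<bullet> b = 0" "compact P"
  shows "compact (slab b P s t)"
proof -
  have "slab b P s t = (\<lambda>z. fst z + snd z *\<^sub>R b) ` (P \<times> {s..t})"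
    using slab_eq_image[OF assms(1,2)] by (simp add: case_prod_beta')
  then show ?thesis
    by (simp add: compact_continuous_image compact_Times assms continuous_intros)
qed

text \<open>An affine map that stretches only the coordinate along \<open>b\<close> carries the slab
  of height 1 to the general one.\<close>

lemma emeasure_slab:
  fixes b :: "'a::euclidean_space"
  assumes b: "b \<in> Basis" and [measurable]: "P \<in> sets borel" and st: "s < t"
  shows "emeasure lborel (slab b P s t) = ennreal (t - s) * emeasure lborel (slab b P 0 1)"
proof -
  let ?c = "\<lambda>j. if j = b then t - s else 1"
  let ?T = "\<lambda>x. s *\<^sub>R b + (\<Sum>j\<in>Basis. (?c j * (x \<bullet> j)) *\<^sub>R j)"
  have Tb: "?T x \<bullet> b = s + (t - s) * (x \<bullet> b)" for x
    using b by (simp add: inner_add_left inner_sum_left_Basis)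
  have Tj: "?T x \<bullet> j = x \<bullet> j" if "j \<in> Basis" "j \<noteq> b" for x j
    using that b by (simp add: inner_add_left inner_sum_left_Basis inner_not_same_Basis)
  have proj: "?T x - (?T x \<bullet> b) *\<^sub>R b = x - (x \<bullet> b) *\<^sub>R b" for x
  proof (rule euclidean_eqI)
    fix j :: 'a assume j: "j \<in> Basis"
    show "(?T x - (?T x \<bullet> b) *\<^sub>R b) \<bullet> j = (x - (x \<bullet> b) *\<^sub>R b) \<bullet> j"
    proof (cases "j = b")
      case True
      then show ?thesis using b by (simp add: inner_diff_left)
    next
      case False
      then show ?thesis using b j Tj[OF j False, of x] by (simp add: inner_diff_left inner_not_same_Basis)
    qed
  qed
  have unit: "s \<le> s + (t - s) * y \<and> s + (t - s) * y \<le> t \<longleftrightarrow> 0 \<le> y \<and> y \<le> 1" for y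
  proof -
    have "s + (t - s) * y \<le> t \<longleftrightarrow> (t - s) * y \<le> (t - s) * 1" by (simp only: mult_1_right) linarith
    also have "\<dots> \<longleftrightarrow> y \<le> 1" using st by (subst mult_le_cancel_left_pos) auto
    finally show ?thesis using st by (simp add: zero_le_mult_iff)
  qed
  have pre: "?T -` slab b P s t = slab b P 0 1"
    unfolding slab_def vimage_def mem_Collect_eq proj unfolding Tb unit by simp
  have [measurable]: "?T \<in> borel_measurable borel" by measurable
  have "emeasure lborel (slab b P s t)
      = emeasure (density (distr lborel borel ?T) (\<lambda>_. ennreal (\<Prod>j\<in>Basis. \<bar>?c j\<bar>))) (slab b P s t)"
    using st by (subst lborel_affine_euclidean[of ?c "s *\<^sub>R b", symmetric]) auto
  also have "\<dots> = ennreal (\<Prod>j\<in>Basis. \<bar>?c j\<bar>) * emeasure (distr lborel borel ?T) (slab b P s t)"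
    by (subst emeasure_density_const) auto
  also have "emeasure (distr lborel borel ?T) (slab b P s t) = emeasure lborel (slab b P 0 1)"
    by (subst emeasure_distr) (auto simp: pre)
  also have "(\<Prod>j\<in>Basis. \<bar>?c j\<bar>) = t - s"
    using b st by (subst prod.remove[OF finite_Basis b]) (auto intro!: prod.neutral)
  finally show ?thesis .
qed

text \<open>Fubini with the coordinate along \<open>b\<close> split off: what remains is a ball in
  the other n - 1 coordinates.\<close>

lemma emeasure_slab_cball:
  fixes b :: "'a::euclidean_space"
  assumes b: "b \<in> Basis" and r: "0 < r"
  shows "emeasure lborel (slab b (cball 0 r) 0 1) = ennreal (unit_ball_vol (real (DIM('a) - 1)) * r ^ (DIM('a) - 1))"
proof -
  interpret product_sigma_finite "\<lambda>_::'a. lborel :: real measure" by standard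
  let ?I = "Basis - {b}"
  let ?T = "\<lambda>f. \<Sum>j\<in>(Basis::'a set). f j *\<^sub>R j"
  let ?S = "slab b (cball 0 r) 0 1"
  have I: "insert b ?I = Basis" "finite ?I" "b \<notin> ?I" using b by auto
  have T: "?T \<in> measurable (Pi\<^sub>M Basis (\<lambda>_. lborel)) borel" by measurable
  have S: "?S \<in> sets borel" by (intro slab_measurable) simp
  have mem: "?T (x(b := y)) \<in> ?S \<longleftrightarrow> sqrt (\<Sum>i\<in>?I. (x i)\<^sup>2) \<le> r \<and> 0 \<le> y \<and> y \<le> 1" for x y
  proof -
    have Tb: "?T (x(b := y)) \<bullet> b = y" using b by (simp add: inner_sum_left_Basis)
    have "norm (?T (x(b := y)) - y *\<^sub>R b) = sqrt (\<Sum>i\<in>?I. (x i)\<^sup>2)"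
    proof -
      have "?T (x(b := y)) - y *\<^sub>R b = (\<Sum>j\<in>?I. x j *\<^sub>R j)"
        using b by (simp add: sum.remove[OF finite_Basis b])
      moreover have "norm (\<Sum>j\<in>?I. x j *\<^sub>R j) = sqrt (\<Sum>j\<in>?I. (x j)\<^sup>2)"
      proof -
        have "(norm (\<Sum>j\<in>?I. x j *\<^sub>R j))\<^sup>2 = (\<Sum>j\<in>?I. (x j)\<^sup>2)"
          by (subst norm_sum_Pythagorean)
            (auto simp: pairwise_def orthogonal_def inner_not_same_Basis)
        then show ?thesis by (metis norm_ge_zero real_sqrt_unique)
      qed
      ultimately show ?thesis by simp
    qed
    then show ?thesis unfolding slab_def mem_Collect_eq Tb by (simp del: fun_upd_apply)
  qed
  have "emeasure lborel ?S = (\<integral>\<^sup>+x. indicator ?S x \<partial>distr (Pi\<^sub>M Basis (\<lambda>_. lborel)) borel ?T)"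
    using S by (subst lborel_eq[symmetric]) simp
  also have "\<dots> = (\<integral>\<^sup>+x. indicator ?S (?T x) \<partial>Pi\<^sub>M Basis (\<lambda>_. lborel))"
    using S T by (subst nn_integral_distr) auto
  also have "\<dots> = (\<integral>\<^sup>+x. indicator ?S (?T x) \<partial>Pi\<^sub>M (insert b ?I) (\<lambda>_. lborel))" by (simp only: I(1))
  also have "\<dots> = (\<integral>\<^sup>+x. \<integral>\<^sup>+y. indicator ?S (?T (x(b := y))) \<partial>lborel \<partial>Pi\<^sub>M ?I (\<lambda>_. lborel))"
  proof (rule product_nn_integral_insert)
    have "(\<lambda>x. indicator ?S (?T x) :: ennreal) \<in> borel_measurable (Pi\<^sub>M Basis (\<lambda>_. lborel))"
      using S T by measurable
    then show "(\<lambda>x. indicator ?S (?T x) :: ennreal) \<in> borel_measurable (Pi\<^sub>M (insert b ?I) (\<lambda>_. lborel))"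
      by (simp only: I(1))
  qed (use I in auto)
  also have "\<dots> = (\<integral>\<^sup>+x. indicator ({f. sqrt (\<Sum>i\<in>?I. (f i)\<^sup>2) \<le> r} \<inter> space (Pi\<^sub>M ?I (\<lambda>_. lborel))) x \<partial>Pi\<^sub>M ?I (\<lambda>_. lborel))"
  proof (intro nn_integral_cong)
    fix x assume x: "x \<in> space (Pi\<^sub>M ?I (\<lambda>_. lborel :: real measure))"
    have "(indicator ?S (?T (x(b := y))) :: ennreal)
        = indicator {f. sqrt (\<Sum>i\<in>?I. (f i)\<^sup>2) \<le> r} x * indicator {0..1} y" for y
      unfolding indicator_def mem mem_Collect_eq by auto
    then show "(\<integral>\<^sup>+y. indicator ?S (?T (x(b := y))) \<partial>lborel)
        = (indicator ({f. sqrt (\<Sum>i\<in>?I. (f i)\<^sup>2) \<le> r} \<inter> space (Pi\<^sub>M ?I (\<lambda>_. lborel))) x :: ennreal)"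
      using x by (simp add: nn_integral_cmult indicator_inter_arith)
  qed
  also have "\<dots> = emeasure (Pi\<^sub>M ?I (\<lambda>_. lborel)) ({f. sqrt (\<Sum>i\<in>?I. (f i)\<^sup>2) \<le> r} \<inter> space (Pi\<^sub>M ?I (\<lambda>_. lborel)))"
    by (rule nn_integral_indicator) measurable
  also have "\<dots> = ennreal (unit_ball_vol (real (card ?I)) * r ^ card ?I)"
    using r I by (intro emeasure_cball_aux) auto
  finally show ?thesis using b by (simp add: card_Diff_singleton)
qed

lemma emeasure_lborel_uminus_translation:
  assumes [measurable]: "A \<in> sets borel"
  shows "emeasure lborel {x::'a::euclidean_space. c - x \<in> A} = emeasure lborel A"
proof -
  have "emeasure lborel A
      = emeasure (density (distr lborel borel (\<lambda>x. c + (-1) *\<^sub>R x)) (\<lambda>_. ennreal (\<bar>-1\<bar> ^ DIM('a)))) A"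
    by (subst lborel_affine[of "-1" c, symmetric]) auto
  also have "\<dots> = emeasure (distr lborel borel (\<lambda>x. c + (-1) *\<^sub>R x)) A"
    by (subst emeasure_density_const) auto
  also have "\<dots> = emeasure lborel {x. c - x \<in> A}"
    by (subst emeasure_distr) (auto simp: vimage_def)
  finally show ?thesis by simp
qed

text \<open>Apply Brunn--Minkowski to the cylinders over \<open>C\<close> and \<open>- C\<close>,
  whose midpoints lie in the cylinder over a ball of radius \<open>diameter C / 2\<close>.\<close>

lemma isodiametric_slab:
  fixes b :: "'a::euclidean_space"
  assumes b: "b \<in> Basis" and C: "compact C" "\<And>p. p \<in> C \<Longrightarrow> p \<bullet> b = 0"
  shows "emeasure lborel (slab b C 0 1) \<le> ball_content (DIM('a) - 1) C"
proof (cases "C = {}")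
  case False
  let ?k = "DIM('a) - 1" and ?\<omega> = "unit_ball_vol (real (DIM('a) - 1))"
  \<comment> \<open>Reflection in the point \<open>b / 2\<close> gives the cylinder over
    \<open>- C\<close> with heights again between 0 and 1, so the heights of the midpoints stay in
    that range.\<close>
  let ?A = "slab b C 0 1" and ?B = "{x. b - x \<in> slab b C 0 1}"
  have [measurable]: "C \<in> sets borel" using C by (simp add: borel_compact)
  have B: "?B \<in> sets borel" by measurable
  have fin: "emeasure lborel ?A < top"
    using b C by (intro order.strict_trans2[OF emeasure_compact_finite[OF compact_slab]]) auto
  have bound: "emeasure lborel ?A \<le> ennreal (?\<omega> * r ^ ?k)" if r: "diameter C / 2 \<le> r" "0 < r" for r
  proof -
    have "emeasure lborel ?A * emeasure lborel ?B \<le> (emeasure lborel (slab b (cball 0 r) 0 1))\<^sup>2"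
    proof (rule brunn_minkowski_midpoint[OF _ B])
      fix x y assume x: "x \<in> ?A" and y: "y \<in> ?B"
      let ?px = "x - (x \<bullet> b) *\<^sub>R b" and ?z = "b - y"
      let ?pz = "?z - (?z \<bullet> b) *\<^sub>R b"
      let ?m = "(1/2) *\<^sub>R (x + y)"
      have zb: "?z \<bullet> b = 1 - y \<bullet> b" using b by (simp add: inner_diff_left)
      have "?m - (?m \<bullet> b) *\<^sub>R b = (1/2) *\<^sub>R (?px - ?pz)"
        by (simp add: zb inner_add_left scaleR_add_left scaleR_diff_left scaleR_add_right scaleR_diff_right add_divide_distrib)
      moreover have "dist ?px ?pz \<le> diameter C"
        using x y C by (intro diameter_bounded_bound compact_imp_bounded) (auto simp: slab_def)
      ultimately have "norm (?m - (?m \<bullet> b) *\<^sub>R b) \<le> r" using r by (simp add: dist_norm)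
      moreover have "0 \<le> ?m \<bullet> b" "?m \<bullet> b \<le> 1"
        using x y zb by (auto simp: slab_def inner_add_left)
      ultimately show "?m \<in> slab b (cball 0 r) 0 1" by (simp add: slab_def)
    qed (auto intro: slab_measurable)
    then have "(emeasure lborel ?A)\<^sup>2 \<le> (ennreal (?\<omega> * r ^ ?k))\<^sup>2"
      using emeasure_lborel_uminus_translation[of ?A b]
      by (simp add: emeasure_slab_cball[OF b \<open>0 < r\<close>] power2_eq_square slab_measurable)
    moreover obtain v where "emeasure lborel ?A = ennreal v" "0 \<le> v" using fin by (cases "emeasure lborel ?A") auto
    ultimately show ?thesis
      using r unit_ball_vol_nonneg[of "real ?k"]
      by (auto simp: ennreal_power abs_le_square_iff[symmetric] intro!: ennreal_leI)
  qed
  \<comment> \<open>The ball volume was computed for positive radii, so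
    \<open>diameter C / 2\<close>, possibly 0, is approached from above.\<close>
  have "(\<lambda>n. ennreal (?\<omega> * (diameter C / 2 + 1 / real (Suc n)) ^ ?k))
      \<longlonglongrightarrow> ennreal (?\<omega> * (diameter C / 2 + 0) ^ ?k)"
    by (intro tendsto_intros LIMSEQ_Suc[OF lim_1_over_n])
  moreover have "emeasure lborel ?A \<le> ennreal (?\<omega> * (diameter C / 2 + 1 / real (Suc n)) ^ ?k)" for n
    using diameter_ge_0[OF compact_imp_bounded[OF C(1)]] by (intro bound) (auto intro: add_nonneg_pos)
  ultimately have "emeasure lborel ?A \<le> ennreal (?\<omega> * (diameter C / 2 + 0) ^ ?k)"
    by (intro LIMSEQ_le_const) auto
  then show ?thesis using False by (simp add: ball_content_def)
qed (simp add: slab_def)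

text \<open>Each covering set is replaced by the closure of its part in \<open>P\<close>, which
  keeps the diameter bound and is compact, so the isodiametric inequality bounds the cylinder over
  it. As that inequality holds at every scale, the content at scale 1 already dominates the
  volume.\<close>

lemma slab_le_hausdorff_measure:
  fixes b :: "'a::euclidean_space"
  assumes b: "b \<in> Basis" and P: "\<And>p. p \<in> P \<Longrightarrow> p \<bullet> b = 0"
  shows "emeasure lborel (slab b P 0 1) \<le> hausdorff_measure (DIM('a) - 1) P"
proof -
  have "emeasure lborel (slab b P 0 1) \<le> hausdorff_content (DIM('a) - 1) 1 P"
  proof (rule hausdorff_content_greatest)
    fix U assume U: "hausdorff_cover 1 P U"
    let ?V = "\<lambda>i. closure (U i \<inter> P)"
    have bU: "bounded (U i \<inter> P)" for i using U by (auto simp: hausdorff_cover_def)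
    have cV: "compact (?V i)" for i using bU by simp
    have Vb: "p \<bullet> b = 0" if "p \<in> ?V i" for p i
    proof -
      have "closure (U i \<inter> P) \<subseteq> {x. x \<bullet> b = 0}"
      proof (rule closure_minimal)
        show "closed {x. x \<bullet> b = 0}" by (intro closed_Collect_eq continuous_intros)
      qed (use P in auto)
      then show ?thesis using that by blast
    qed
    have "slab b P 0 1 \<subseteq> (\<Union>i. slab b (?V i) 0 1)"
    proof
      fix x assume x: "x \<in> slab b P 0 1"
      then obtain i where "x - (x \<bullet> b) *\<^sub>R b \<in> U i"
        using U unfolding hausdorff_cover_def slab_def by blast
      then have "x - (x \<bullet> b) *\<^sub>R b \<in> ?V i" using x closure_subset[of "U i \<inter> P"] by (auto simp: slab_def)
      then show "x \<in> (\<Union>i. slab b (?V i) 0 1)" using x by (auto simp: slab_def)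
    qed
    then have "emeasure lborel (slab b P 0 1) \<le> emeasure lborel (\<Union>i. slab b (?V i) 0 1)"
      by (intro emeasure_mono) (auto intro!: sets.countable_UN slab_measurable simp: borel_compact cV)
    also have "\<dots> \<le> (\<Sum>i. emeasure lborel (slab b (?V i) 0 1))"
      by (intro emeasure_subadditive_countably) (auto intro!: slab_measurable)
    also have "\<dots> \<le> (\<Sum>i. ball_content (DIM('a) - 1) (U i))"
    proof (intro suminf_le)
      fix i
      have "emeasure lborel (slab b (?V i) 0 1) \<le> ball_content (DIM('a) - 1) (?V i)"
        using b cV Vb by (intro isodiametric_slab) auto
      also have "\<dots> \<le> ball_content (DIM('a) - 1) (U i)"
      proof (cases "U i \<inter> P = {}")
        case False
        have "diameter (?V i) \<le> diameter (U i)"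
          using U bU by (subst diameter_closure) (auto intro!: diameter_subset simp: hausdorff_cover_def)
        then show ?thesis
          using False bU[of i] unit_ball_vol_nonneg[of "real (DIM('a) - 1)"]
          by (auto simp: ball_content_def intro!: ennreal_leI mult_left_mono power_mono divide_right_mono diameter_ge_0)
      qed simp
      finally show "emeasure lborel (slab b (?V i) 0 1) \<le> ball_content (DIM('a) - 1) (U i)" .
    qed auto
    finally show "emeasure lborel (slab b P 0 1) \<le> (\<Sum>i. ball_content (DIM('a) - 1) (U i))" .
  qed
  also have "\<dots> \<le> hausdorff_measure (DIM('a) - 1) P" by (rule hausdorff_content_le_measure) simp
  finally show ?thesis .
qed

text \<open>Outer regularity gives an open set of nearly the same volume, and compactness puts a
  whole neighbourhood of \<open>S\<close> inside it.\<close>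

lemma compact_thickening:
  fixes S :: "'a::euclidean_space set"
  assumes S: "compact S" and e: "0 < e"
  obtains \<rho> where "0 < \<rho>" "\<And>T. T \<in> sets borel \<Longrightarrow> (\<And>x. x \<in> T \<Longrightarrow> \<exists>s\<in>S. dist x s \<le> \<rho>) \<Longrightarrow>
    emeasure lborel T \<le> emeasure lborel S + ennreal e"
proof -
  have bS: "S \<in> sets borel" using S by (simp add: borel_compact)
  obtain U where U: "open U" "S \<subseteq> U" "emeasure lborel (U - S) < ennreal e"
    using outer_regular_lborel[OF bS e] by blast
  obtain \<rho> where \<rho>: "0 < \<rho>" "(\<Union>x\<in>S. cball x \<rho>) \<subseteq> U"
    using compact_subset_open_imp_cball_epsilon_subset[OF S U(1,2)] by blast
  show ?thesis
  proof (rule that[OF \<rho>(1)])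
    fix T assume T: "T \<in> sets borel" "\<And>x. x \<in> T \<Longrightarrow> \<exists>s\<in>S. dist x s \<le> \<rho>"
    have "T \<subseteq> U" using T(2) \<rho>(2) by (force simp: dist_commute)
    then have "emeasure lborel T \<le> emeasure lborel (S \<union> (U - S))"
      using U bS by (intro emeasure_mono) auto
    also have "\<dots> = emeasure lborel S + emeasure lborel (U - S)"
      using U bS by (intro plus_emeasure[symmetric]) auto
    also have "\<dots> \<le> emeasure lborel S + ennreal e" using U by (intro add_left_mono) auto
    finally show "emeasure lborel T \<le> emeasure lborel S + ennreal e" .
  qed
qed

section \<open>Self-similarity of the unit cube in a hyperplane\<close>

definition unit_face :: "'a::euclidean_space \<Rightarrow> 'a set" where
  "unit_face b = {x. x \<bullet> b = 0 \<and> (\<forall>j\<in>Basis - {b}. 0 \<le> x \<bullet> j \<and> x \<bullet> j \<le> 1)}"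

lemma unit_face_eq_cbox:
  assumes "b \<in> Basis"
  shows "unit_face b = cbox 0 (\<Sum>j\<in>Basis - {b}. j)"
  using assms unfolding unit_face_def
  by (force simp: mem_box inner_sum_left_Basis inner_sum_left inner_Basis)

text \<open>The grid cells of side \<open>1 / N\<close> that meet \<open>Q\<close> are scaled copies
  of the unit face, so each has content at most a known multiple of the content of the face. The
  boxes of height 1 over the cells form \<open>T\<close>, whose volume counts the cells; a bound on
  content thus becomes the volume of a set close to the slab over \<open>Q\<close>.\<close>

lemma grid_bound:
  fixes b :: "'a::euclidean_space" and N :: nat
  assumes b: "b \<in> Basis" and Q: "bounded Q" "\<And>q. q \<in> Q \<Longrightarrow> q \<bullet> b = 0" and N: "0 < N" and d: "0 \<le> \<delta>"
  obtains T where "T \<in> sets borel" "\<And>x. x \<in> T \<Longrightarrow> \<exists>s\<in>slab b Q 0 1. dist x s \<le> DIM('a) / N"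
    "hausdorff_content (DIM('a) - 1) (\<delta> / N) Q
      \<le> emeasure lborel T * hausdorff_content (DIM('a) - 1) \<delta> (unit_face b)"
proof -
  let ?B = "Basis - {b}" and ?k = "DIM('a) - 1"
  define idx where "idx x = (\<lambda>j\<in>?B. \<lfloor>real N * (x \<bullet> j)\<rfloor>)" for x :: 'a
  define Z where "Z = idx ` Q"
  define base where "base z = (1 / real N) *\<^sub>R (\<Sum>j\<in>?B. real_of_int (z j) *\<^sub>R j)" for z :: "'a \<Rightarrow> int"
  define cell where "cell z = (\<lambda>x. base z + (1 / real N) *\<^sub>R x) ` unit_face b" for z
  define upper where "upper z = base z + (1 / real N) *\<^sub>R (\<Sum>j\<in>?B. j) + b" for z
  have base_b: "base z \<bullet> b = 0" for z
    using b by (simp add: base_def inner_sum_left inner_not_same_Basis)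
  have base_j: "base z \<bullet> j = z j / N" if "j \<in> ?B" for z j
    using that by (simp add: base_def inner_sum_left inner_Basis if_distrib sum.delta cong: if_cong)
  have sum_b: "(\<Sum>j\<in>?B. j) \<bullet> b = 0" and sum_j: "j \<in> ?B \<Longrightarrow> (\<Sum>j\<in>?B. j) \<bullet> j = 1" for j
    using b by (simp_all add: inner_sum_left inner_Basis sum.delta)
  have upper_b: "upper z \<bullet> b = 1" for z
    using b base_b sum_b by (simp add: upper_def inner_add_left)
  have upper_j: "upper z \<bullet> j = (z j + 1) / N" if "j \<in> ?B" for z j
    using that base_j[OF that, of z] sum_j[OF that] inner_not_same_Basis[OF b, of j]
    by (auto simp add: upper_def inner_add_left add_divide_distrib)
  have k: "card ?B = ?k" using b by (simp add: card_Diff_singleton)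
  have finZ: "finite Z"
  proof -
    obtain M where M: "\<And>x. x \<in> Q \<Longrightarrow> norm x \<le> M" using Q(1) by (auto simp: bounded_iff)
    have "Z \<subseteq> PiE ?B (\<lambda>_. {-\<lceil>N * M\<rceil> - 1..\<lceil>N * M\<rceil>})"
    proof
      fix z assume "z \<in> Z"
      then obtain x where x: "x \<in> Q" "z = idx x" by (auto simp: Z_def)
      have "\<bar>real N * (x \<bullet> j)\<bar> \<le> N * M" if "j \<in> ?B" for j
        using Basis_le_norm[of j x] M[OF x(1)] that N by (simp add: abs_mult)
      then have "\<lfloor>real N * (x \<bullet> j)\<rfloor> \<in> {-\<lceil>N * M\<rceil> - 1..\<lceil>N * M\<rceil>}" if "j \<in> ?B" for j
      proof -
        have "- (N * M) \<le> real N * (x \<bullet> j)" "real N * (x \<bullet> j) \<le> N * M"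
          using \<open>\<And>j. j \<in> ?B \<Longrightarrow> \<bar>real N * (x \<bullet> j)\<bar> \<le> N * M\<close>[OF that] by (auto simp: abs_le_iff)
        then show ?thesis unfolding atLeastAtMost_iff by linarith
      qed
      then show "z \<in> PiE ?B (\<lambda>_. {-\<lceil>N * M\<rceil> - 1..\<lceil>N * M\<rceil>})" by (auto simp: x idx_def)
    qed
    then show ?thesis by (rule finite_subset) (auto intro: finite_PiE)
  qed
  have floor_bounds: "idx x j / N \<le> x \<bullet> j" "x \<bullet> j \<le> (idx x j + 1) / N" if "j \<in> ?B" for x j
    using that N of_int_floor_le[of "real N * (x \<bullet> j)"] real_of_int_floor_add_one_ge[of "real N * (x \<bullet> j)"]
    by (auto simp: idx_def divide_le_eq le_divide_eq mult.commute)
  have cover: "Q \<subseteq> (\<Union>z\<in>Z. cell z)"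
  proof
    fix x assume x: "x \<in> Q"
    have "x \<in> cell (idx x)"
      unfolding cell_def
    proof (rule image_eqI)
      show "x = base (idx x) + (1 / real N) *\<^sub>R (real N *\<^sub>R (x - base (idx x)))" using N by simp
      show "real N *\<^sub>R (x - base (idx x)) \<in> unit_face b"
        using Q(2)[OF x] base_b base_j floor_bounds[of _ x] N
        by (auto simp: unit_face_def inner_diff_left field_simps)
    qed
    then show "x \<in> (\<Union>z\<in>Z. cell z)" using x by (auto simp: Z_def)
  qed
  \<comment> \<open>Open boxes are pairwise disjoint although neighbouring closed cells share faces,
    so the volumes add up exactly.\<close>
  let ?T = "\<Union>z\<in>Z. box (base z) (upper z)"
  have T_mem: "0 < x \<bullet> b" "x \<bullet> b < 1" "\<And>j. j \<in> ?B \<Longrightarrow> real_of_int (z j) / N < x \<bullet> j \<and> x \<bullet> j < real_of_int (z j + 1) / N"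
    if "x \<in> box (base z) (upper z)" for x and z :: "'a \<Rightarrow> int"
  proof -
    have lt: "base z \<bullet> j < x \<bullet> j \<and> x \<bullet> j < upper z \<bullet> j" if "j \<in> Basis" for j
      using \<open>x \<in> box (base z) (upper z)\<close> that by (simp add: mem_box)
    show "0 < x \<bullet> b" "x \<bullet> b < 1" using lt[OF b] base_b upper_b by auto
    fix j assume j: "j \<in> ?B"
    show "real_of_int (z j) / N < x \<bullet> j \<and> x \<bullet> j < real_of_int (z j + 1) / N"
      using lt[of j] j base_j[OF j] upper_j[OF j] by auto
  qed
  have disj: "disjoint_family_on (\<lambda>z. box (base z) (upper z)) Z"
  proof (unfold disjoint_family_on_def, intro ballI impI)
    fix z z' assume z: "z \<in> Z" "z' \<in> Z" "z \<noteq> z'"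
    show "box (base z) (upper z) \<inter> box (base z') (upper z') = {}"
    proof (rule ccontr)
      assume "\<not> ?thesis"
      then obtain x where x: "x \<in> box (base z) (upper z)" "x \<in> box (base z') (upper z')" by blast
      have fl: "w j = \<lfloor>real N * (x \<bullet> j)\<rfloor>" if "x \<in> box (base w) (upper w)" "j \<in> ?B" for w j
        using T_mem(3)[OF that] N by (intro floor_unique[symmetric]) (auto simp: field_simps)
      have "z j = z' j" for j
        using fl[OF x(1), of j] fl[OF x(2), of j] z by (cases "j \<in> ?B") (auto simp: Z_def idx_def)
      then show False using z by auto
    qed
  qed
  have vol: "emeasure lborel (box (base z) (upper z)) = ennreal ((1 / N) ^ ?k)" for z
  proof -
    have d: "(upper z - base z) \<bullet> j = (if j = b then 1 else 1 / N)" if "j \<in> Basis" for j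
      using that base_b[of z] upper_b[of z] base_j[of j z] upper_j[of j z]
      by (auto simp: inner_diff_left add_divide_distrib)
    have "emeasure lborel (box (base z) (upper z)) = ennreal (\<Prod>j\<in>Basis. (upper z - base z) \<bullet> j)"
    proof (rule emeasure_lborel_box)
      fix j :: 'a assume "j \<in> Basis"
      from d[OF this] have "0 \<le> (upper z - base z) \<bullet> j" by simp
      then show "base z \<bullet> j \<le> upper z \<bullet> j" by (simp add: inner_diff_left)
    qed
    also have "(\<Prod>j\<in>Basis. (upper z - base z) \<bullet> j) = (\<Prod>j\<in>Basis. if j = b then 1 else 1 / N)"
      using d by (intro prod.cong) auto
    also have "\<dots> = (\<Prod>j\<in>?B. 1 / N)"
      using b by (subst prod.remove[OF finite_Basis b]) (auto intro!: prod.cong)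
    also have "\<dots> = (1 / N) ^ ?k" by (simp add: k)
    finally show ?thesis .
  qed
  have volT: "emeasure lborel ?T = of_nat (card Z) * ennreal ((1 / N) ^ ?k)"
    using disj finZ by (subst sum_emeasure[symmetric]) (auto simp: vol)
  show ?thesis
  proof (rule that[of ?T])
    show "?T \<in> sets borel" using finZ by (intro sets.finite_UN) auto
    show "\<exists>s\<in>slab b Q 0 1. dist x s \<le> DIM('a) / N" if "x \<in> ?T" for x
    proof -
      obtain q where q: "q \<in> Q" and xq: "x \<in> box (base (idx q)) (upper (idx q))"
        using \<open>x \<in> ?T\<close> by (auto simp: Z_def)
      \<comment> \<open>The witness has the height of \<open>x\<close> and its foot \<open>q\<close>
        in the same cell, so every coordinate differs by at most \<open>1 / N\<close>.\<close>
      let ?s = "q + (x \<bullet> b) *\<^sub>R b"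
      have sb: "?s \<bullet> b = x \<bullet> b" using b Q(2)[OF q] by (simp add: inner_add_left)
      have "?s \<in> slab b Q 0 1" using T_mem[OF xq] q sb by (simp add: slab_def)
      moreover have "\<bar>(x - ?s) \<bullet> j\<bar> \<le> 1 / N" if j: "j \<in> Basis" for j
      proof (cases "j = b")
        case True
        then show ?thesis using sb by (simp add: inner_diff_left)
      next
        case False
        with j have "j \<in> ?B" by simp
        have "?s \<bullet> j = q \<bullet> j" using False j b by (simp add: inner_add_left inner_not_same_Basis)
        then show ?thesis
          using T_mem(3)[OF xq \<open>j \<in> ?B\<close>] floor_bounds[OF \<open>j \<in> ?B\<close>, of q]
          by (auto simp: inner_diff_left abs_le_iff add_divide_distrib)
      qed
      then have "norm (x - ?s) \<le> DIM('a) * (1 / N)"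
        by (intro order_trans[OF norm_le_l1] sum_bounded_above)
      ultimately show ?thesis by (auto simp: dist_norm)
    qed
    have "hausdorff_content ?k (\<delta> / N) Q \<le> (\<Sum>z\<in>Z. hausdorff_content ?k (\<delta> / N) (cell z))"
      using d finZ by (intro order_trans[OF hausdorff_content_mono[OF cover]] hausdorff_content_finite_subadditive) auto
    also have "\<dots> \<le> (\<Sum>z\<in>Z. ennreal ((1 / N) ^ ?k) * hausdorff_content ?k \<delta> (unit_face b))"
    proof (rule sum_mono)
      fix z
      have "(1 / N)-lipschitz_on (unit_face b) (\<lambda>x. base z + (1 / real N) *\<^sub>R x)"
        by (intro lipschitz_onI) (auto simp: dist_norm simp flip: scaleR_diff_right)
      from hausdorff_content_lipschitz_image[OF this _ d, of ?k]
      show "hausdorff_content ?k (\<delta> / N) (cell z) \<le> ennreal ((1 / N) ^ ?k) * hausdorff_content ?k \<delta> (unit_face b)"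
        using N by (simp add: cell_def)
    qed
    also have "\<dots> = emeasure lborel ?T * hausdorff_content ?k \<delta> (unit_face b)"
      by (simp add: volT mult.assoc)
    finally show "hausdorff_content ?k (\<delta> / N) Q \<le> emeasure lborel ?T * hausdorff_content ?k \<delta> (unit_face b)" .
  qed
qed

lemma translate_slab_cball:
  fixes b :: "'a::euclidean_space"
  assumes "c \<bullet> b = 0"
  shows "emeasure lborel (slab b (cball c r) 0 1) = emeasure lborel (slab b (cball 0 r) 0 1)"
proof -
  have "emeasure lborel (slab b (cball c r) 0 1) = emeasure (distr lborel borel ((+) c)) (slab b (cball c r) 0 1)"
    by (simp add: lborel_distr_plus)
  also have "\<dots> = emeasure lborel ((+) c -` slab b (cball c r) 0 1)"
    by (subst emeasure_distr) (auto intro: slab_measurable)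
  also have "(+) c -` slab b (cball c r) 0 1 = slab b (cball 0 r) 0 1"
    using assms by (auto simp: slab_def inner_add_left dist_norm norm_minus_commute add_diff_eq[symmetric])
  finally show ?thesis .
qed

text \<open>\<open>N\<close> is fixed before \<open>\<delta>\<close>: one subdivision works at all
  scales, so the scale on either side can be prescribed afterwards. The bound \<open>M\<close> lets
  \<open>N\<close> be as large as a later rescaling requires.\<close>

lemma hausdorff_content_grid:
  fixes b :: "'a::euclidean_space" and M :: real
  assumes b: "b \<in> Basis" and Q: "compact Q" "\<And>q. q \<in> Q \<Longrightarrow> q \<bullet> b = 0" and e: "0 < e" and M: "0 < M"
  obtains N :: nat where "M < N"
    "\<And>\<delta>. 0 \<le> \<delta> \<Longrightarrow> hausdorff_content (DIM('a) - 1) (\<delta> / N) Q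
      \<le> (emeasure lborel (slab b Q 0 1) + ennreal e) * hausdorff_content (DIM('a) - 1) \<delta> (unit_face b)"
proof -
  have "compact (slab b Q 0 1)" using b Q by (intro compact_slab) auto
  then obtain \<rho> where \<rho>: "0 < \<rho>" "\<And>T. T \<in> sets borel \<Longrightarrow> (\<And>x. x \<in> T \<Longrightarrow> \<exists>s\<in>slab b Q 0 1. dist x s \<le> \<rho>) \<Longrightarrow>
    emeasure lborel T \<le> emeasure lborel (slab b Q 0 1) + ennreal e"
    using compact_thickening[OF _ e] by metis
  obtain N :: nat where N: "max (DIM('a) / \<rho>) M < N" using reals_Archimedean2 by blast
  have N0: "0 < N" using N M by (auto intro: gr0I)
  have small: "DIM('a) / N \<le> \<rho>" using N \<rho>(1) N0 by (auto simp: divide_less_eq divide_le_eq mult.commute)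
  show ?thesis
  proof (rule that[of N])
    fix \<delta> :: real assume d: "0 \<le> \<delta>"
    obtain T where T: "T \<in> sets borel" "\<And>x. x \<in> T \<Longrightarrow> \<exists>s\<in>slab b Q 0 1. dist x s \<le> DIM('a) / N"
      "hausdorff_content (DIM('a) - 1) (\<delta> / N) Q \<le> emeasure lborel T * hausdorff_content (DIM('a) - 1) \<delta> (unit_face b)"
      using grid_bound[OF b compact_imp_bounded[OF Q(1)] Q(2) N0 d] by metis
    have "emeasure lborel T \<le> emeasure lborel (slab b Q 0 1) + ennreal e"
      using T(1,2) small by (intro \<rho>(2)) (metis order_trans)+
    then show "hausdorff_content (DIM('a) - 1) (\<delta> / N) Q
      \<le> (emeasure lborel (slab b Q 0 1) + ennreal e) * hausdorff_content (DIM('a) - 1) \<delta> (unit_face b)"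
      by (intro order_trans[OF T(3)] mult_right_mono) auto
  qed (use N in auto)
qed

lemma hausdorff_measure_le_slab:
  fixes b :: "'a::euclidean_space"
  assumes b: "b \<in> Basis" and Q: "compact Q" "\<And>q. q \<in> Q \<Longrightarrow> q \<bullet> b = 0"
    and fin: "hausdorff_measure (DIM('a) - 1) (unit_face b) < top"
  shows "hausdorff_measure (DIM('a) - 1) Q
    \<le> emeasure lborel (slab b Q 0 1) * hausdorff_measure (DIM('a) - 1) (unit_face b)"
proof (rule hausdorff_measure_least)
  fix \<delta> :: real assume d: "0 < \<delta>"
  obtain c where c: "hausdorff_measure (DIM('a) - 1) (unit_face b) = ennreal c" "0 \<le> c"
    using fin by (cases "hausdorff_measure (DIM('a) - 1) (unit_face b)") auto
  show "hausdorff_content (DIM('a) - 1) \<delta> Q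
    \<le> emeasure lborel (slab b Q 0 1) * hausdorff_measure (DIM('a) - 1) (unit_face b)"
  proof (rule ennreal_le_epsilon)
    fix e :: real assume e: "0 < e"
    \<comment> \<open>Dividing by \<open>c + 1\<close> keeps the final error
      \<open>e * c / (c + 1)\<close> below \<open>e\<close> and also covers
      \<open>c = 0\<close>.\<close>
    obtain N :: nat where N: "1 < real N" "\<And>\<delta>. 0 \<le> \<delta> \<Longrightarrow> hausdorff_content (DIM('a) - 1) (\<delta> / N) Q
      \<le> (emeasure lborel (slab b Q 0 1) + ennreal (e / (c + 1))) * hausdorff_content (DIM('a) - 1) \<delta> (unit_face b)"
      using e c by (rule_tac hausdorff_content_grid[OF b Q, of "e / (c + 1)" 1]) auto
    \<comment> \<open>Starting from the scale \<open>\<delta> * N\<close>, the subdivision lands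
      exactly at \<open>\<delta>\<close>.\<close>
    have "hausdorff_content (DIM('a) - 1) (\<delta> * N / N) Q
      \<le> (emeasure lborel (slab b Q 0 1) + ennreal (e / (c + 1))) * hausdorff_content (DIM('a) - 1) (\<delta> * N) (unit_face b)"
      using d by (intro N(2)) simp
    also have "\<dots> \<le> (emeasure lborel (slab b Q 0 1) + ennreal (e / (c + 1))) * ennreal c"
      using d N(1) by (intro mult_left_mono) (auto simp flip: c(1) intro!: hausdorff_content_le_measure)
    also have "\<dots> = emeasure lborel (slab b Q 0 1) * ennreal c + ennreal (e / (c + 1) * c)"
      using c(2) e by (simp only: distrib_right ennreal_mult'[symmetric] ennreal_mult''[symmetric] mult_1_left)
    also have "\<dots> \<le> emeasure lborel (slab b Q 0 1) * ennreal c + ennreal e"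
      using c e by (intro add_left_mono ennreal_leI) (simp add: divide_le_eq)
    finally show "hausdorff_content (DIM('a) - 1) \<delta> Q
      \<le> emeasure lborel (slab b Q 0 1) * hausdorff_measure (DIM('a) - 1) (unit_face b) + ennreal e"
      using N(1) c by simp
  qed
qed

lemma compact_unit_face:
  assumes "b \<in> Basis"
  shows "compact (unit_face b)"
  using assms by (simp add: unit_face_eq_cbox)

lemma emeasure_slab_unit_face:
  assumes b: "b \<in> Basis"
  shows "emeasure lborel (slab b (unit_face b) 0 1) = 1"
proof -
  have "slab b (unit_face b) 0 1 = cbox 0 One"
  proof (intro set_eqI)
    fix x :: 'a
    have pb: "(x - (x \<bullet> b) *\<^sub>R b) \<bullet> b = 0" using b by (simp add: inner_diff_left)
    have pj: "(x - (x \<bullet> b) *\<^sub>R b) \<bullet> j = x \<bullet> j" if "j \<in> Basis" "j \<noteq> b" for j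
      using b that by (simp add: inner_diff_left inner_not_same_Basis)
    show "x \<in> slab b (unit_face b) 0 1 \<longleftrightarrow> x \<in> cbox 0 One"
    proof -
      have "x \<in> slab b (unit_face b) 0 1 \<longleftrightarrow>
          (\<forall>j\<in>Basis - {b}. 0 \<le> x \<bullet> j \<and> x \<bullet> j \<le> 1) \<and> 0 \<le> x \<bullet> b \<and> x \<bullet> b \<le> 1"
      proof -
        have "(\<forall>j\<in>Basis - {b}. 0 \<le> (x - (x \<bullet> b) *\<^sub>R b) \<bullet> j \<and> (x - (x \<bullet> b) *\<^sub>R b) \<bullet> j \<le> 1)
            \<longleftrightarrow> (\<forall>j\<in>Basis - {b}. 0 \<le> x \<bullet> j \<and> x \<bullet> j \<le> 1)"
          using pj by (metis DiffE singletonI)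
        then show ?thesis unfolding slab_def unit_face_def mem_Collect_eq using pb by blast
      qed
      also have "\<dots> \<longleftrightarrow> (\<forall>j\<in>Basis. 0 \<le> x \<bullet> j \<and> x \<bullet> j \<le> 1)" using b by blast
      also have "\<dots> \<longleftrightarrow> x \<in> cbox 0 One" by (simp add: mem_box)
      finally show ?thesis .
    qed
  qed
  then show ?thesis by simp
qed

text \<open>The slab over the unit face has volume 1, so subdividing the face reproduces its content
  at the coarse scale up to an arbitrarily small error, and \<open>N\<close> beyond
  \<open>\<delta> / \<eta>\<close> brings the fine scale below \<open>\<eta>\<close>. A finite
  content at one scale therefore bounds the measure itself.\<close>

lemma hausdorff_measure_unit_face_self_similar:
  fixes b :: "'a::euclidean_space"
  assumes b: "b \<in> Basis" and d: "0 < \<delta>"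
    and fin: "hausdorff_content (DIM('a) - 1) \<delta> (unit_face b) < top"
  shows "hausdorff_measure (DIM('a) - 1) (unit_face b) \<le> hausdorff_content (DIM('a) - 1) \<delta> (unit_face b)"
proof (rule hausdorff_measure_least)
  fix \<eta> :: real assume \<eta>: "0 < \<eta>"
  obtain c where c: "hausdorff_content (DIM('a) - 1) \<delta> (unit_face b) = ennreal c" "0 \<le> c"
    using fin by (cases "hausdorff_content (DIM('a) - 1) \<delta> (unit_face b)") auto
  show "hausdorff_content (DIM('a) - 1) \<eta> (unit_face b) \<le> hausdorff_content (DIM('a) - 1) \<delta> (unit_face b)"
  proof (rule ennreal_le_epsilon)
    fix e :: real assume e: "0 < e"
    have W: "compact (unit_face b)" "\<And>q. q \<in> unit_face b \<Longrightarrow> q \<bullet> b = 0"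
      using compact_unit_face[OF b] by (auto simp: unit_face_def)
    obtain N :: nat where N: "\<delta> / \<eta> < real N" "\<And>\<delta>. 0 \<le> \<delta> \<Longrightarrow> hausdorff_content (DIM('a) - 1) (\<delta> / N) (unit_face b)
      \<le> (emeasure lborel (slab b (unit_face b) 0 1) + ennreal (e / (c + 1))) * hausdorff_content (DIM('a) - 1) \<delta> (unit_face b)"
      using e c d \<eta> by (rule_tac hausdorff_content_grid[OF b W, of "e / (c + 1)" "\<delta> / \<eta>"]) auto
    have N0: "0 < real N" using N(1) divide_pos_pos[OF d \<eta>] by linarith
    have "\<delta> / N \<le> \<eta>" using N(1) \<eta> N0 by (auto simp: divide_less_eq divide_le_eq mult.commute)
    then have "hausdorff_content (DIM('a) - 1) \<eta> (unit_face b) \<le> hausdorff_content (DIM('a) - 1) (\<delta> / N) (unit_face b)"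
      by (rule hausdorff_content_antimono)
    also have "\<dots> \<le> (1 + ennreal (e / (c + 1))) * ennreal c"
      using N(2)[of \<delta>] d b c by (simp add: emeasure_slab_unit_face)
    also have "\<dots> = ennreal c + ennreal (e / (c + 1) * c)"
      using c(2) e by (simp only: distrib_right ennreal_mult'[symmetric] ennreal_mult''[symmetric] mult_1_left)
    also have "\<dots> \<le> ennreal c + ennreal e"
      using c e by (intro add_left_mono ennreal_leI) (simp add: divide_le_eq)
    finally show "hausdorff_content (DIM('a) - 1) \<eta> (unit_face b)
      \<le> hausdorff_content (DIM('a) - 1) \<delta> (unit_face b) + ennreal e" by (simp only: c(1))
  qed
qed

text \<open>By self-similarity the measure of the unit face is at most its content at scale 1.
  Splitting off the inscribed ball, whose content is its volume, gives
  \<open>c \<le> \<theta> + c (1 - \<theta>)\<close> for the measure \<open>c\<close> of the face and the volume \<open>\<theta>\<close> of the ball.\<close>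

lemma hausdorff_measure_unit_face:
  fixes b :: "'a::euclidean_space"
  assumes b: "b \<in> Basis" and dim: "2 \<le> DIM('a)"
  shows "hausdorff_measure (DIM('a) - 1) (unit_face b) \<le> 1"
proof -
  let ?k = "DIM('a) - 1" and ?W = "unit_face b"
  let ?\<omega> = "unit_ball_vol (real ?k)"
  have \<omega>: "0 < ?\<omega>" by (rule unit_ball_vol_pos) simp
  have bW: "bounded ?W" using compact_imp_bounded[OF compact_unit_face[OF b]] .
  \<comment> \<open>The face covers itself, which gives a finite content at a coarse scale;
    self-similarity turns this into finite measure.\<close>
  have fin1: "hausdorff_content ?k (diameter ?W + 1) ?W < top"
  proof -
    have "hausdorff_content ?k (diameter ?W + 1) ?W \<le> ball_content ?k ?W"
      using diameter_ge_0[OF bW] by (intro hausdorff_content_le_ball_content bW) auto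
    also have "\<dots> < top" by (simp add: ball_content_def)
    finally show ?thesis .
  qed
  have fin: "hausdorff_measure ?k ?W < top"
    using diameter_ge_0[OF bW]
    by (intro le_less_trans[OF hausdorff_measure_unit_face_self_similar[OF b _ fin1] fin1]) auto
  have fin2: "hausdorff_content ?k 1 ?W < top"
    by (rule le_less_trans[OF hausdorff_content_le_measure fin]) simp
  obtain c where c: "hausdorff_measure ?k ?W = ennreal c" "0 \<le> c"
    using fin by (cases "hausdorff_measure ?k ?W") auto
  define p where "p = (1/2) *\<^sub>R (\<Sum>j\<in>Basis - {b}. j)"
  have pb: "p \<bullet> b = 0" and pj: "\<And>j. j \<in> Basis \<Longrightarrow> j \<noteq> b \<Longrightarrow> p \<bullet> j = 1/2"
    using b by (simp_all add: p_def inner_sum_left inner_Basis sum.delta)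
  have main: "c * r ^ ?k \<le> (1/2) ^ ?k" if r: "0 < r" "r < 1/2" for r
  proof -
    \<comment> \<open>Two radii are in play: removing the open ball of radius 1/2 leaves a compact
      set, as the slab bound requires, while the removed volume is estimated from below by a smaller
      closed ball.\<close>
    have sub: "slab b (cball p r) 0 1 \<subseteq> slab b ?W 0 1"
    proof
      fix x assume x: "x \<in> slab b (cball p r) 0 1"
      let ?y = "x - (x \<bullet> b) *\<^sub>R b"
      have "\<bar>(?y - p) \<bullet> j\<bar> \<le> 1/2" if "j \<in> Basis" for j
        using Basis_le_norm[OF that, of "?y - p"] x r by (auto simp: slab_def dist_norm norm_minus_commute)
      moreover have "?y \<bullet> b = 0" using b by (simp add: inner_diff_left)
      ultimately have "?y \<in> ?W"
        unfolding unit_face_def mem_Collect_eq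
      proof (intro conjI ballI)
        fix j assume j: "j \<in> Basis - {b}"
        have "(?y - p) \<bullet> j = ?y \<bullet> j - 1/2" using pj[of j] j by (simp add: inner_diff_left[of _ p])
        then have "\<bar>?y \<bullet> j - 1/2\<bar> \<le> 1/2" using \<open>\<And>j. j \<in> Basis \<Longrightarrow> \<bar>(?y - p) \<bullet> j\<bar> \<le> 1/2\<close>[of j] j by simp
        then show "0 \<le> ?y \<bullet> j" "?y \<bullet> j \<le> 1" by linarith+
      qed
      then show "x \<in> slab b ?W 0 1" using x by (simp add: slab_def)
    qed
    have mW: "?W \<in> sets borel" using compact_unit_face[OF b] by (simp add: borel_compact)
    have "emeasure lborel (slab b (?W - ball p (1/2)) 0 1) \<le> emeasure lborel (slab b ?W 0 1 - slab b (cball p r) 0 1)"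
      using r mW by (intro emeasure_mono) (auto simp: slab_def intro!: sets.Diff slab_measurable)
    also have "\<dots> = emeasure lborel (slab b ?W 0 1) - emeasure lborel (slab b (cball p r) 0 1)"
      using sub mW r by (intro emeasure_Diff)
        (auto intro!: slab_measurable simp: translate_slab_cball[OF pb] emeasure_slab_cball[OF b])
    also have "\<dots> = 1 - ennreal (?\<omega> * r ^ ?k)"
      using r by (simp add: emeasure_slab_unit_face[OF b] translate_slab_cball[OF pb] emeasure_slab_cball[OF b])
    finally have rest: "emeasure lborel (slab b (?W - ball p (1/2)) 0 1) \<le> 1 - ennreal (?\<omega> * r ^ ?k)" .
    have le1: "?\<omega> * r ^ ?k \<le> 1"
    proof -
      have "ennreal (?\<omega> * r ^ ?k) \<le> 1"
        using emeasure_mono[OF sub, of lborel] mW r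
        by (simp add: slab_measurable emeasure_slab_unit_face[OF b] translate_slab_cball[OF pb] emeasure_slab_cball[OF b])
      then show ?thesis by simp
    qed
    have "ennreal c \<le> hausdorff_content ?k 1 ?W"
      unfolding c(1)[symmetric] by (rule hausdorff_measure_unit_face_self_similar[OF b _ fin2]) simp
    also have "\<dots> \<le> hausdorff_content ?k 1 (ball p (1/2) \<union> (?W - ball p (1/2)))"
      by (rule hausdorff_content_mono) auto
    also have "\<dots> \<le> hausdorff_content ?k 1 (ball p (1/2)) + hausdorff_content ?k 1 (?W - ball p (1/2))"
      by (rule hausdorff_content_Un) simp
    also have "\<dots> \<le> ball_content ?k (ball p (1/2)) + hausdorff_measure ?k (?W - ball p (1/2))"
      by (intro add_mono hausdorff_content_le_ball_content hausdorff_content_le_measure) auto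
    also have "\<dots> \<le> ennreal (?\<omega> * (1/2) ^ ?k) + (1 - ennreal (?\<omega> * r ^ ?k)) * ennreal c"
    proof (rule add_mono)
      show "ball_content ?k (ball p (1/2)) \<le> ennreal (?\<omega> * (1/2) ^ ?k)" by (simp add: ball_content_def)
      have "hausdorff_measure ?k (?W - ball p (1/2))
          \<le> emeasure lborel (slab b (?W - ball p (1/2)) 0 1) * hausdorff_measure ?k ?W"
        using compact_unit_face[OF b] fin
        by (intro hausdorff_measure_le_slab b compact_diff) (auto simp: unit_face_def)
      also have "\<dots> \<le> (1 - ennreal (?\<omega> * r ^ ?k)) * ennreal c"
        unfolding c(1) by (intro mult_right_mono rest) auto
      finally show "hausdorff_measure ?k (?W - ball p (1/2)) \<le> (1 - ennreal (?\<omega> * r ^ ?k)) * ennreal c" .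
    qed
    also have "\<dots> = ennreal (?\<omega> * (1/2) ^ ?k + (1 - ?\<omega> * r ^ ?k) * c)"
    proof -
      have *: "ennreal u + (1 - ennreal v) * ennreal c = ennreal (u + (1 - v) * c)"
        if "0 \<le> u" "0 \<le> v" "v \<le> 1" for u v
      proof -
        have "1 - ennreal v = ennreal (1 - v)" using that by (simp add: ennreal_minus flip: ennreal_1)
        then show ?thesis using that c(2) by (simp add: ennreal_mult'[symmetric])
      qed
      show ?thesis using le1 \<omega> r by (intro *) auto
    qed
    finally have "c \<le> ?\<omega> * (1/2) ^ ?k + (1 - ?\<omega> * r ^ ?k) * c"
      using le1 c \<omega> by (subst (asm) ennreal_le_iff) auto
    then have "?\<omega> * (c * r ^ ?k) \<le> ?\<omega> * (1/2) ^ ?k" by (simp add: algebra_simps)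
    then show ?thesis using \<omega> by (simp only: mult_le_cancel_left_pos)
  qed
  \<comment> \<open>The ball constant has cancelled; letting the inner radius tend to 1/2 leaves
    \<open>c \<le> 1\<close>.\<close>
  have "((\<lambda>r. c * r ^ ?k) \<longlongrightarrow> c * (1/2) ^ ?k) (at_left (1/2))" by (intro tendsto_intros)
  moreover have "eventually (\<lambda>r::real. c * r ^ ?k \<le> (1/2) ^ ?k) (at_left (1/2))"
    using eventually_at_left_real[of 0 "1/2 :: real"] by (rule eventually_mono) (use main in auto)
  ultimately have "c * (1/2) ^ ?k \<le> (1/2) ^ ?k"
    by (intro tendsto_upperbound[where F="at_left (1/2)"]) auto
  then have "c \<le> 1" by (simp add: mult_le_cancel_right2 power_divide divide_le_cancel)
  then show ?thesis by (simp only: c(1) ennreal_le_1)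
qed

theorem hausdorff_measure_eq_slab:
  fixes b :: "'a::euclidean_space"
  assumes b: "b \<in> Basis" and dim: "2 \<le> DIM('a)" and Q: "compact Q" "\<And>q. q \<in> Q \<Longrightarrow> q \<bullet> b = 0"
  shows "hausdorff_measure (DIM('a) - 1) Q = emeasure lborel (slab b Q 0 1)"
proof (rule antisym)
  have "hausdorff_measure (DIM('a) - 1) Q
    \<le> emeasure lborel (slab b Q 0 1) * hausdorff_measure (DIM('a) - 1) (unit_face b)"
    using hausdorff_measure_unit_face[OF b dim]
    by (intro hausdorff_measure_le_slab b Q) (auto intro: le_less_trans)
  also have "\<dots> \<le> emeasure lborel (slab b Q 0 1) * 1"
    by (intro mult_left_mono hausdorff_measure_unit_face b dim) auto
  finally show "hausdorff_measure (DIM('a) - 1) Q \<le> emeasure lborel (slab b Q 0 1)" by simp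
qed (rule slab_le_hausdorff_measure[OF b Q(2)])

section \<open>Volumes of cones over flat sets\<close>

text \<open>Vitali's theorem fills \<open>E\<close> up to a null set with disjoint balls inside a
  slightly larger open set, and \<open>f\<close> maps each ball to one of the same radius. The null
  remainder stays null because \<open>f\<close> is Lipschitz.\<close>

lemma emeasure_orthogonal_image_le:
  fixes f :: "'a::euclidean_space \<Rightarrow> 'a"
  assumes f: "orthogonal_transformation f" and E: "compact E"
  shows "emeasure lborel (f ` E) \<le> emeasure lborel E"
proof (rule ennreal_le_epsilon)
  fix e :: real assume e: "0 < e"
  have lin: "linear f" using f by (rule orthogonal_transformation_linear)
  have bE: "E \<in> sets borel" using E by (simp add: borel_compact)
  obtain U where U: "open U" "E \<subseteq> U" "emeasure lborel (U - E) < ennreal e"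
    using outer_regular_lborel[OF bE e] by blast
  let ?K = "{(a, r). 0 < r \<and> cball a r \<subseteq> U}"
  have fine: "\<exists>i. i \<in> ?K \<and> x \<in> cball (fst i) (snd i) \<and> snd i < d" if x: "x \<in> E" and d: "0 < d" for x and d :: real
  proof -
    obtain r where r: "0 < r" "cball x r \<subseteq> U" using U x open_contains_cball by blast
    have "cball x (min r (d/2)) \<subseteq> U" using r(2) by auto
    then show ?thesis using r(1) d by (intro exI[of _ "(x, min r (d/2))"]) auto
  qed
  have pos: "\<And>i. i \<in> ?K \<Longrightarrow> 0 < snd i" by auto
  obtain C where C: "countable C" "C \<subseteq> ?K"
    "pairwise (\<lambda>i j. disjnt (cball (fst i) (snd i)) (cball (fst j) (snd j))) C"
    "negligible (E - (\<Union>i\<in>C. cball (fst i) (snd i)))"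
    by (rule Vitali_covering_theorem_cballs[of ?K snd E fst, OF pos fine])
  let ?N = "E - (\<Union>i\<in>C. cball (fst i) (snd i))"
  have fN: "negligible (f ` ?N)"
    by (rule negligible_locally_Lipschitz_image[OF _ C(4)])
      (auto intro!: exI[of _ UNIV] exI[of _ 1] simp: orthogonal_transformation_norm[OF f] simp flip: linear_diff[OF lin])
  have fball: "f ` cball a r = cball (f a) r" for a r
    by (rule image_orthogonal_transformation_cball[OF f])
  let ?B = "\<Union>i\<in>C. cball (f (fst i)) (snd i)"
  have nN: "f ` ?N \<in> null_sets lebesgue" using fN by (simp add: negligible_iff_null_sets)
  have bB: "?B \<in> sets borel" using C(1) by (intro sets.countable_UN') auto
  have cover: "f ` E \<subseteq> f ` ?N \<union> ?B"
  proof
    fix y assume "y \<in> f ` E"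
    then obtain x where x: "x \<in> E" "y = f x" by blast
    show "y \<in> f ` ?N \<union> ?B"
    proof (cases "x \<in> ?N")
      case False
      then obtain i where "i \<in> C" "x \<in> cball (fst i) (snd i)" using x(1) by blast
      then have "y \<in> cball (f (fst i)) (snd i)" using x(2) fball by blast
      then show ?thesis using \<open>i \<in> C\<close> by blast
    qed (use x in blast)
  qed
  have disjf: "disjoint_family_on (\<lambda>i. cball (f (fst i)) (snd i)) C"
  proof -
    have "f ` cball (fst i) (snd i) \<inter> f ` cball (fst j) (snd j) = {}" if "i \<in> C" "j \<in> C" "i \<noteq> j" for i j
      using C(3) that orthogonal_transformation_inj[OF f]
      by (simp add: pairwise_def disjnt_def flip: image_Int)
    then show ?thesis by (simp add: disjoint_family_on_def fball)
  qed
  have cf: "compact (f ` E)"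
    by (intro compact_continuous_image E linear_continuous_on[OF lin[unfolded linear_conv_bounded_linear]])
  have "emeasure lborel (f ` E) = emeasure lebesgue (f ` E)"
    using cf by (simp add: borel_compact)
  also have "\<dots> \<le> emeasure lebesgue (f ` ?N \<union> ?B)"
    using nN bB cover by (intro emeasure_mono) auto
  also have "\<dots> \<le> emeasure lebesgue (f ` ?N) + emeasure lebesgue ?B"
    using nN bB by (intro emeasure_subadditive) auto
  also have "\<dots> = emeasure lborel ?B" using nN bB by auto
  also have "\<dots> = (\<integral>\<^sup>+i. emeasure lborel (cball (f (fst i)) (snd i)) \<partial>count_space C)"
    using C(1) disjf by (intro emeasure_UN_countable) auto
  also have "\<dots> = (\<integral>\<^sup>+i. emeasure lborel (cball (fst i) (snd i)) \<partial>count_space C)"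
    using C(2) by (intro nn_integral_cong) (auto simp: emeasure_cball)
  also have "\<dots> = emeasure lborel (\<Union>i\<in>C. cball (fst i) (snd i))"
    using C(1,3) by (intro emeasure_UN_countable[symmetric]) (auto simp: pairwise_def disjnt_def disjoint_family_on_def)
  also have "\<dots> \<le> emeasure lborel (E \<union> (U - E))"
  proof (rule emeasure_mono)
    have "cball (fst i) (snd i) \<subseteq> U" if "i \<in> C" for i using subsetD[OF C(2) that] by (cases i) simp
    then show "(\<Union>i\<in>C. cball (fst i) (snd i)) \<subseteq> E \<union> (U - E)" by blast
  qed (use U(1) bE in auto)
  also have "\<dots> \<le> emeasure lborel E + emeasure lborel (U - E)"
    using U(1) bE by (intro emeasure_subadditive) auto
  also have "\<dots> \<le> emeasure lborel E + ennreal e" using U(3) by (intro add_left_mono) auto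
  finally show "emeasure lborel (f ` E) \<le> emeasure lborel E + ennreal e" .
qed

lemma emeasure_orthogonal_image:
  fixes f :: "'a::euclidean_space \<Rightarrow> 'a"
  assumes f: "orthogonal_transformation f" and E: "compact E"
  shows "emeasure lborel (f ` E) = emeasure lborel E"
proof (rule antisym)
  have cf: "compact (f ` E)"
    using orthogonal_transformation_linear[OF f]
    by (intro compact_continuous_image E linear_continuous_on) (simp add: linear_conv_bounded_linear)
  have "emeasure lborel (inv f ` (f ` E)) \<le> emeasure lborel (f ` E)"
    by (rule emeasure_orthogonal_image_le[OF orthogonal_transformation_inv[OF f] cf])
  then show "emeasure lborel E \<le> emeasure lborel (f ` E)"
    using orthogonal_transformation_inj[OF f] by (simp add: image_inv_f_f)
qed (rule emeasure_orthogonal_image_le[OF f E])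

section \<open>Truncated cones with apex at the origin\<close>

definition cone_upto :: "real \<Rightarrow> 'a::real_vector set \<Rightarrow> 'a set" where
  "cone_upto t Q = {s *\<^sub>R q | s q. 0 \<le> s \<and> s \<le> t \<and> q \<in> Q}"

lemma cone_upto_eq_image: "cone_upto t Q = (\<lambda>z. fst z *\<^sub>R snd z) ` ({0..t} \<times> Q)"
  by (force simp: cone_upto_def)

lemma compact_cone_upto:
  fixes Q :: "'a::euclidean_space set"
  shows "compact Q \<Longrightarrow> compact (cone_upto t Q)"
  unfolding cone_upto_eq_image
  by (intro compact_continuous_image compact_Times continuous_intros compact_Icc)

lemma cone_upto_mono: "s \<le> t \<Longrightarrow> P \<subseteq> Q \<Longrightarrow> cone_upto s P \<subseteq> cone_upto t Q"
  unfolding cone_upto_def by force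

lemma cone_upto_linear_image: "linear f \<Longrightarrow> cone_upto t (f ` Q) = f ` cone_upto t Q"
  by (force simp: cone_upto_def linear_scale)

lemma emeasure_lebesgue_scaleR_image:
  fixes E :: "'a::euclidean_space set"
  assumes "0 \<le> t"
  shows "emeasure lebesgue ((*\<^sub>R) t ` E) = ennreal (t ^ DIM('a)) * emeasure lebesgue E"
proof -
  have "emeasure lebesgue ((\<lambda>x. t *\<^sub>R x + 0) ` E) = ennreal (\<bar>t\<bar> ^ DIM('a)) * emeasure lebesgue E"
    using assms by (subst emeasure_lebesgue_affine) (auto simp: ennreal_power)
  then show ?thesis using assms by simp
qed

lemma measure_lebesgue_scaleR_image:
  fixes E :: "'a::euclidean_space set"
  shows "0 < t \<Longrightarrow> measure lebesgue ((*\<^sub>R) t ` E) = t ^ DIM('a) * measure lebesgue E"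
  using measure_lebesgue_affine[of t 0 E] by simp

lemma emeasure_cone_upto:
  fixes Q :: "'a::euclidean_space set"
  assumes Q: "compact Q" and t: "0 \<le> t"
  shows "emeasure lborel (cone_upto t Q) = ennreal (t ^ DIM('a)) * emeasure lborel (cone_upto 1 Q)"
proof -
  have "cone_upto t Q = (*\<^sub>R) t ` cone_upto 1 Q"
  proof (intro equalityI subsetI)
    fix x assume "x \<in> cone_upto t Q"
    then obtain s q where x: "x = s *\<^sub>R q" "0 \<le> s" "s \<le> t" "q \<in> Q" by (auto simp: cone_upto_def)
    have st: "0 \<le> s / t" "s / t \<le> 1" using x t by (auto simp: divide_le_eq)
    show "x \<in> (*\<^sub>R) t ` cone_upto 1 Q"
    proof (rule image_eqI)
      show "x = t *\<^sub>R ((s / t) *\<^sub>R q)" using x by (cases "t = 0") auto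
      show "(s / t) *\<^sub>R q \<in> cone_upto 1 Q" using st x(4) unfolding cone_upto_def by blast
    qed
  next
    fix x assume "x \<in> (*\<^sub>R) t ` cone_upto 1 Q"
    then obtain s q where x: "x = (t * s) *\<^sub>R q" "0 \<le> s" "s \<le> 1" "q \<in> Q" by (auto simp: cone_upto_def)
    have "0 \<le> t * s" "t * s \<le> t" using x t by (auto intro: mult_left_le)
    then show "x \<in> cone_upto t Q" using x unfolding cone_upto_def by blast
  qed
  then have "emeasure lebesgue (cone_upto t Q) = ennreal (t ^ DIM('a)) * emeasure lebesgue (cone_upto 1 Q)"
    using emeasure_lebesgue_scaleR_image[OF t, of "cone_upto 1 Q"] by simp
  then show ?thesis using compact_cone_upto[OF Q] by (simp add: borel_compact)
qed

text \<open>The neighbourhood is taken inside the hyperplane, so that it can again serve as the base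
  of a slab or of a cone.\<close>

lemma compact_plane_thickening:
  fixes Q :: "'a::euclidean_space set"
  assumes "compact Q"
  shows "compact {x. x \<bullet> b = c \<and> (\<exists>q\<in>Q. dist x q \<le> \<rho>)}"
proof -
  have "{x. x \<bullet> b = c \<and> (\<exists>q\<in>Q. dist x q \<le> \<rho>)} = {x. x \<bullet> b = c} \<inter> (\<Union>q\<in>Q. \<Union>z\<in>cball 0 \<rho>. {q + z})"
  proof (intro set_eqI iffI)
    fix x assume x: "x \<in> {x. x \<bullet> b = c \<and> (\<exists>q\<in>Q. dist x q \<le> \<rho>)}"
    then obtain q where "q \<in> Q" "dist x q \<le> \<rho>" by blast
    then have "x = q + (x - q)" "x - q \<in> cball 0 \<rho>" by (auto simp: dist_norm norm_minus_commute)
    then show "x \<in> {x. x \<bullet> b = c} \<inter> (\<Union>q\<in>Q. \<Union>z\<in>cball 0 \<rho>. {q + z})" using x \<open>q \<in> Q\<close> by blast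
  next
    fix x assume "x \<in> {x. x \<bullet> b = c} \<inter> (\<Union>q\<in>Q. \<Union>z\<in>cball 0 \<rho>. {q + z})"
    then obtain q z where "q \<in> Q" "norm z \<le> \<rho>" "x = q + z" "x \<bullet> b = c" by auto
    moreover from this have "dist x q \<le> \<rho>" by (simp add: dist_norm)
    ultimately show "x \<in> {x. x \<bullet> b = c \<and> (\<exists>q\<in>Q. dist x q \<le> \<rho>)}" by blast
  qed
  moreover have "compact (\<Union>q\<in>Q. \<Union>z\<in>cball 0 \<rho>. {q + z})"
    by (intro compact_sums' assms compact_cball)
  moreover have "closed {x. x \<bullet> b = c}" by (intro closed_Collect_eq continuous_intros)
  ultimately show ?thesis by (simp add: closed_Int_compact)
qed

text \<open>The layer of the cone between the heights \<open>1 - \<epsilon>\<close> and 1 has volume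
  \<open>(1 - (1 - \<epsilon>) ^ n) * V\<close> by homogeneity, where V is the volume of the cone.
  Up to a thickening of the base it also has \<open>\<epsilon>\<close> times the volume of the slab.
  Division by \<open>\<epsilon>\<close> produces the factor n.\<close>

lemma emeasure_flat_cone_axis:
  fixes b :: "'a::euclidean_space"
  assumes b: "b \<in> Basis" and Q: "compact Q" "\<And>q. q \<in> Q \<Longrightarrow> q \<bullet> b = 1"
  shows "real DIM('a) * measure lborel (cone_upto 1 Q) = measure lborel (slab b ((\<lambda>q. q - b) ` Q) 0 1)"
proof -
  let ?n = "DIM('a)" and ?P = "(\<lambda>q. q - b) ` Q"
  let ?C = "cone_upto 1 Q" and ?S = "slab b ?P 0 1"
  have P: "compact ?P" "\<And>p. p \<in> ?P \<Longrightarrow> p \<bullet> b = 0"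
    using Q b by (auto intro!: compact_continuous_image continuous_intros simp: inner_diff_left)
  have nb: "norm b = 1" "b \<bullet> b = 1" using b by auto
  have cC: "compact ?C" and cS: "compact ?S"
    using Q P nb by (auto intro: compact_cone_upto compact_slab)
  have em: "emeasure lborel E = ennreal (measure lborel E)" if "compact E" for E :: "'a set"
    using emeasure_compact_finite[OF that] by (intro emeasure_eq_ennreal_measure) auto
  have mono: "measure lborel E \<le> measure lborel F" if "compact E" "compact F" "E \<subseteq> F" for E F :: "'a set"
    using emeasure_mono[OF that(3), of lborel] that by (simp add: em borel_compact)
  have slab_m: "measure lborel (slab b P' s t) = (t - s) * measure lborel (slab b P' 0 1)"
    if "compact P'" "\<And>p. p \<in> P' \<Longrightarrow> p \<bullet> b = 0" "s < t" for P' s t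
    using emeasure_slab[OF b _ that(3), of P'] that nb
    by (simp add: em compact_slab borel_compact ennreal_mult'[symmetric])
  have cone_m: "measure lborel (cone_upto t Q') = t ^ ?n * measure lborel (cone_upto 1 Q')"
    if "compact Q'" "0 \<le> t" for Q' :: "'a set" and t
    using emeasure_cone_upto[OF that] that
    by (simp add: em compact_cone_upto ennreal_mult'[symmetric])
  obtain R where R: "0 < R" "\<And>p. p \<in> ?P \<Longrightarrow> norm p \<le> R"
    using compact_imp_bounded[OF P(1)] by (meson bounded_pos)
  have thick: "\<exists>\<rho>>0. \<forall>T. compact T \<longrightarrow> (\<forall>x\<in>T. \<exists>s\<in>E. dist x s \<le> \<rho>) \<longrightarrow> measure lborel T \<le> measure lborel E + e"
    if E: "compact E" "0 < e" for E :: "'a set" and e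
  proof -
    obtain \<rho> where \<rho>: "0 < \<rho>" "\<And>T. T \<in> sets borel \<Longrightarrow> (\<And>x. x \<in> T \<Longrightarrow> \<exists>s\<in>E. dist x s \<le> \<rho>) \<Longrightarrow>
      emeasure lborel T \<le> emeasure lborel E + ennreal e"
      using compact_thickening[OF E] by metis
    have "measure lborel T \<le> measure lborel E + e" if "compact T" "\<forall>x\<in>T. \<exists>s\<in>E. dist x s \<le> \<rho>" for T
      using \<rho>(2)[of T] that \<open>0 < e\<close> \<open>compact E\<close> by (simp add: em borel_compact flip: ennreal_plus)
    then show ?thesis using \<rho>(1) by blast
  qed
  have upper: "real ?n * measure lborel ?C \<le> measure lborel ?S + e" if e: "0 < e" for e
  proof -
    obtain \<rho> where \<rho>: "0 < \<rho>" "\<And>T. compact T \<Longrightarrow> \<forall>x\<in>T. \<exists>s\<in>?S. dist x s \<le> \<rho> \<Longrightarrow> measure lborel T \<le> measure lborel ?S + e"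
      using thick[OF cS e] by metis
    \<comment> \<open>A point at height s of the layer projects to
      \<open>s *\<^sub>R (q - b)\<close>, within \<open>(1 - s) * R\<close> of the base; the
      thickened base absorbs this taper.\<close>
    let ?P' = "{x. x \<bullet> b = 0 \<and> (\<exists>p\<in>?P. dist x p \<le> \<rho>)}"
    have P': "compact ?P'" by (rule compact_plane_thickening[OF P(1)])
    have "measure lborel (slab b ?P' 0 1) \<le> measure lborel ?S + e"
    proof (rule \<rho>(2))
      show "compact (slab b ?P' 0 1)" using P' nb by (intro compact_slab) auto
      show "\<forall>x\<in>slab b ?P' 0 1. \<exists>s\<in>?S. dist x s \<le> \<rho>"
      proof
        fix x assume x: "x \<in> slab b ?P' 0 1"
        then obtain p where p: "p \<in> ?P" "dist (x - (x \<bullet> b) *\<^sub>R b) p \<le> \<rho>" by (auto simp: slab_def)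
        have "p + (x \<bullet> b) *\<^sub>R b \<in> ?S" using x p(1) P(2)[OF p(1)] nb by (auto simp: slab_def inner_add_left)
        moreover have "dist x (p + (x \<bullet> b) *\<^sub>R b) \<le> \<rho>" using p(2) by (simp add: dist_norm algebra_simps)
        ultimately show "\<exists>s\<in>?S. dist x s \<le> \<rho>" by blast
      qed
    qed
    then have step: "(\<Sum>i<?n. (1 - \<epsilon>) ^ i) * measure lborel ?C \<le> measure lborel ?S + e"
      if \<epsilon>: "0 < \<epsilon>" "\<epsilon> < min 1 (\<rho> / R)" for \<epsilon>
    proof -
      have \<epsilon>R: "\<epsilon> * R \<le> \<rho>" using \<epsilon> R(1) by (simp add: less_divide_eq)
      have sub: "?C \<subseteq> cone_upto (1 - \<epsilon>) Q \<union> slab b ?P' (1 - \<epsilon>) 1"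
      proof
        fix x assume "x \<in> ?C"
        then obtain s q where x: "x = s *\<^sub>R q" "0 \<le> s" "s \<le> 1" "q \<in> Q" by (auto simp: cone_upto_def)
        show "x \<in> cone_upto (1 - \<epsilon>) Q \<union> slab b ?P' (1 - \<epsilon>) 1"
        proof (cases "s \<le> 1 - \<epsilon>")
          case True
          then show ?thesis using x by (auto simp: cone_upto_def)
        next
          case False
          have xb: "x \<bullet> b = s" using x Q(2) by simp
          have pr: "x - (x \<bullet> b) *\<^sub>R b = s *\<^sub>R (q - b)" using xb x(1) by (simp add: scaleR_diff_right)
          have "dist (s *\<^sub>R (q - b)) (q - b) = (1 - s) * norm (q - b)"
          proof -
            have "s *\<^sub>R (q - b) - (q - b) = - ((1 - s) *\<^sub>R (q - b))" by (simp add: algebra_simps)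
            then show ?thesis using x(3) by (simp only: dist_norm norm_minus_cancel norm_scaleR abs_of_nonneg diff_ge_0_iff_ge)
          qed
          also have "\<dots> \<le> \<epsilon> * R" using False x R by (intro mult_mono) auto
          finally have "dist (s *\<^sub>R (q - b)) (q - b) \<le> \<rho>" using \<epsilon>R by simp
          then have "s *\<^sub>R (q - b) \<in> ?P'" using x Q(2)[OF x(4)] nb by (auto simp: inner_diff_left)
          then have "x - (x \<bullet> b) *\<^sub>R b \<in> ?P'" by (simp only: pr)
          then have "x \<in> slab b ?P' (1 - \<epsilon>) 1" using False x(3) xb unfolding slab_def by simp
          then show ?thesis by blast
        qed
      qed
      have cF: "compact (slab b ?P' (1 - \<epsilon>) 1)" using P' nb by (intro compact_slab) auto
      have "measure lborel ?C \<le> measure lborel (cone_upto (1 - \<epsilon>) Q \<union> slab b ?P' (1 - \<epsilon>) 1)"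
        by (rule mono[OF cC compact_Un[OF compact_cone_upto[OF Q(1)] cF] sub])
      also have "\<dots> \<le> measure lborel (cone_upto (1 - \<epsilon>) Q) + measure lborel (slab b ?P' (1 - \<epsilon>) 1)"
        using borel_compact[OF cF] borel_compact[OF compact_cone_upto[OF Q(1)]] unfolding sets_lborel[symmetric]
        by (rule measure_Un_le[rotated])
      also have "\<dots> = (1 - \<epsilon>) ^ ?n * measure lborel ?C + \<epsilon> * measure lborel (slab b ?P' 0 1)"
        using cone_m[OF Q(1), of "1 - \<epsilon>"] slab_m[OF P', of "1 - \<epsilon>" 1] \<epsilon> by simp
      also have "\<dots> \<le> (1 - \<epsilon>) ^ ?n * measure lborel ?C + \<epsilon> * (measure lborel ?S + e)"
        using \<epsilon> \<open>measure lborel (slab b ?P' 0 1) \<le> measure lborel ?S + e\<close> by (intro add_left_mono mult_left_mono) auto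
      finally have "(1 - (1 - \<epsilon>) ^ ?n) * measure lborel ?C \<le> \<epsilon> * (measure lborel ?S + e)"
        by (simp add: algebra_simps)
      moreover have "1 - (1 - \<epsilon>) ^ ?n = \<epsilon> * (\<Sum>i<?n. (1 - \<epsilon>) ^ i)"
        using one_diff_power_eq[of "1 - \<epsilon>" ?n] by simp
      ultimately show ?thesis using \<epsilon> by (simp add: mult.assoc)
    qed
    \<comment> \<open>As \<open>\<epsilon>\<close> tends to 0 the geometric sum tends to n.\<close>
    have "((\<lambda>\<epsilon>. (\<Sum>i<?n. (1 - \<epsilon>) ^ i) * measure lborel ?C) \<longlongrightarrow> (\<Sum>i<?n. (1 - 0) ^ i) * measure lborel ?C) (at_right 0)"
      by (intro tendsto_intros)
    moreover have "eventually (\<lambda>\<epsilon>. (\<Sum>i<?n. (1 - \<epsilon>) ^ i) * measure lborel ?C \<le> measure lborel ?S + e) (at_right 0)"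
      using eventually_at_right_real[of 0 "min 1 (\<rho> / R)"] \<rho>(1) R(1)
      by (auto elim!: eventually_mono intro: step)
    ultimately show ?thesis by (auto dest: tendsto_upperbound)
  qed
  have lower: "measure lborel ?S \<le> real ?n * (measure lborel ?C + e)" if e: "0 < e" for e
  proof -
    obtain \<rho> where \<rho>: "0 < \<rho>" "\<And>T. compact T \<Longrightarrow> \<forall>x\<in>T. \<exists>s\<in>?C. dist x s \<le> \<rho> \<Longrightarrow> measure lborel T \<le> measure lborel ?C + e"
      using thick[OF cC e] by metis
    let ?Q' = "{x. x \<bullet> b = 1 \<and> (\<exists>q\<in>Q. dist x q \<le> \<rho>)}"
    let ?C' = "cone_upto 1 ?Q'"
    have Q': "compact ?Q'" by (rule compact_plane_thickening[OF Q(1)])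
    have C': "measure lborel ?C' \<le> measure lborel ?C + e"
    proof (rule \<rho>(2)[OF compact_cone_upto[OF Q']], intro ballI)
      fix x assume "x \<in> ?C'"
      then obtain s q' where x: "x = s *\<^sub>R q'" "0 \<le> s" "s \<le> 1" "q' \<in> ?Q'" by (auto simp: cone_upto_def)
      then obtain q where q: "q \<in> Q" "dist q' q \<le> \<rho>" by blast
      have "dist x (s *\<^sub>R q) = s * dist q' q" using x by (simp add: dist_norm flip: scaleR_diff_right)
      also have "\<dots> \<le> 1 * \<rho>" using x q by (intro mult_mono) auto
      finally show "\<exists>c\<in>?C. dist x c \<le> \<rho>" using x q by (intro bexI[of _ "s *\<^sub>R q"]) (auto simp: cone_upto_def)
    qed
    \<comment> \<open>\<open>\<epsilon> \<le> 1/2\<close> yields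
      \<open>1 / s - 1 \<le> 2 * \<epsilon>\<close> for heights
      \<open>s \<ge> 1 - \<epsilon>\<close>, and \<open>2 * \<epsilon> * R \<le> \<rho>\<close>
      keeps the point of the base plane on the ray through \<open>x\<close> within the
      thickening.\<close>
    define \<epsilon> where "\<epsilon> = min (1/2) (\<rho> / (2 * R))"
    have \<epsilon>: "0 < \<epsilon>" "\<epsilon> \<le> 1/2" "2 * \<epsilon> * R \<le> \<rho>"
    proof -
      show "0 < \<epsilon>" "\<epsilon> \<le> 1/2" using \<rho>(1) R(1) by (auto simp: \<epsilon>_def)
      have "\<epsilon> \<le> \<rho> / (2 * R)" by (simp add: \<epsilon>_def)
      then show "2 * \<epsilon> * R \<le> \<rho>" using R(1) by (simp add: le_divide_eq mult_ac)
    qed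
    have slabC': "slab b ?P (1 - \<epsilon>) 1 \<subseteq> ?C'"
    proof
      fix x assume x: "x \<in> slab b ?P (1 - \<epsilon>) 1"
      then obtain q where q: "q \<in> Q" "x - (x \<bullet> b) *\<^sub>R b = q - b" by (auto simp: slab_def)
      define s where "s = x \<bullet> b"
      have s: "1 - \<epsilon> \<le> s" "s \<le> 1" "0 < s" using x \<epsilon> by (auto simp: slab_def s_def)
      let ?q' = "b + (1 / s) *\<^sub>R (q - b)"
      have "x = s *\<^sub>R ?q'" using q(2) s by (simp add: s_def scaleR_add_right algebra_simps)
      moreover have "?q' \<bullet> b = 1" using nb Q(2)[OF q(1)] by (simp add: inner_add_left inner_diff_left)
      moreover have "dist ?q' q \<le> \<rho>"
      proof -
        have "?q' - q = (1 / s - 1) *\<^sub>R (q - b)" by (simp add: algebra_simps)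
        then have "dist ?q' q = (1 / s - 1) * norm (q - b)" using s by (simp add: dist_norm)
        also have "\<dots> \<le> (2 * \<epsilon>) * R"
        proof (rule mult_mono)
          have "1 \<le> s * (1 + 2 * \<epsilon>)"
          proof -
            have "(1 - \<epsilon>) * (1 + 2 * \<epsilon>) \<le> s * (1 + 2 * \<epsilon>)" using s \<epsilon> by (intro mult_right_mono) auto
            moreover have "1 \<le> (1 - \<epsilon>) * (1 + 2 * \<epsilon>)" using \<epsilon> by (simp add: algebra_simps)
            ultimately show ?thesis by linarith
          qed
          then show "1 / s - 1 \<le> 2 * \<epsilon>" using s by (simp add: divide_le_eq algebra_simps)
          show "norm (q - b) \<le> R" using R(2) q(1) by auto
        qed (use \<epsilon> in auto)
        finally show ?thesis using \<epsilon> by simp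
      qed
      ultimately show "x \<in> ?C'" using s q(1) by (auto simp: cone_upto_def intro!: exI[of _ s] exI[of _ ?q'])
    qed
    \<comment> \<open>The smaller cone stops strictly below the height \<open>1 - \<epsilon>\<close>
      and so misses the closed layer; afterwards \<open>\<sigma>\<close> tends to
      \<open>1 - \<epsilon>\<close>.\<close>
    have step: "\<epsilon> * measure lborel ?S \<le> (1 - \<sigma> ^ ?n) * measure lborel ?C'" if \<sigma>: "0 < \<sigma>" "\<sigma> < 1 - \<epsilon>" for \<sigma>
    proof -
      have disj: "slab b ?P (1 - \<epsilon>) 1 \<inter> cone_upto \<sigma> ?Q' = {}"
        using \<sigma> by (auto simp: slab_def cone_upto_def)
      have cs: "compact (slab b ?P (1 - \<epsilon>) 1)" using P nb by (intro compact_slab) auto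
      have "\<epsilon> * measure lborel ?S + \<sigma> ^ ?n * measure lborel ?C'
          = measure lborel (slab b ?P (1 - \<epsilon>) 1) + measure lborel (cone_upto \<sigma> ?Q')"
        using \<epsilon> \<sigma> slab_m[OF P, of "1 - \<epsilon>" 1] cone_m[OF Q', of \<sigma>] by simp
      also have "\<dots> = measure lborel (slab b ?P (1 - \<epsilon>) 1 \<union> cone_upto \<sigma> ?Q')"
      proof -
        have "cone_upto \<sigma> ?Q' - slab b ?P (1 - \<epsilon>) 1 = cone_upto \<sigma> ?Q'" using disj by blast
        then show ?thesis
          using cs compact_cone_upto[OF Q', of \<sigma>]
          by (subst measure_Un2) (simp_all add: fmeasurable_compact)
      qed
      also have "\<dots> \<le> measure lborel ?C'"
      proof (rule mono)
        show "compact (slab b ?P (1 - \<epsilon>) 1 \<union> cone_upto \<sigma> ?Q')"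
          by (rule compact_Un[OF cs compact_cone_upto[OF Q']])
        show "compact ?C'" by (rule compact_cone_upto[OF Q'])
        show "slab b ?P (1 - \<epsilon>) 1 \<union> cone_upto \<sigma> ?Q' \<subseteq> ?C'"
          using slabC' cone_upto_mono[of \<sigma> 1 ?Q' ?Q'] \<sigma> \<epsilon> by (intro Un_least) auto
      qed
      finally show ?thesis by (simp add: algebra_simps)
    qed
    have "((\<lambda>\<sigma>. (1 - \<sigma> ^ ?n) * measure lborel ?C') \<longlongrightarrow> (1 - (1 - \<epsilon>) ^ ?n) * measure lborel ?C') (at_left (1 - \<epsilon>))"
      by (intro tendsto_intros)
    moreover have "eventually (\<lambda>\<sigma>. \<epsilon> * measure lborel ?S \<le> (1 - \<sigma> ^ ?n) * measure lborel ?C') (at_left (1 - \<epsilon>))"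
      using eventually_at_left_real[of 0 "1 - \<epsilon>"] \<epsilon> by (auto elim!: eventually_mono intro: step)
    ultimately have "\<epsilon> * measure lborel ?S \<le> (1 - (1 - \<epsilon>) ^ ?n) * measure lborel ?C'"
      by (auto dest: tendsto_lowerbound)
    also have "1 - (1 - \<epsilon>) ^ ?n = \<epsilon> * (\<Sum>i<?n. (1 - \<epsilon>) ^ i)"
      using one_diff_power_eq[of "1 - \<epsilon>" ?n] by simp
    finally have "measure lborel ?S \<le> (\<Sum>i<?n. (1 - \<epsilon>) ^ i) * measure lborel ?C'"
      using \<epsilon>(1) by (simp add: mult.assoc)
    also have "\<dots> \<le> real ?n * measure lborel ?C'"
    proof (rule mult_right_mono)
      have "(\<Sum>i<?n. (1 - \<epsilon>) ^ i) \<le> (\<Sum>i<?n. 1)"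
        using \<epsilon> by (intro sum_mono power_le_one) auto
      then show "(\<Sum>i<?n. (1 - \<epsilon>) ^ i) \<le> real ?n" by simp
    qed simp
    also have "\<dots> \<le> real ?n * (measure lborel ?C + e)" by (rule mult_left_mono[OF C']) simp
    finally show ?thesis .
  qed
  have lower': "measure lborel ?S \<le> real ?n * measure lborel ?C + e" if "0 < e" for e
    using lower[of "e / ?n"] that by (simp add: distrib_left)
  show ?thesis
    by (rule antisym; rule field_le_epsilon) (fact upper lower')+
qed

text \<open>A rotation carries \<open>u\<close> to a basis vector and a translation moves the base
  into the hyperplane through the origin. Hausdorff measure is invariant under both, the cone volume
  under the rotation.\<close>

theorem emeasure_flat_cone:
  fixes u :: "real ^ 'n"
  assumes n: "2 \<le> CARD('n)" and u: "norm u = 1" and Q: "compact Q" "\<And>q. q \<in> Q \<Longrightarrow> q \<bullet> u = 1" and t: "0 \<le> t"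
  shows "of_nat CARD('n) * emeasure lborel (cone_upto t Q) = ennreal (t ^ CARD('n)) * hausdorff_measure (CARD('n) - 1) Q"
proof -
  obtain b :: "real ^ 'n" where b: "b \<in> Basis" using nonempty_Basis by blast
  obtain f where f: "orthogonal_transformation f" "f u = b"
    using orthogonal_transformation_exists[of u b] u b by auto
  have lin: "linear f" using f(1) by (rule orthogonal_transformation_linear)
  let ?Q = "f ` Q" and ?P = "(\<lambda>q. q - b) ` f ` Q"
  have cQ: "compact ?Q" by (intro compact_continuous_image Q(1) linear_continuous_on[OF lin[unfolded linear_conv_bounded_linear]])
  have Qb: "q \<bullet> b = 1" if "q \<in> ?Q" for q
    using that f Q(2) by (auto simp: orthogonal_transformation_def simp flip: f(2))
  have cP: "compact ?P" by (intro compact_continuous_image cQ continuous_intros)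
  have Pb: "p \<bullet> b = 0" if "p \<in> ?P" for p
    using that Qb b by (auto simp: inner_diff_left)
  have fin: "emeasure lborel E = ennreal (measure lborel E)" if "compact E" for E :: "(real ^ 'n) set"
    using emeasure_compact_finite[OF that] by (intro emeasure_eq_ennreal_measure) auto
  have "hausdorff_measure (CARD('n) - 1) Q = hausdorff_measure (CARD('n) - 1) ?Q"
    using f(1) by (intro hausdorff_measure_isometric_image[symmetric]) (simp add: orthogonal_transformation_isometry)
  also have "\<dots> = hausdorff_measure (CARD('n) - 1) ?P"
    by (intro hausdorff_measure_isometric_image[symmetric]) (simp add: dist_norm)
  also have "\<dots> = emeasure lborel (slab b ?P 0 1)"
    using hausdorff_measure_eq_slab[OF b _ cP Pb] n by simp
  also have "\<dots> = ennreal (real CARD('n) * measure lborel (cone_upto 1 ?Q))"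
    using emeasure_flat_cone_axis[OF b cQ Qb] compact_slab[OF _ Pb cP] b by (simp add: fin)
  also have "\<dots> = of_nat CARD('n) * emeasure lborel (cone_upto 1 ?Q)"
    using compact_cone_upto[OF cQ] by (simp add: fin ennreal_mult' ennreal_of_nat_eq_real_of_nat)
  also have "emeasure lborel (cone_upto 1 ?Q) = emeasure lborel (cone_upto 1 Q)"
    unfolding cone_upto_linear_image[OF lin] by (rule emeasure_orthogonal_image[OF f(1) compact_cone_upto[OF Q(1)]])
  finally have "hausdorff_measure (CARD('n) - 1) Q = of_nat CARD('n) * emeasure lborel (cone_upto 1 Q)" .
  then show ?thesis using emeasure_cone_upto[OF Q(1) t] by (simp add: mult_ac)
qed

section \<open>Gauge and normals of a convex body\<close>

lemma support_fun_upper: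
  fixes M :: "'a::euclidean_space set"
  assumes "compact M" "y \<in> M"
  shows "u \<bullet> y \<le> support_fun M u"
proof -
  have "bdd_above ((\<lambda>y. u \<bullet> y) ` M)"
    by (intro compact_imp_bounded bounded_imp_bdd_above compact_continuous_image assms continuous_intros)
  then show ?thesis unfolding support_fun_def using assms(2) by (rule cSUP_upper2) simp
qed

lemma support_fun_attained:
  fixes M :: "'a::euclidean_space set"
  assumes "compact M" "M \<noteq> {}"
  obtains y where "y \<in> M" "u \<bullet> y = support_fun M u"
proof -
  have "continuous_on M (\<lambda>y. u \<bullet> y)" by (intro continuous_intros)
  from continuous_attains_sup[OF assms this] obtain y where y: "y \<in> M" "\<And>z. z \<in> M \<Longrightarrow> u \<bullet> z \<le> u \<bullet> y" by blast
  then have "support_fun M u \<le> u \<bullet> y" unfolding support_fun_def by (intro cSUP_least) auto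
  then show ?thesis using that[OF y(1)] support_fun_upper[OF assms(1) y(1)] by (metis antisym)
qed

lemma support_fun_Lipschitz:
  fixes M :: "'a::euclidean_space set"
  assumes M: "compact M" "M \<noteq> {}" and R: "\<And>y. y \<in> M \<Longrightarrow> norm y \<le> R"
  shows "\<bar>support_fun M u - support_fun M v\<bar> \<le> R * norm (u - v)"
proof -
  have *: "support_fun M u - support_fun M v \<le> R * norm (u - v)" for u v
  proof -
    obtain y where y: "y \<in> M" "u \<bullet> y = support_fun M u" using support_fun_attained[OF M] by blast
    have "support_fun M u - support_fun M v \<le> (u - v) \<bullet> y"
      using support_fun_upper[OF M(1) y(1), of v] y(2) by (simp add: inner_diff_left)
    also have "\<dots> \<le> norm (u - v) * norm y" by (rule norm_cauchy_schwarz)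
    also have "\<dots> \<le> norm (u - v) * R" using R[OF y(1)] by (intro mult_left_mono) auto
    finally show ?thesis by (simp add: mult.commute)
  qed
  show ?thesis using *[of u v] *[of v u] by (simp add: abs_le_iff norm_minus_commute)
qed

lemma continuous_on_support_fun:
  fixes M :: "'a::euclidean_space set"
  assumes M: "compact M" "M \<noteq> {}"
  shows "continuous_on A (support_fun M)"
proof -
  obtain R where R: "0 < R" "\<And>y. y \<in> M \<Longrightarrow> norm y \<le> R"
    using compact_imp_bounded[OF M(1)] by (meson bounded_pos)
  have "R-lipschitz_on A (support_fun M)"
    using support_fun_Lipschitz[OF M R(2)] R(1) by (intro lipschitz_onI) (auto simp: dist_norm)
  then show ?thesis by (rule lipschitz_on_continuous_on)
qed

section \<open>The gauge and the directions in which it is attained\<close>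

locale convex_body =
  fixes K :: "(real ^ 'n) set"
  assumes compact_K: "compact K" and convex_K: "convex K" and zero_interior: "0 \<in> interior K"
    and dim_ge_2: "2 \<le> CARD('n)"
begin

abbreviation h :: "real ^ 'n \<Rightarrow> real" where "h \<equiv> support_fun K"

abbreviation S1 :: "(real ^ 'n) set" where "S1 \<equiv> sphere 0 1"

lemma zero_in_K: "0 \<in> K"
  using zero_interior interior_subset by blast

lemma K_ne: "K \<noteq> {}"
  using zero_in_K by blast

definition inner_radius :: real where
  "inner_radius = (SOME r. 0 < r \<and> cball 0 r \<subseteq> K)"

lemma inner_radius: "0 < inner_radius" "cball 0 inner_radius \<subseteq> K"
proof -
  have "\<exists>r. 0 < r \<and> cball 0 r \<subseteq> K" using zero_interior by (simp add: mem_interior_cball)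
  from someI_ex[OF this] show "0 < inner_radius" "cball 0 inner_radius \<subseteq> K" by (auto simp: inner_radius_def)
qed

definition outer_radius :: real where
  "outer_radius = (SOME r. 0 < r \<and> (\<forall>x\<in>K. norm x \<le> r))"

lemma outer_radius: "0 < outer_radius" "x \<in> K \<Longrightarrow> norm x \<le> outer_radius"
proof -
  have "\<exists>r. 0 < r \<and> (\<forall>x\<in>K. norm x \<le> r)"
    using compact_imp_bounded[OF compact_K] by (simp add: bounded_pos)
  from someI_ex[OF this] show "0 < outer_radius" "x \<in> K \<Longrightarrow> norm x \<le> outer_radius"
    by (auto simp: outer_radius_def)
qed

lemma h_upper: "y \<in> K \<Longrightarrow> u \<bullet> y \<le> h u"
  by (rule support_fun_upper[OF compact_K])

lemma h_ge: "norm u = 1 \<Longrightarrow> inner_radius \<le> h u"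
proof -
  assume u: "norm u = 1"
  then have "inner_radius *\<^sub>R u \<in> K" using inner_radius by (intro subsetD[OF inner_radius(2)]) auto
  from h_upper[OF this, of u] u show ?thesis by (simp add: norm_eq_1)
qed

lemma h_pos: "norm u = 1 \<Longrightarrow> 0 < h u"
  using h_ge[of u] inner_radius by simp

lemma h_le: "norm u = 1 \<Longrightarrow> h u \<le> outer_radius"
proof -
  assume u: "norm u = 1"
  obtain y where y: "y \<in> K" "u \<bullet> y = h u" using support_fun_attained[OF compact_K K_ne] by blast
  show ?thesis using norm_cauchy_schwarz[of u y] outer_radius(2)[OF y(1)] y u by simp
qed

lemma h_Lipschitz: "\<bar>h u - h v\<bar> \<le> outer_radius * norm (u - v)"
  by (rule support_fun_Lipschitz[OF compact_K K_ne outer_radius(2)])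

lemma continuous_on_h: "continuous_on A h"
  by (rule continuous_on_support_fun[OF compact_K K_ne])

lemma h_measurable [measurable]: "h \<in> borel_measurable borel"
  by (intro borel_measurable_continuous_onI continuous_on_h)

text \<open>The dual description of the gauge, by the supporting half-spaces
  \<open>u \<bullet> x \<le> h u\<close> of \<open>K\<close>. In this form the directions attaining
  the supremum are exactly the outer normals.\<close>

definition gauge_fun :: "real ^ 'n \<Rightarrow> real" where
  "gauge_fun x = (SUP u\<in>S1. (u \<bullet> x) / h u)"

text \<open>For \<open>x \<noteq> 0\<close> this says that \<open>u\<close> is an outer unit normal
  at the boundary point \<open>x / gauge_fun x\<close>; at the origin every unit vector
  qualifies.\<close>

definition is_normal :: "real ^ 'n \<Rightarrow> real ^ 'n \<Rightarrow> bool" where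
  "is_normal x u \<longleftrightarrow> norm u = 1 \<and> u \<bullet> x = h u * gauge_fun x"

lemma gauge_attained:
  obtains u where "norm u = 1" "\<And>v. norm v = 1 \<Longrightarrow> (v \<bullet> x) / h v \<le> (u \<bullet> x) / h u" "gauge_fun x = (u \<bullet> x) / h u"
proof -
  have ne: "S1 \<noteq> {}" by simp
  have "continuous_on S1 (\<lambda>u. (u \<bullet> x) / h u)"
    using h_pos by (intro continuous_intros continuous_on_h) force
  from continuous_attains_sup[OF compact_sphere ne this]
  obtain u where u: "norm u = 1" "\<And>v. norm v = 1 \<Longrightarrow> (v \<bullet> x) / h v \<le> (u \<bullet> x) / h u" by auto
  have "gauge_fun x = (u \<bullet> x) / h u"
    unfolding gauge_fun_def using u by (intro cSup_eq_maximum) auto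
  with u that show ?thesis by blast
qed

lemma gauge_upper: "norm u = 1 \<Longrightarrow> u \<bullet> x \<le> h u * gauge_fun x"
proof -
  assume u: "norm u = 1"
  have "(u \<bullet> x) / h u \<le> gauge_fun x" using u gauge_attained[of x] by metis
  then show ?thesis using h_pos[OF u] by (simp add: divide_le_eq mult.commute)
qed

lemma gauge_upper': "norm u = 1 \<Longrightarrow> (u \<bullet> x) / h u \<le> gauge_fun x"
  using gauge_upper[of u x] h_pos[of u] by (simp add: divide_le_eq mult.commute)

lemma is_normal_ex: "\<exists>u. is_normal x u"
proof -
  obtain u where "norm u = 1" "gauge_fun x = (u \<bullet> x) / h u" using gauge_attained[of x] by metis
  then show ?thesis using h_pos[of u] by (auto simp: is_normal_def)
qed

lemma is_normal_norm: "is_normal x u \<Longrightarrow> norm u = 1"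
  by (simp add: is_normal_def)

lemma is_normal_gauge: "is_normal x u \<Longrightarrow> gauge_fun x = (u \<bullet> x) / h u"
  using h_pos[of u] by (auto simp: is_normal_def)

lemma gauge_0 [simp]: "gauge_fun 0 = 0"
  using is_normal_ex[of 0] is_normal_gauge by fastforce

lemma gauge_ge: "norm x \<le> outer_radius * gauge_fun x"
proof (cases "x = 0")
  case False
  let ?u = "x /\<^sub>R norm x"
  have u: "norm ?u = 1" using False by simp
  have "norm x = ?u \<bullet> x" using False by (simp add: dot_square_norm power2_eq_square)
  also have "\<dots> \<le> h ?u * gauge_fun x" by (rule gauge_upper[OF u])
  finally have *: "norm x \<le> h ?u * gauge_fun x" .
  then have "0 \<le> gauge_fun x" using h_pos[OF u] by (smt (verit) norm_ge_zero zero_le_mult_iff)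
  then have "h ?u * gauge_fun x \<le> outer_radius * gauge_fun x" by (intro mult_right_mono h_le u)
  with * show ?thesis by linarith
qed simp

lemma gauge_nonneg: "0 \<le> gauge_fun x"
  using gauge_ge[of x] outer_radius(1) by (smt (verit) norm_ge_zero zero_le_mult_iff)

lemma gauge_pos: "x \<noteq> 0 \<Longrightarrow> 0 < gauge_fun x"
  using gauge_ge[of x] outer_radius(1) gauge_nonneg[of x] by (metis mult_zero_right norm_le_zero_iff order_le_less)

lemma gauge_scale: "0 \<le> t \<Longrightarrow> gauge_fun (t *\<^sub>R x) = t * gauge_fun x"
proof (rule antisym)
  assume t: "0 \<le> t"
  obtain u where u: "is_normal (t *\<^sub>R x) u" using is_normal_ex by blast
  have "gauge_fun (t *\<^sub>R x) = t * ((u \<bullet> x) / h u)" using is_normal_gauge[OF u] by simp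
  also have "\<dots> \<le> t * gauge_fun x" by (intro mult_left_mono gauge_upper' is_normal_norm[OF u] t)
  finally show "gauge_fun (t *\<^sub>R x) \<le> t * gauge_fun x" .
  obtain v where v: "is_normal x v" using is_normal_ex by blast
  have "t * gauge_fun x = (v \<bullet> (t *\<^sub>R x)) / h v" using is_normal_gauge[OF v] by simp
  also have "\<dots> \<le> gauge_fun (t *\<^sub>R x)" by (intro gauge_upper' is_normal_norm[OF v])
  finally show "t * gauge_fun x \<le> gauge_fun (t *\<^sub>R x)" .
qed

lemma is_normal_scale: "0 < t \<Longrightarrow> is_normal (t *\<^sub>R x) u \<longleftrightarrow> is_normal x u"
  by (auto simp: is_normal_def gauge_scale)

lemma gauge_Lipschitz: "\<bar>gauge_fun x - gauge_fun y\<bar> \<le> (1 / inner_radius) * norm (x - y)"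
proof -
  have *: "gauge_fun x - gauge_fun y \<le> (1 / inner_radius) * norm (x - y)" for x y
  proof -
    obtain u where u: "is_normal x u" using is_normal_ex by blast
    have "gauge_fun x - gauge_fun y \<le> (u \<bullet> (x - y)) / h u"
      using is_normal_gauge[OF u] gauge_upper'[OF is_normal_norm[OF u], of y]
      by (simp add: inner_diff_right diff_divide_distrib)
    also have "\<dots> \<le> norm (x - y) / h u"
      using norm_cauchy_schwarz[of u "x - y"] is_normal_norm[OF u] h_pos[of u] by (intro divide_right_mono) auto
    also have "\<dots> \<le> norm (x - y) / inner_radius"
      using h_ge[OF is_normal_norm[OF u]] inner_radius(1) by (intro divide_left_mono) auto
    finally show ?thesis by simp
  qed
  show ?thesis using *[of x y] *[of y x] by (simp add: abs_le_iff norm_minus_commute)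
qed

lemma continuous_on_gauge: "continuous_on A gauge_fun"
proof -
  have "(1 / inner_radius)-lipschitz_on A gauge_fun"
    using gauge_Lipschitz inner_radius(1) by (intro lipschitz_onI) (auto simp: dist_norm)
  then show ?thesis by (rule lipschitz_on_continuous_on)
qed

text \<open>A point outside \<open>K\<close> is strictly separated from it, and the unit vector
  normal to the separating hyperplane makes the supremum exceed 1.\<close>

lemma gauge_le_1_iff: "gauge_fun x \<le> 1 \<longleftrightarrow> x \<in> K"
proof
  assume x: "x \<in> K"
  obtain u where u: "is_normal x u" using is_normal_ex by blast
  then show "gauge_fun x \<le> 1"
    using is_normal_gauge[OF u] h_upper[OF x, of u] h_pos[OF is_normal_norm[OF u]] by simp
next
  assume g: "gauge_fun x \<le> 1"
  show "x \<in> K"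
  proof (rule ccontr)
    assume "x \<notin> K"
    obtain a c where ac: "a \<bullet> x < c" "\<And>y. y \<in> K \<Longrightarrow> c < a \<bullet> y"
      using separating_hyperplane_closed_point[OF convex_K compact_imp_closed[OF compact_K] \<open>x \<notin> K\<close>] by blast
    have "a \<noteq> 0" using ac(1) ac(2)[OF zero_in_K] by auto
    define u where "u = - (a /\<^sub>R norm a)"
    have u: "norm u = 1" using \<open>a \<noteq> 0\<close> by (simp add: u_def)
    obtain y where y: "y \<in> K" "u \<bullet> y = h u" using support_fun_attained[OF compact_K K_ne] by blast
    have lt: "a \<bullet> x < a \<bullet> y" using ac(1) ac(2)[OF y(1)] by simp
    have ua: "u \<bullet> z = - ((a \<bullet> z) / norm a)" for z by (simp add: u_def divide_inverse mult.commute)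
    have "(a \<bullet> x) / norm a < (a \<bullet> y) / norm a" using lt \<open>a \<noteq> 0\<close> by (intro divide_strict_right_mono) auto
    then have "h u < u \<bullet> x" using y(2) ua[of x] ua[of y] by linarith
    also have "\<dots> \<le> h u * gauge_fun x" by (rule gauge_upper[OF u])
    also have "\<dots> \<le> h u * 1" using g less_imp_le[OF h_pos[OF u]] by (rule mult_left_mono)
    finally have "h u < h u * 1" .
    then show False by simp
  qed
qed

lemma frontier_K: "frontier K = {x. gauge_fun x = 1}"
proof -
  have "interior K = {x. gauge_fun x < 1}"
  proof (rule interior_unique)
    show "{x. gauge_fun x < 1} \<subseteq> K"
    proof
      fix x assume "x \<in> {x. gauge_fun x < 1}"
      then show "x \<in> K" using gauge_le_1_iff[of x] by simp
    qed
    show "open {x. gauge_fun x < 1}" by (intro open_Collect_less continuous_on_gauge continuous_intros)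
    fix T assume T: "T \<subseteq> K" "open T"
    show "T \<subseteq> {x. gauge_fun x < 1}"
    proof
      fix x assume x: "x \<in> T"
      obtain e where e: "0 < e" "cball x e \<subseteq> T" using T(2) x open_contains_cball by blast
      \<comment> \<open>An interior point can be pushed outward by a factor \<open>1 + s\<close>
        without leaving \<open>K\<close>; the summand 1 in the denominator covers the
        origin.\<close>
      define s where "s = e / (norm x + 1)"
      have s: "0 < s" using e(1) by (simp add: s_def add_nonneg_pos)
      have "s * norm x \<le> e"
        using e(1) by (simp add: s_def divide_le_eq add_nonneg_pos mult.commute)
      then have "(1 + s) *\<^sub>R x \<in> cball x e"
        using s by (simp add: scaleR_add_left dist_norm)
      then have "gauge_fun ((1 + s) *\<^sub>R x) \<le> 1" using e T(1) gauge_le_1_iff by blast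
      then have "(1 + s) * gauge_fun x \<le> 1" using s by (simp add: gauge_scale)
      then show "x \<in> {x. gauge_fun x < 1}"
        using s gauge_nonneg[of x] by (smt (verit) mem_Collect_eq mult_less_cancel_right2 mult_mono mult_cancel_right1)
    qed
  qed
  then show ?thesis
    using gauge_le_1_iff by (force simp: frontier_def compact_imp_closed[OF compact_K])
qed

text \<open>For nonempty \<open>\<omega>\<close> within the sphere this is the full cone over its
  reverse spherical image, apex included; passing to cones allows boundary pieces to be compared by
  Lebesgue measure.\<close>

definition normal_cone_set :: "(real ^ 'n) set \<Rightarrow> (real ^ 'n) set" where
  "normal_cone_set \<omega> = {x. \<exists>u\<in>\<omega>. is_normal x u}"

lemma reverse_spherical_image_eq:
  assumes "\<omega> \<subseteq> S1"
  shows "reverse_spherical_image K \<omega> = {x. gauge_fun x = 1} \<inter> normal_cone_set \<omega>"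
proof -
  have "norm u = 1" if "u \<in> \<omega>" for u using assms that by auto
  then show ?thesis
    by (auto simp: reverse_spherical_image_def frontier_K normal_cone_set_def is_normal_def inner_commute)
qed

lemma cone_upto_reverse_spherical_image:
  assumes "\<omega> \<subseteq> S1"
  shows "cone_upto 1 (reverse_spherical_image K \<omega>) = K \<inter> normal_cone_set \<omega>"
proof (intro equalityI subsetI)
  fix x assume "x \<in> cone_upto 1 (reverse_spherical_image K \<omega>)"
  then obtain s y u where x: "x = s *\<^sub>R y" "0 \<le> s" "s \<le> 1" "gauge_fun y = 1" "u \<in> \<omega>" "is_normal y u"
    by (auto simp: cone_upto_def reverse_spherical_image_eq[OF assms] normal_cone_set_def)
  have "gauge_fun x = s" using x by (simp add: gauge_scale)
  moreover have "is_normal x u" using x by (auto simp: is_normal_def gauge_scale)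
  ultimately show "x \<in> K \<inter> normal_cone_set \<omega>"
    using x by (auto simp: normal_cone_set_def simp flip: gauge_le_1_iff)
next
  fix x assume x: "x \<in> K \<inter> normal_cone_set \<omega>"
  then obtain u where u: "u \<in> \<omega>" "is_normal x u" by (auto simp: normal_cone_set_def)
  show "x \<in> cone_upto 1 (reverse_spherical_image K \<omega>)"
  proof (cases "x = 0")
    case True
    \<comment> \<open>The origin lies in the truncated cone only if the base is nonempty; a support
      point in the direction \<open>u\<close> provides a point of the base.\<close>
    have nu: "norm u = 1" using u(2) by (rule is_normal_norm)
    obtain y where y: "y \<in> K" "u \<bullet> y = h u" using support_fun_attained[OF compact_K K_ne] by blast
    have "gauge_fun y = 1"
      using gauge_upper'[OF nu, of y] y h_pos[OF nu] gauge_le_1_iff[of y] by simp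
    then have "y \<in> reverse_spherical_image K \<omega>"
      using u(1) nu y by (auto simp: reverse_spherical_image_eq[OF assms] normal_cone_set_def is_normal_def)
    then have "0 *\<^sub>R y \<in> cone_upto 1 (reverse_spherical_image K \<omega>)"
      unfolding cone_upto_def by (smt (verit) mem_Collect_eq)
    then show ?thesis using True by simp
  next
    case False
    have g: "0 < gauge_fun x" using gauge_pos[OF False] .
    define y where "y = (1 / gauge_fun x) *\<^sub>R x"
    have y: "gauge_fun y = 1" "x = gauge_fun x *\<^sub>R y" using g by (auto simp: y_def gauge_scale)
    have "is_normal y u" using u(2) g by (simp add: y_def is_normal_scale)
    then have "y \<in> reverse_spherical_image K \<omega>"
      using u(1) y(1) by (auto simp: reverse_spherical_image_eq[OF assms] normal_cone_set_def)
    moreover have "gauge_fun x \<le> 1" using x gauge_le_1_iff by blast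
    ultimately show ?thesis using y(2) g unfolding cone_upto_def by (smt (verit) mem_Collect_eq)
  qed
qed

text \<open>The relation between points and their normals is closed, and it is projected along the
  compact factor \<open>\<omega>\<close>.\<close>

lemma closed_normal_cone_set:
  assumes "compact \<omega>"
  shows "closed (normal_cone_set \<omega>)"
proof -
  let ?G = "{z. norm (fst z) = 1 \<and> fst z \<bullet> snd z = h (fst z) * gauge_fun (snd z)}"
  have "closed ?G"
    by (intro closed_Collect_conj closed_Collect_eq continuous_intros
        continuous_on_compose2[OF continuous_on_h[of UNIV]] continuous_on_compose2[OF continuous_on_gauge[of UNIV]]) auto
  then have "closed {x. \<exists>u. u \<in> \<omega> \<and> (u, x) \<in> ?G}" by (rule closed_compact_projection[OF assms])
  moreover have "{x. \<exists>u. u \<in> \<omega> \<and> (u, x) \<in> ?G} = normal_cone_set \<omega>"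
    by (auto simp: normal_cone_set_def is_normal_def)
  ultimately show ?thesis by simp
qed

lemma compact_normal_cone_set: "compact \<omega> \<Longrightarrow> compact C \<Longrightarrow> compact (C \<inter> normal_cone_set \<omega>)"
  by (intro compact_Int_closed closed_normal_cone_set)

lemma compact_reverse_spherical_image:
  assumes "compact \<omega>" "\<omega> \<subseteq> S1"
  shows "compact (reverse_spherical_image K \<omega>)"
  unfolding reverse_spherical_image_eq[OF assms(2)] frontier_K[symmetric]
  by (intro compact_normal_cone_set assms compact_frontier compact_K)

section \<open>Almost everywhere uniqueness of the normal\<close>

definition singular :: "(real ^ 'n) set" where
  "singular = {x. \<exists>u v. u \<noteq> v \<and> is_normal x u \<and> is_normal x v}"

text \<open>Two points of \<open>E\<close> cannot lie on a common line parallel to \<open>i\<close>: by convexity of the gauge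
  the slope between them would be both at least \<open>\<beta>\<close> and at most \<open>\<alpha>\<close>.  Hence the translates of
  \<open>E\<close> along \<open>i\<close> are pairwise disjoint.\<close>

lemma negligible_two_slopes:
  assumes i: "i \<in> Basis" and ab: "\<alpha> < \<beta>"
  shows "negligible (normal_cone_set {u. norm u = 1 \<and> \<beta> * h u \<le> u \<bullet> i} \<inter> normal_cone_set {u. norm u = 1 \<and> u \<bullet> i \<le> \<alpha> * h u})"
    (is "negligible ?E")
proof -
  have unique: "s = 0" if E: "x \<in> ?E" "x + s *\<^sub>R i \<in> ?E" "0 \<le> s" for x s
  proof (rule ccontr)
    assume "s \<noteq> 0"
    with E have s: "0 < s" by simp
    let ?y = "x + s *\<^sub>R i"
    obtain u where u: "is_normal x u" "\<beta> * h u \<le> u \<bullet> i" using E(1) unfolding normal_cone_set_def by blast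
    obtain v where v: "is_normal ?y v" "v \<bullet> i \<le> \<alpha> * h v" using E(2) unfolding normal_cone_set_def by blast
    have hu: "0 < h u" "0 < h v" using u v h_pos is_normal_norm by auto
    have "gauge_fun x + s * \<beta> \<le> (u \<bullet> ?y) / h u"
    proof -
      have "(u \<bullet> ?y) / h u = gauge_fun x + s * ((u \<bullet> i) / h u)"
        using is_normal_gauge[OF u(1)] by (simp add: inner_add_right add_divide_distrib)
      moreover have "s * \<beta> \<le> s * ((u \<bullet> i) / h u)" using u(2) hu s by (intro mult_left_mono) (auto simp: le_divide_eq)
      ultimately show ?thesis by linarith
    qed
    also have "\<dots> \<le> gauge_fun ?y" by (rule gauge_upper'[OF is_normal_norm[OF u(1)]])
    finally have 1: "gauge_fun x + s * \<beta> \<le> gauge_fun ?y" .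
    have "gauge_fun ?y - s * \<alpha> \<le> (v \<bullet> x) / h v"
    proof -
      have "(v \<bullet> x) / h v = gauge_fun ?y - s * ((v \<bullet> i) / h v)"
        using is_normal_gauge[OF v(1)] by (simp add: inner_add_right add_divide_distrib)
      moreover have "s * ((v \<bullet> i) / h v) \<le> s * \<alpha>" using v(2) hu s by (intro mult_left_mono) (auto simp: divide_le_eq)
      ultimately show ?thesis by linarith
    qed
    also have "\<dots> \<le> gauge_fun x" by (rule gauge_upper'[OF is_normal_norm[OF v(1)]])
    finally have "s * \<beta> \<le> s * \<alpha>" using 1 by linarith
    then show False using s ab by simp
  qed
  have cmp: "compact (cball 0 M \<inter> ?E)" for M
  proof -
    have "{u. norm u = 1 \<and> \<beta> * h u \<le> u \<bullet> i} = S1 \<inter> {u. \<beta> * h u \<le> u \<bullet> i}"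
      "{u. norm u = 1 \<and> u \<bullet> i \<le> \<alpha> * h u} = S1 \<inter> {u. u \<bullet> i \<le> \<alpha> * h u}" by auto
    moreover have "closed {u. \<beta> * h u \<le> u \<bullet> i}" "closed {u. u \<bullet> i \<le> \<alpha> * h u}"
      by (intro closed_Collect_le continuous_intros continuous_on_h)+
    ultimately have "compact {u. norm u = 1 \<and> \<beta> * h u \<le> u \<bullet> i}" "compact {u. norm u = 1 \<and> u \<bullet> i \<le> \<alpha> * h u}"
      by (simp_all add: compact_Int_closed)
    then have "compact ((cball 0 M \<inter> normal_cone_set {u. norm u = 1 \<and> \<beta> * h u \<le> u \<bullet> i})
        \<inter> (cball 0 M \<inter> normal_cone_set {u. norm u = 1 \<and> u \<bullet> i \<le> \<alpha> * h u}))"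
      by (intro compact_Int compact_normal_cone_set compact_cball)
    moreover have "(cball 0 M \<inter> normal_cone_set {u. norm u = 1 \<and> \<beta> * h u \<le> u \<bullet> i})
        \<inter> (cball 0 M \<inter> normal_cone_set {u. norm u = 1 \<and> u \<bullet> i \<le> \<alpha> * h u}) = cball 0 M \<inter> ?E" by blast
    ultimately show ?thesis by simp
  qed
  have "negligible (cball 0 M \<inter> ?E)" for M :: real
  proof -
    define F where "F = cball 0 M \<inter> ?E"
    have cF: "compact F" unfolding F_def by (rule cmp)
    have neg: "measure lebesgue F = 0"
    proof (rule ccontr)
      assume "measure lebesgue F \<noteq> 0"
      then have pos: "0 < measure lebesgue F" by (simp add: zero_less_measure_iff)
      \<comment> \<open>Infinitely many disjoint copies of equal volume fit into one ball, which
        excludes positive volume.\<close>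
      define T where "T k = (+) ((1 / real (Suc k)) *\<^sub>R i) ` F" for k :: nat
      have cT: "compact (T k)" for k unfolding T_def by (intro compact_translation cF)
      have mT: "measure lebesgue (T k) = measure lebesgue F" for k unfolding T_def by (rule measure_translation)
      have disj: "disjoint_family T"
        unfolding disjoint_family_on_def
      proof (intro ballI impI)
        have *: "T k \<inter> T l = {}" if "k < l" for k l
        proof (rule ccontr)
          assume "T k \<inter> T l \<noteq> {}"
          then obtain x y where xy: "x \<in> F" "y \<in> F" "(1 / real (Suc k)) *\<^sub>R i + x = (1 / real (Suc l)) *\<^sub>R i + y"
            by (auto simp: T_def)
          define s where "s = 1 / real (Suc k) - 1 / real (Suc l)"
          have s: "0 < s" using that by (simp add: s_def frac_less2)
          have "y = x + s *\<^sub>R i" using xy(3) by (simp add: s_def algebra_simps)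
          then show False using unique[of x s] xy(1,2) s unfolding F_def by auto
        qed
        show "T k \<inter> T l = {}" if "k \<noteq> l" for k l using *[of k l] *[of l k] that by (metis Int_commute linorder_neqE_nat)
      qed
      have sub: "T k \<subseteq> cball 0 (M + 1)" for k
      proof
        fix y assume "y \<in> T k"
        then obtain x where x: "x \<in> F" "y = (1 / real (Suc k)) *\<^sub>R i + x" by (auto simp: T_def)
        have "norm y \<le> norm ((1 / real (Suc k)) *\<^sub>R i) + norm x" unfolding x(2) by (rule norm_triangle_ineq)
        moreover have "norm ((1 / real (Suc k)) *\<^sub>R i) \<le> 1" using i by simp
        moreover have "norm x \<le> M" using x(1) by (auto simp: F_def)
        ultimately have "norm y \<le> M + 1" by linarith
        then show "y \<in> cball 0 (M + 1)" by simp
      qed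
      have bound: "real N * measure lebesgue F \<le> measure lebesgue (cball (0::real^'n) (M + 1))" for N :: nat
      proof -
        have "real N * measure lebesgue F = (\<Sum>k<N. measure lebesgue (T k))" by (simp add: mT)
        also have "\<dots> = measure lebesgue (\<Union>k<N. T k)"
          using disj by (intro measure_finite_Union[symmetric])
            (auto simp: borel_compact[OF cT] disjoint_family_on_def emeasure_compact_finite[OF cT, THEN less_imp_neq, simplified])
        also have "\<dots> \<le> measure lebesgue (cball (0::real^'n) (M + 1))"
          using sub by (intro measure_mono_fmeasurable) (auto simp: borel_compact[OF cT])
        finally show ?thesis .
      qed
      obtain N :: nat where "measure lebesgue (cball (0::real^'n) (M + 1)) / measure lebesgue F < real N"
        using reals_Archimedean2 by blast
      then show False using bound[of N] pos by (simp add: divide_less_eq)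
    qed
    then have "negligible F"
      using lmeasurable_compact[OF cF] by (simp add: negligible_iff_measure)
    then show ?thesis by (simp add: F_def)
  qed
  then have "negligible (\<Union>M::nat. cball 0 (real M) \<inter> ?E)" by (intro negligible_countable_Union) auto
  moreover have "?E \<subseteq> (\<Union>M::nat. cball 0 (real M) \<inter> ?E)" using real_arch_simple by fastforce
  ultimately show ?thesis by (rule negligible_subset)
qed

text \<open>For a normal \<open>u\<close> at \<open>x\<close> the vector \<open>u / h u\<close> is a
  subgradient of the gauge. Distinct normals give distinct subgradients, hence a coordinate in which
  rationals \<open>\<alpha> < \<beta>\<close> separate them, and there are only countably many such
  triples.\<close>

lemma negligible_singular: "negligible singular"
proof -
  let ?E = "\<lambda>i \<alpha> \<beta>. normal_cone_set {u. norm u = 1 \<and> \<beta> * h u \<le> u \<bullet> i} \<inter> normal_cone_set {u. norm u = 1 \<and> u \<bullet> i \<le> \<alpha> * h u}"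
  let ?I = "{(i :: real ^ 'n, \<alpha> :: real, \<beta> :: real). i \<in> Basis \<and> \<alpha> \<in> \<rat> \<and> \<beta> \<in> \<rat> \<and> \<alpha> < \<beta>}"
  have "countable (Basis \<times> \<rat> \<times> \<rat> :: ((real ^ 'n) \<times> real \<times> real) set)"
    by (intro countable_SIGMA countable_rat countable_finite finite_Basis)
  moreover have "?I \<subseteq> Basis \<times> \<rat> \<times> \<rat>" by auto
  ultimately have "countable ?I" using countable_subset by blast
  then have neg: "negligible (\<Union>((\<lambda>(i, \<alpha>, \<beta>). ?E i \<alpha> \<beta>) ` ?I))"
  proof (rule negligible_countable_Union[OF countable_image])
    fix X assume "X \<in> (\<lambda>(i, \<alpha>, \<beta>). ?E i \<alpha> \<beta>) ` ?I"
    then obtain i \<alpha> \<beta> where "X = ?E i \<alpha> \<beta>" "i \<in> Basis" "\<alpha> < \<beta>" by auto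
    then show "negligible X" by (simp only: negligible_two_slopes)
  qed
  have "singular \<subseteq> (\<Union>((\<lambda>(i, \<alpha>, \<beta>). ?E i \<alpha> \<beta>) ` ?I))"
  proof
    fix x assume "x \<in> singular"
    then obtain u v where uv: "u \<noteq> v" "is_normal x u" "is_normal x v" by (auto simp: singular_def)
    have n: "norm u = 1" "norm v = 1" using uv is_normal_norm by auto
    have hp: "0 < h u" "0 < h v" using n h_pos by auto
    have "(1 / h u) *\<^sub>R u \<noteq> (1 / h v) *\<^sub>R v"
    proof
      assume eq: "(1 / h u) *\<^sub>R u = (1 / h v) *\<^sub>R v"
      then have "norm ((1 / h u) *\<^sub>R u) = norm ((1 / h v) *\<^sub>R v)" by simp
      then have "h u = h v" using n hp by simp
      with eq uv(1) hp show False by simp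
    qed
    then obtain i where i: "i \<in> Basis" "(u \<bullet> i) / h u \<noteq> (v \<bullet> i) / h v"
      using euclidean_eqI[of "(1 / h u) *\<^sub>R u" "(1 / h v) *\<^sub>R v"] by auto
    have *: "x \<in> (\<Union>((\<lambda>(i, \<alpha>, \<beta>). ?E i \<alpha> \<beta>) ` ?I))"
      if uv: "is_normal x u" "is_normal x v" and lt: "(v \<bullet> i) / h v < (u \<bullet> i) / h u" for u v
    proof -
      have n: "norm u = 1" "norm v = 1" using uv is_normal_norm by auto
      have hp: "0 < h u" "0 < h v" using n h_pos by auto
      obtain \<beta> where \<beta>: "\<beta> \<in> \<rat>" "(v \<bullet> i) / h v < \<beta>" "\<beta> < (u \<bullet> i) / h u" using Rats_dense_in_real[OF lt] by blast
      obtain \<alpha> where \<alpha>: "\<alpha> \<in> \<rat>" "(v \<bullet> i) / h v < \<alpha>" "\<alpha> < \<beta>" using Rats_dense_in_real[OF \<beta>(2)] by blast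
      have "\<beta> * h u \<le> u \<bullet> i" "v \<bullet> i \<le> \<alpha> * h v" using \<alpha> \<beta> hp by (auto simp: less_divide_eq divide_less_eq)
      then have "x \<in> ?E i \<alpha> \<beta>" using uv n by (auto simp: normal_cone_set_def)
      moreover have "(i, \<alpha>, \<beta>) \<in> ?I" using i \<alpha> \<beta> by simp
      ultimately show ?thesis by blast
    qed
    show "x \<in> (\<Union>((\<lambda>(i, \<alpha>, \<beta>). ?E i \<alpha> \<beta>) ` ?I))"
    proof (cases "(v \<bullet> i) / h v < (u \<bullet> i) / h u")
      case True
      then show ?thesis using uv by (intro *)
    next
      case False
      then have "(u \<bullet> i) / h u < (v \<bullet> i) / h v" using i(2) by simp
      then show ?thesis using uv by (intro *)
    qed
  qed
  then show ?thesis by (rule negligible_subset[OF neg])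
qed

section \<open>A measurable selection of normals\<close>

text \<open>An arbitrary choice where the normal is not unique. As \<open>is_normal\<close> is the
  same predicate along an open ray, the choice is constant on every ray, not merely on almost every
  one.\<close>

definition \<nu> :: "real ^ 'n \<Rightarrow> real ^ 'n" where
  "\<nu> x = (SOME u. is_normal x u)"

lemma is_normal_\<nu>: "is_normal x (\<nu> x)"
  unfolding \<nu>_def by (rule someI_ex[OF is_normal_ex])

lemma norm_\<nu> [simp]: "norm (\<nu> x) = 1"
  using is_normal_norm[OF is_normal_\<nu>] .

lemma h_\<nu>_pos [simp]: "0 < h (\<nu> x)"
  by (simp add: h_pos)

lemma \<nu>_scale: "0 < t \<Longrightarrow> \<nu> (t *\<^sub>R x) = \<nu> x"
proof -
  assume "0 < t"
  then have "is_normal (t *\<^sub>R x) = is_normal x" by (intro ext is_normal_scale)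
  then show ?thesis by (simp add: \<nu>_def)
qed

lemma gauge_eq_\<nu>: "gauge_fun x = (\<nu> x \<bullet> x) / h (\<nu> x)"
  by (rule is_normal_gauge[OF is_normal_\<nu>])

lemma is_normal_unique: "x \<notin> singular \<Longrightarrow> is_normal x u \<Longrightarrow> u = \<nu> x"
  using is_normal_\<nu>[of x] by (auto simp: singular_def)

lemma vimage_\<nu>_subset: "\<nu> -` \<omega> \<subseteq> normal_cone_set \<omega>"
  using is_normal_\<nu> by (auto simp: normal_cone_set_def)

lemma normal_cone_set_subset: "normal_cone_set \<omega> \<subseteq> \<nu> -` \<omega> \<union> singular"
  using is_normal_unique by (auto simp: normal_cone_set_def)

lemma singular_null: "singular \<in> null_sets lebesgue"
  using negligible_singular by (simp add: negligible_iff_null_sets)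

text \<open>The preimage of a closed set differs from the closed set of all points with some normal
  in it only within the null set \<open>singular\<close>; completeness of Lebesgue measure makes the
  difference measurable, whence \<open>lebesgue\<close> as the domain.\<close>

lemma \<nu>_measurable [measurable]: "\<nu> \<in> lebesgue \<rightarrow>\<^sub>M borel"
proof (rule borel_measurableI)
  fix S :: "(real ^ 'n) set" assume S: "open S"
  let ?C = "- S"
  have "compact (S1 \<inter> ?C)" using S by (intro compact_Int_closed) (auto simp: closed_Compl)
  then have cl: "closed (normal_cone_set (S1 \<inter> ?C))" by (rule closed_normal_cone_set)
  have eq: "normal_cone_set (S1 \<inter> ?C) = normal_cone_set ?C"
    using is_normal_norm by (auto simp: normal_cone_set_def)
  have "normal_cone_set ?C - \<nu> -` ?C \<in> null_sets lebesgue"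
    using normal_cone_set_subset[of ?C] by (intro null_sets_completion_subset[OF _ singular_null]) blast
  then have N: "normal_cone_set ?C - \<nu> -` ?C \<in> sets lebesgue" by (rule null_setsD2)
  have A: "normal_cone_set ?C \<in> sets lebesgue" using cl unfolding eq by (simp add: borel_closed)
  have "normal_cone_set ?C - (normal_cone_set ?C - \<nu> -` ?C) = \<nu> -` ?C"
    using vimage_\<nu>_subset[of ?C] by blast
  with sets.Diff[OF A N] have "\<nu> -` ?C \<in> sets lebesgue" by metis
  then have "space lebesgue - \<nu> -` ?C \<in> sets lebesgue" by (rule sets.compl_sets)
  moreover have "space lebesgue - \<nu> -` ?C = \<nu> -` S \<inter> space lebesgue" by auto
  ultimately show "\<nu> -` S \<inter> space lebesgue \<in> sets lebesgue" by simp
qed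

end

section \<open>Hausdorff measure of patches of the boundary\<close>

context convex_body
begin

abbreviation hm :: "(real ^ 'n) set \<Rightarrow> ennreal" where "hm \<equiv> hausdorff_measure (CARD('n) - 1)"

text \<open>With t the quotient of the outer by the inner radius, the projection estimate has an
  error coefficient \<open>4 * t\<close>, from the height of a point, plus \<open>4 * t ^ 2\<close>,
  from the slope of the patch; \<open>t \<ge> 1\<close> bounds the sum by
  \<open>8 * t ^ 2\<close>.\<close>

definition distortion :: real where "distortion = 8 * outer_radius\<^sup>2 / inner_radius\<^sup>2"

lemma inner_radius_le_outer_radius: "inner_radius \<le> outer_radius"
proof -
  obtain u :: "real ^ 'n" where "norm u = 1" using vector_choose_size[of 1] by auto
  then show ?thesis using h_ge[of u] h_le[of u] by linarith
qed

lemma distortion_bounds: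
  "0 < distortion" "4 * outer_radius / inner_radius + 4 * outer_radius\<^sup>2 / inner_radius\<^sup>2 \<le> distortion"
  "4 * (outer_radius / inner_radius) \<le> distortion"
proof -
  define t where "t = outer_radius / inner_radius"
  have t: "1 \<le> t" using inner_radius(1) inner_radius_le_outer_radius by (simp add: t_def)
  have D: "distortion = 8 * t\<^sup>2" by (simp add: distortion_def t_def power_divide)
  have "t \<le> t\<^sup>2" using t by (simp add: power2_eq_square)
  moreover have "4 * outer_radius / inner_radius + 4 * outer_radius\<^sup>2 / inner_radius\<^sup>2 = 4 * t + 4 * t\<^sup>2"
    by (simp add: t_def power_divide)
  ultimately show "4 * outer_radius / inner_radius + 4 * outer_radius\<^sup>2 / inner_radius\<^sup>2 \<le> distortion"
    "4 * (outer_radius / inner_radius) \<le> distortion" "0 < distortion"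
    using t unfolding D by (auto simp: t_def[symmetric])
qed

text \<open>On boundary points whose normals are within \<open>\<delta>\<close> of \<open>u\<close>, the central projection to the
  hyperplane \<open>{z. z \<bullet> u = 1}\<close> is a similarity with factor \<open>1 / h u\<close> up to a relative error of order
  \<open>\<delta>\<close>; no smoothness of the boundary is needed.\<close>

context
  fixes u :: "real ^ 'n" and \<delta> :: real and q :: real
  assumes u: "norm u = 1" and \<delta>: "0 \<le> \<delta>" and q_def: "q = distortion * \<delta>" and q_half: "q \<le> 1/2"
begin

lemma q_nonneg: "0 \<le> q"
  using \<delta> distortion_bounds(1) by (simp add: q_def)

lemma patch_h:
  assumes "norm (v - u) \<le> \<delta>"
  shows "\<bar>h v - h u\<bar> \<le> h u * q"
proof -
  have "\<bar>h v - h u\<bar> \<le> outer_radius * \<delta>"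
    using h_Lipschitz[of v u] mult_left_mono[OF assms less_imp_le[OF outer_radius(1)]] by linarith
  also have "outer_radius * \<delta> \<le> h u * q"
  proof -
    have "outer_radius / inner_radius \<le> distortion" using distortion_bounds(3) inner_radius(1) outer_radius(1)
      by (smt (verit) divide_pos_pos)
    then have "inner_radius * (outer_radius / inner_radius) \<le> h u * distortion"
      using h_ge[OF u] inner_radius(1) outer_radius(1) h_pos[OF u] by (intro mult_mono) auto
    then have "outer_radius \<le> h u * distortion" using inner_radius(1) by simp
    then have "outer_radius * \<delta> \<le> h u * distortion * \<delta>" using \<delta> by (rule mult_right_mono)
    then show ?thesis by (simp add: q_def mult.assoc)
  qed
  finally show ?thesis .
qed

text \<open>Two errors of size \<open>outer_radius * \<delta>\<close> add up: \<open>u\<close>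
  replaces the nearby normal \<open>v\<close> in the inner product, and \<open>h u\<close> replaces
  \<open>h v\<close>.\<close>

lemma patch_height:
  assumes x: "x \<in> reverse_spherical_image K (S1 \<inter> cball u \<delta>)"
  shows "\<bar>x \<bullet> u - h u\<bar> \<le> 2 * outer_radius * \<delta>" "norm x \<le> outer_radius" "inner_radius / 2 \<le> x \<bullet> u"
    "\<bar>x \<bullet> u - h u\<bar> \<le> h u * q" "0 < x \<bullet> u"
proof -
  obtain v where v: "norm v = 1" "norm (v - u) \<le> \<delta>" "x \<bullet> v = h v" and "x \<in> frontier K"
    using x by (auto simp: reverse_spherical_image_def dist_norm norm_minus_commute)
  then have "x \<in> K" by (simp add: frontier_def compact_imp_closed[OF compact_K])
  then show nx: "norm x \<le> outer_radius" by (rule outer_radius(2))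
  have "\<bar>x \<bullet> (u - v)\<bar> \<le> norm x * norm (u - v)" by (rule Cauchy_Schwarz_ineq2)
  also have "\<dots> \<le> outer_radius * \<delta>" using nx v(2) outer_radius(1) by (intro mult_mono) (auto simp: norm_minus_commute)
  finally have 1: "\<bar>x \<bullet> (u - v)\<bar> \<le> outer_radius * \<delta>" .
  have "\<bar>h v - h u\<bar> \<le> outer_radius * \<delta>"
    using h_Lipschitz[of v u] mult_left_mono[OF v(2) less_imp_le[OF outer_radius(1)]] by linarith
  then show 2: "\<bar>x \<bullet> u - h u\<bar> \<le> 2 * outer_radius * \<delta>"
    using 1 v(3) by (simp add: inner_diff_right)
  have "4 * (outer_radius / inner_radius) * \<delta> \<le> q"
    unfolding q_def using distortion_bounds(3) \<delta> by (rule mult_right_mono)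
  then have "4 * outer_radius * \<delta> \<le> inner_radius * q"
    using inner_radius(1) by (simp add: pos_divide_le_eq mult_ac)
  moreover have "inner_radius * q \<le> h u * q" using h_ge[OF u] q_nonneg by (rule mult_right_mono)
  moreover have "0 \<le> outer_radius * \<delta>" using \<delta> outer_radius(1) by simp
  ultimately show 3: "\<bar>x \<bullet> u - h u\<bar> \<le> h u * q" using 2 by linarith
  then have "h u - h u * q \<le> x \<bullet> u" by linarith
  moreover have "h u * q \<le> h u * (1/2)" using q_half h_pos[OF u] by (intro mult_left_mono) auto
  ultimately show "inner_radius / 2 \<le> x \<bullet> u" using h_ge[OF u] by linarith
  then show "0 < x \<bullet> u" using inner_radius(1) by linarith
qed

text \<open>Each point maximizes the inner product with a vector within \<open>\<delta>\<close> of
  \<open>u\<close>, so in the direction \<open>u\<close> the other point can exceed it by at most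
  \<open>\<delta> * norm (x - y)\<close>; exchanging the two points gives the absolute
  value.\<close>

lemma patch_slope:
  assumes x: "x \<in> reverse_spherical_image K (S1 \<inter> cball u \<delta>)"
    and y: "y \<in> reverse_spherical_image K (S1 \<inter> cball u \<delta>)"
  shows "\<bar>x \<bullet> u - y \<bullet> u\<bar> \<le> \<delta> * norm (x - y)"
proof -
  have *: "y \<bullet> u - x \<bullet> u \<le> \<delta> * norm (x - y)"
    if x: "x \<in> reverse_spherical_image K (S1 \<inter> cball u \<delta>)"
      and y: "y \<in> reverse_spherical_image K (S1 \<inter> cball u \<delta>)" for x y
  proof -
    obtain v where v: "norm (v - u) \<le> \<delta>" "x \<bullet> v = h v"
      using x by (auto simp: reverse_spherical_image_def dist_norm norm_minus_commute)
    have "y \<in> K" using y by (auto simp: reverse_spherical_image_def frontier_def compact_imp_closed[OF compact_K])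
    then have "y \<bullet> v \<le> x \<bullet> v" using h_upper[of y v] v(2) by (simp add: inner_commute)
    then have "(y - x) \<bullet> v \<le> 0" by (simp add: inner_diff_left)
    moreover have "(y - x) \<bullet> (u - v) \<le> norm (y - x) * norm (u - v)" by (rule norm_cauchy_schwarz)
    moreover have "norm (y - x) * norm (u - v) \<le> norm (y - x) * \<delta>"
      using v(1) by (intro mult_left_mono) (auto simp: norm_minus_commute)
    ultimately have "(y - x) \<bullet> u \<le> norm (y - x) * \<delta>" by (simp add: inner_diff_right)
    then show ?thesis by (simp add: inner_diff_left norm_minus_commute mult.commute)
  qed
  show ?thesis using *[OF x y] *[OF y x] by (simp add: abs_le_iff norm_minus_commute)
qed

definition cproj :: "real ^ 'n \<Rightarrow> real ^ 'n" where "cproj x = (1 / (x \<bullet> u)) *\<^sub>R x"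

text \<open>The deviation splits in two: the factor \<open>1 / (x \<bullet> u)\<close> replaces
  \<open>1 / h u\<close>, and the factors at \<open>x\<close> and \<open>y\<close> differ. The first
  is small by the height bound. The second is small by the slope bound, which supplies the needed
  \<open>norm (x - y)\<close>.\<close>

lemma cproj_near_similarity:
  assumes x: "x \<in> reverse_spherical_image K (S1 \<inter> cball u \<delta>)"
    and y: "y \<in> reverse_spherical_image K (S1 \<inter> cball u \<delta>)"
  shows "norm (cproj x - cproj y - (1 / h u) *\<^sub>R (x - y)) \<le> (q / h u) * norm (x - y)"
proof -
  define a b c where "a = x \<bullet> u" "b = y \<bullet> u" "c = h u"
  have pos: "0 < a" "0 < b" "0 < c" "inner_radius / 2 \<le> a" "inner_radius / 2 \<le> b" "inner_radius \<le> c" "c \<le> outer_radius"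
    using patch_height[OF x] patch_height[OF y] h_pos[OF u] h_ge[OF u] h_le[OF u] by (auto simp: a_b_c_def)
  have r: "0 < inner_radius" by (rule inner_radius)
  have ac: "\<bar>1 / a - 1 / c\<bar> \<le> (4 * outer_radius / inner_radius * \<delta>) / c"
  proof -
    have "1 / a - 1 / c = ((c - a) / a) / c" using pos by (simp add: field_simps)
    then have "\<bar>1 / a - 1 / c\<bar> = (\<bar>a - c\<bar> / a) / c" using pos by (simp add: abs_divide abs_minus_commute)
    also have "\<dots> \<le> ((2 * outer_radius * \<delta>) / (inner_radius / 2)) / c"
      using patch_height(1)[OF x] pos r \<delta> outer_radius(1)
      by (intro divide_right_mono frac_le) (auto simp: a_b_c_def)
    finally show ?thesis by (simp add: mult.assoc)
  qed
  have ab: "\<bar>1 / a - 1 / b\<bar> \<le> (4 * \<delta> * norm (x - y) / inner_radius\<^sup>2)"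
  proof -
    have "1 / a - 1 / b = (b - a) / (a * b)" using pos by (simp add: field_simps)
    then have "\<bar>1 / a - 1 / b\<bar> = \<bar>a - b\<bar> / (a * b)" using pos by (simp add: abs_divide abs_minus_commute abs_mult)
    also have "\<dots> \<le> (\<delta> * norm (x - y)) / ((inner_radius / 2) * (inner_radius / 2))"
      using patch_slope[OF x y] pos r \<delta>
      by (intro frac_le mult_mono) (auto simp: a_b_c_def)
    finally show ?thesis by (simp add: power2_eq_square mult_ac)
  qed
  have "cproj x - cproj y - (1 / c) *\<^sub>R (x - y) = (1 / a - 1 / c) *\<^sub>R (x - y) + (1 / a - 1 / b) *\<^sub>R y"
    by (simp add: cproj_def a_b_c_def algebra_simps)
  then have "norm (cproj x - cproj y - (1 / c) *\<^sub>R (x - y)) \<le> \<bar>1 / a - 1 / c\<bar> * norm (x - y) + \<bar>1 / a - 1 / b\<bar> * norm y"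
    by (metis norm_triangle_ineq norm_scaleR)
  also have "\<dots> \<le> (4 * outer_radius / inner_radius * \<delta>) / c * norm (x - y)
      + (4 * \<delta> * norm (x - y) / inner_radius\<^sup>2) * outer_radius"
    using ac ab patch_height(2)[OF y] by (intro add_mono mult_mono) (use \<delta> r in auto)
  also have "(4 * \<delta> * norm (x - y) / inner_radius\<^sup>2) * outer_radius
      \<le> (4 * outer_radius\<^sup>2 / inner_radius\<^sup>2 * \<delta>) / c * norm (x - y)"
  proof -
    have "outer_radius \<le> outer_radius\<^sup>2 / c" using pos outer_radius(1) by (simp add: le_divide_eq power2_eq_square)
    then have "(4 * \<delta> * norm (x - y) / inner_radius\<^sup>2) * outer_radius \<le> (4 * \<delta> * norm (x - y) / inner_radius\<^sup>2) * (outer_radius\<^sup>2 / c)"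
      using \<delta> by (intro mult_left_mono) auto
    then show ?thesis by (simp add: mult_ac)
  qed
  also have "(4 * outer_radius / inner_radius * \<delta>) / c * norm (x - y) + (4 * outer_radius\<^sup>2 / inner_radius\<^sup>2 * \<delta>) / c * norm (x - y)
      = ((4 * outer_radius / inner_radius + 4 * outer_radius\<^sup>2 / inner_radius\<^sup>2) * \<delta>) / c * norm (x - y)"
    by (simp add: distrib_right add_divide_distrib)
  also have "\<dots> \<le> (distortion * \<delta>) / c * norm (x - y)"
    using distortion_bounds(2) \<delta> pos by (intro mult_right_mono divide_right_mono) auto
  finally show ?thesis by (simp add: a_b_c_def q_def)
qed

text \<open>The flat image satisfies the exact cone formula. Passing to it costs
  \<open>1 + q\<close> or \<open>1 - q\<close> to the power n for the height of the cone and to the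
  power n - 1 for the Lipschitz factor, which explains the exponent; the powers of
  \<open>h u\<close> collapse to a single one.\<close>

lemma patch_volume:
  assumes A: "compact A" "A \<subseteq> reverse_spherical_image K (S1 \<inter> cball u \<delta>)"
  shows "of_nat CARD('n) * emeasure lborel (cone_upto 1 A) \<le> ennreal (h u * (1 + q) ^ (CARD('n) + (CARD('n) - 1))) * hm A"
    and "ennreal (h u * (1 - q) ^ (CARD('n) + (CARD('n) - 1))) * hm A \<le> of_nat CARD('n) * emeasure lborel (cone_upto 1 A)"
proof -
  define c where "c = h u"
  define k where "k = CARD('n) - 1"
  have n: "CARD('n) = Suc k" using dim_ge_2 by (simp add: k_def)
  have c: "0 < c" using h_pos[OF u] by (simp add: c_def)
  have q1: "0 < 1 - q" "0 < 1 + q" using q_half q_nonneg by auto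
  let ?Q = "cproj ` A"
  have hgt: "\<bar>x \<bullet> u - c\<bar> \<le> c * q" "0 < x \<bullet> u" if "x \<in> A" for x
    using patch_height[of x] A(2) that by (auto simp: c_def)
  have "continuous_on A cproj"
    unfolding cproj_def using hgt(2) by (intro continuous_intros) force
  then have cQ: "compact ?Q" using A(1) by (rule compact_continuous_image)
  have Qu: "p \<bullet> u = 1" if "p \<in> ?Q" for p
    using that hgt(2) by (force simp: cproj_def)
  have up: "norm (cproj x - cproj y) \<le> (1 + q) / c * norm (x - y)"
    and low: "(1 - q) / c * norm (x - y) \<le> norm (cproj x - cproj y)" if "x \<in> A" "y \<in> A" for x y
  proof -
    have near: "norm (cproj x - cproj y - (1 / c) *\<^sub>R (x - y)) \<le> (q / c) * norm (x - y)"
      unfolding c_def using that A(2) by (intro cproj_near_similarity) auto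
    have nn: "norm ((1 / c) *\<^sub>R (x - y)) = (1 / c) * norm (x - y)" using c by simp
    show "norm (cproj x - cproj y) \<le> (1 + q) / c * norm (x - y)"
      using near nn norm_triangle_ineq2[of "cproj x - cproj y" "(1 / c) *\<^sub>R (x - y)"]
      by (simp only: add_divide_distrib distrib_right)
    show "(1 - q) / c * norm (x - y) \<le> norm (cproj x - cproj y)"
      using near nn norm_triangle_ineq2[of "(1 / c) *\<^sub>R (x - y)" "cproj x - cproj y"]
      by (simp only: diff_divide_distrib left_diff_distrib norm_minus_commute)
  qed
  have "((1 + q) / c)-lipschitz_on A cproj"
    using up c q1 by (intro lipschitz_onI) (auto simp: dist_norm)
  then have HQ: "hm ?Q \<le> ennreal (((1 + q) / c) ^ k) * hm A"
    unfolding k_def using c q1 by (intro hausdorff_measure_lipschitz_image) auto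
  have inj: "inj_on cproj A"
  proof (rule inj_onI)
    fix x y assume xy: "x \<in> A" "y \<in> A" "cproj x = cproj y"
    then have "(1 - q) / c * norm (x - y) \<le> 0" using low[OF xy(1,2)] by simp
    then have "norm (x - y) \<le> 0" using divide_pos_pos[OF q1(1) c] by (metis mult_pos_pos not_le)
    then show "x = y" by simp
  qed
  have "(c / (1 - q))-lipschitz_on ?Q (inv_into A cproj)"
  proof (rule lipschitz_onI)
    fix p p' assume "p \<in> ?Q" "p' \<in> ?Q"
    then obtain x y where xy: "x \<in> A" "y \<in> A" "p = cproj x" "p' = cproj y" by blast
    have "norm (x - y) \<le> c / (1 - q) * norm (cproj x - cproj y)"
      using low[OF xy(1,2)] c q1 by (simp add: field_simps)
    then show "dist (inv_into A cproj p) (inv_into A cproj p') \<le> c / (1 - q) * dist p p'"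
      using xy inj by (simp add: dist_norm)
  qed (use c q1 in auto)
  then have "hm (inv_into A cproj ` ?Q) \<le> ennreal ((c / (1 - q)) ^ k) * hm ?Q"
    unfolding k_def using c q1 by (intro hausdorff_measure_lipschitz_image) auto
  then have HA: "hm A \<le> ennreal ((c / (1 - q)) ^ k) * hm ?Q"
    using inj by (simp add: inv_into_image_cancel)
  have flat: "of_nat CARD('n) * emeasure lborel (cone_upto t ?Q) = ennreal (t ^ CARD('n)) * hm ?Q" if "0 \<le> t" for t
    by (rule emeasure_flat_cone[OF dim_ge_2 u cQ Qu that])
  have sub1: "cone_upto 1 A \<subseteq> cone_upto (c * (1 + q)) ?Q"
  proof
    fix z assume "z \<in> cone_upto 1 A"
    then obtain s x where z: "z = s *\<^sub>R x" "0 \<le> s" "s \<le> 1" "x \<in> A" by (auto simp: cone_upto_def)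
    have "z = (s * (x \<bullet> u)) *\<^sub>R cproj x" using z hgt(2)[OF z(4)] by (simp add: cproj_def)
    moreover have "s * (x \<bullet> u) \<le> 1 * (c * (1 + q))"
      using z hgt[OF z(4)] by (intro mult_mono) (auto simp: algebra_simps)
    moreover have "0 \<le> s * (x \<bullet> u)" using z hgt(2)[OF z(4)] by simp
    ultimately show "z \<in> cone_upto (c * (1 + q)) ?Q" using z(4) unfolding cone_upto_def by auto
  qed
  have sub2: "cone_upto (c * (1 - q)) ?Q \<subseteq> cone_upto 1 A"
  proof
    fix z assume "z \<in> cone_upto (c * (1 - q)) ?Q"
    then obtain s x where z: "z = s *\<^sub>R cproj x" "0 \<le> s" "s \<le> c * (1 - q)" "x \<in> A" by (auto simp: cone_upto_def)
    have "z = (s / (x \<bullet> u)) *\<^sub>R x" using z by (simp add: cproj_def)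
    moreover have "s / (x \<bullet> u) \<le> 1" using z hgt[OF z(4)] by (simp add: divide_le_eq algebra_simps)
    moreover have "0 \<le> s / (x \<bullet> u)" using z hgt(2)[OF z(4)] by simp
    ultimately show "z \<in> cone_upto 1 A" using z(4) unfolding cone_upto_def by blast
  qed
  have bor: "cone_upto 1 A \<in> sets lborel" "cone_upto t ?Q \<in> sets lborel" for t
    using compact_cone_upto[OF A(1)] compact_cone_upto[OF cQ] by (auto simp: borel_compact)
  have "of_nat CARD('n) * emeasure lborel (cone_upto 1 A) \<le> of_nat CARD('n) * emeasure lborel (cone_upto (c * (1 + q)) ?Q)"
    by (intro mult_left_mono emeasure_mono sub1 bor) simp
  also have "\<dots> = ennreal ((c * (1 + q)) ^ CARD('n)) * hm ?Q"
    using c q1 by (intro flat) simp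
  also have "\<dots> \<le> ennreal ((c * (1 + q)) ^ CARD('n)) * (ennreal (((1 + q) / c) ^ k) * hm A)"
    by (intro mult_left_mono HQ) simp
  also have "\<dots> = ennreal ((c * (1 + q)) ^ CARD('n) * ((1 + q) / c) ^ k) * hm A"
    using c q1 by (simp add: ennreal_mult mult.assoc)
  also have "(c * (1 + q)) ^ CARD('n) * ((1 + q) / c) ^ k = c * (1 + q) ^ (CARD('n) + k)"
    using c by (simp add: n power_mult_distrib power_divide power_add)
  finally show "of_nat CARD('n) * emeasure lborel (cone_upto 1 A) \<le> ennreal (h u * (1 + q) ^ (CARD('n) + (CARD('n) - 1))) * hm A"
    unfolding c_def k_def .
  have "ennreal (c * (1 - q) ^ (CARD('n) + k)) * hm A
      \<le> ennreal (c * (1 - q) ^ (CARD('n) + k)) * (ennreal ((c / (1 - q)) ^ k) * hm ?Q)"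
    by (intro mult_left_mono HA) simp
  also have "\<dots> = ennreal (c * (1 - q) ^ (CARD('n) + k) * (c / (1 - q)) ^ k) * hm ?Q"
    using c q1 by (simp add: ennreal_mult mult.assoc)
  also have "c * (1 - q) ^ (CARD('n) + k) * (c / (1 - q)) ^ k = (c * (1 - q)) ^ CARD('n)"
    using c q1 by (simp add: n power_mult_distrib power_divide power_add)
  also have "ennreal ((c * (1 - q)) ^ CARD('n)) * hm ?Q = of_nat CARD('n) * emeasure lborel (cone_upto (c * (1 - q)) ?Q)"
    using c q1 by (intro flat[symmetric]) simp
  also have "\<dots> \<le> of_nat CARD('n) * emeasure lborel (cone_upto 1 A)"
    by (intro mult_left_mono emeasure_mono sub2 bor) simp
  finally show "ennreal (h u * (1 - q) ^ (CARD('n) + (CARD('n) - 1))) * hm A \<le> of_nat CARD('n) * emeasure lborel (cone_upto 1 A)"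
    unfolding c_def k_def .
qed

end

section \<open>A weighted volume that measures boundary area\<close>

text \<open>The cone over a patch with normals near \<open>u\<close> has volume about
  \<open>h u / n\<close> times the area of the patch. The density is the inverse of this factor, so
  the cone has \<open>\<kappa>\<close>-measure close to that area.\<close>

definition \<kappa> :: "(real ^ 'n) measure" where
  "\<kappa> = density lebesgue (\<lambda>x. indicator K x * ennreal (CARD('n) / h (\<nu> x)))"

lemma sets_\<kappa> [simp, measurable_cong]: "sets \<kappa> = sets lebesgue"
  by (simp add: \<kappa>_def)

lemma space_\<kappa> [simp]: "space \<kappa> = UNIV"
  by (simp add: \<kappa>_def)

lemma K_lebesgue [measurable]: "K \<in> sets lebesgue"
  using compact_K by (simp add: borel_compact)

lemma emeasure_\<kappa>:
  "E \<in> sets lebesgue \<Longrightarrow> emeasure \<kappa> E = (\<integral>\<^sup>+x. indicator K x * ennreal (CARD('n) / h (\<nu> x)) * indicator E x \<partial>lebesgue)"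
  unfolding \<kappa>_def by (subst emeasure_density) (auto intro!: borel_measurable_times_ennreal borel_measurable_indicator measurable_compose[OF \<nu>_measurable])

text \<open>Singular points are exempted from the bound, since there the selected normal may be far
  from the others.\<close>

lemma emeasure_\<kappa>_le:
  assumes E: "E \<in> sets lebesgue" and c: "0 < c"
    and le: "\<And>x. x \<in> E \<Longrightarrow> x \<notin> singular \<Longrightarrow> c \<le> h (\<nu> x)"
  shows "emeasure \<kappa> E \<le> ennreal (CARD('n) / c) * emeasure lebesgue E"
proof -
  have "AE x in lebesgue. x \<notin> singular" by (rule AE_not_in[OF singular_null])
  then have "emeasure \<kappa> E \<le> (\<integral>\<^sup>+x. ennreal (CARD('n) / c) * indicator E x \<partial>lebesgue)"
    unfolding emeasure_\<kappa>[OF E] by (intro nn_integral_mono_AE) (auto elim!: eventually_mono intro!: ennreal_leI divide_left_mono le mult_pos_pos c simp: indicator_def)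
  then show ?thesis using E by (simp add: nn_integral_cmult_indicator)
qed

lemma emeasure_\<kappa>_ge:
  assumes E: "E \<in> sets lebesgue" "E \<subseteq> K"
    and le: "\<And>x. x \<in> E \<Longrightarrow> x \<notin> singular \<Longrightarrow> h (\<nu> x) \<le> c"
  shows "ennreal (CARD('n) / c) * emeasure lebesgue E \<le> emeasure \<kappa> E"
proof -
  have "AE x in lebesgue. x \<notin> singular" by (rule AE_not_in[OF singular_null])
  moreover have "0 < c" if "x \<in> E" "x \<notin> singular" for x using le[OF that] h_\<nu>_pos[of x] by linarith
  ultimately have "(\<integral>\<^sup>+x. ennreal (CARD('n) / c) * indicator E x \<partial>lebesgue) \<le> emeasure \<kappa> E"
    unfolding emeasure_\<kappa>[OF E(1)] using E(2)
    by (intro nn_integral_mono_AE) (auto elim!: eventually_mono intro!: ennreal_leI divide_left_mono le mult_pos_pos simp: indicator_def)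
  then show ?thesis using E by (simp add: nn_integral_cmult_indicator)
qed

lemma emeasure_\<kappa>_le_inner_radius: "E \<in> sets lebesgue \<Longrightarrow> emeasure \<kappa> E \<le> ennreal (CARD('n) / inner_radius) * emeasure lebesgue E"
  by (intro emeasure_\<kappa>_le inner_radius h_ge) auto

lemma null_sets_\<kappa>: "N \<in> null_sets lebesgue \<Longrightarrow> emeasure \<kappa> N = 0"
  using emeasure_\<kappa>_le_inner_radius[of N] by (auto simp: null_sets_def)

lemma emeasure_\<kappa>_K: "emeasure \<kappa> (K \<inter> E) = emeasure \<kappa> E" if "E \<in> sets lebesgue"
  using that by (subst (1 2) emeasure_\<kappa>) (auto intro!: nn_integral_cong simp: indicator_def)

lemma finite_measure_\<kappa>: "finite_measure \<kappa>"
proof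
  have "emeasure \<kappa> (space \<kappa>) = emeasure \<kappa> K" using emeasure_\<kappa>_K[of UNIV] by simp
  also have "\<dots> \<le> ennreal (CARD('n) / inner_radius) * emeasure lebesgue K" by (intro emeasure_\<kappa>_le_inner_radius) simp
  also have "\<dots> < top" using emeasure_compact_finite[OF compact_K] compact_K by (auto simp: ennreal_mult_less_top borel_compact)
  finally show "emeasure \<kappa> (space \<kappa>) \<noteq> \<infinity>" by simp
qed

text \<open>The patch size depends on the tolerance alone, not on the direction. The two ratios kept
  below \<open>1 + e\<close> combine the distortion of the cone with the variation of
  \<open>h\<close> in the density of \<open>\<kappa>\<close>.\<close>

lemma patch_measure:
  assumes e: "0 < e"
  obtains \<delta> where "0 < \<delta>"
    "\<And>u A. norm u = 1 \<Longrightarrow> compact A \<Longrightarrow> A \<subseteq> reverse_spherical_image K (S1 \<inter> cball u \<delta>) \<Longrightarrow>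
      emeasure \<kappa> (cone_upto 1 A) \<le> ennreal (1 + e) * hm A \<and> hm A \<le> ennreal (1 + e) * emeasure \<kappa> (cone_upto 1 A)"
proof -
  define m where "m = CARD('n) + (CARD('n) - 1)"
  have "((\<lambda>q::real. (1 + q) ^ m / (1 - q)) \<longlongrightarrow> (1 + 0) ^ m / (1 - 0)) (at_right 0)"
    by (intro tendsto_intros) auto
  then have ev1: "eventually (\<lambda>q::real. (1 + q) ^ m / (1 - q) < 1 + e) (at_right 0)"
    using e by (intro order_tendstoD(2)) auto
  have "((\<lambda>q::real. (1 + q) / (1 - q) ^ m) \<longlongrightarrow> (1 + 0) / (1 - 0) ^ m) (at_right 0)"
    by (intro tendsto_intros) auto
  then have ev2: "eventually (\<lambda>q::real. (1 + q) / (1 - q) ^ m < 1 + e) (at_right 0)"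
    using e by (intro order_tendstoD(2)) auto
  have "eventually (\<lambda>q::real. q \<in> {0<..<1/2}) (at_right 0)" by (intro eventually_at_right_real) simp
  from eventually_conj[OF this eventually_conj[OF ev1 ev2]] obtain q :: real
    where q: "0 < q" "q < 1/2" "(1 + q) ^ m / (1 - q) < 1 + e" "(1 + q) / (1 - q) ^ m < 1 + e"
    by (auto dest!: eventually_happens)
  define \<delta> where "\<delta> = q / distortion"
  have \<delta>: "0 < \<delta>" "q = distortion * \<delta>" using q(1) distortion_bounds(1) by (auto simp: \<delta>_def)
  show ?thesis
  proof (rule that[OF \<delta>(1)])
    fix u A assume u: "norm u = 1" and A: "compact A" "A \<subseteq> reverse_spherical_image K (S1 \<inter> cball u \<delta>)"
    define c where "c = h u"
    have c: "0 < c" using h_pos[OF u] by (simp add: c_def)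
    let ?C = "cone_upto 1 A" and ?n = "of_nat CARD('n) :: ennreal"
    have prem: "norm u = 1" "0 \<le> \<delta>" "q = distortion * \<delta>" "q \<le> 1/2" using u \<delta> q by auto
    note vol = patch_volume[OF prem A, folded m_def c_def]
    have bC: "?C \<in> sets borel" using compact_cone_upto[OF A(1)] by (rule borel_compact)
    then have mC: "?C \<in> sets lebesgue" by simp
    have sub: "?C \<subseteq> K \<inter> normal_cone_set (S1 \<inter> cball u \<delta>)"
      using cone_upto_mono[OF order_refl A(2), of 1] cone_upto_reverse_spherical_image[of "S1 \<inter> cball u \<delta>"] by auto
    \<comment> \<open>Off the singular set the selected normal must be the one known to lie near
      \<open>u\<close>.\<close>
    have hb: "c * (1 - q) \<le> h (\<nu> x) \<and> h (\<nu> x) \<le> c * (1 + q)" if "x \<in> ?C" "x \<notin> singular" for x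
    proof -
      have "x \<in> normal_cone_set (S1 \<inter> cball u \<delta>)" using sub that(1) by blast
      then obtain v where v: "v \<in> cball u \<delta>" "is_normal x v" unfolding normal_cone_set_def by blast
      have "v = \<nu> x" using is_normal_unique[OF that(2) v(2)] .
      then have "\<bar>h (\<nu> x) - h u\<bar> \<le> h u * q"
        using v(1) by (intro patch_h[OF prem]) (simp add: dist_norm norm_minus_commute)
      then show ?thesis by (simp add: c_def algebra_simps abs_le_iff)
    qed
    have n_split: "ennreal (CARD('n) / d) = ennreal (1 / d) * ?n" if "0 < d" for d
      using that by (simp add: ennreal_of_nat_eq_real_of_nat ennreal_mult'[symmetric])
    have em: "emeasure lebesgue ?C = emeasure lborel ?C" using bC by simp
    have "emeasure \<kappa> ?C \<le> ennreal (CARD('n) / (c * (1 - q))) * emeasure lborel ?C"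
      unfolding em[symmetric] using hb c q by (intro emeasure_\<kappa>_le mC) auto
    also have "\<dots> = ennreal (1 / (c * (1 - q))) * (?n * emeasure lborel ?C)"
      using c q by (subst n_split) (auto simp: mult.assoc)
    also have "\<dots> \<le> ennreal (1 / (c * (1 - q))) * (ennreal (c * (1 + q) ^ m) * hm A)"
      by (intro mult_left_mono vol) simp
    also have "\<dots> = ennreal (1 / (c * (1 - q)) * (c * (1 + q) ^ m)) * hm A"
      using c q by (subst mult.assoc[symmetric], subst ennreal_mult'[symmetric]) auto
    also have "1 / (c * (1 - q)) * (c * (1 + q) ^ m) = (1 + q) ^ m / (1 - q)" using c by simp
    also have "ennreal ((1 + q) ^ m / (1 - q)) * hm A \<le> ennreal (1 + e) * hm A"
      using q by (intro mult_right_mono ennreal_leI) auto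
    finally have 1: "emeasure \<kappa> ?C \<le> ennreal (1 + e) * hm A" .
    have "hm A = ennreal (1 / (c * (1 - q) ^ m)) * (ennreal (c * (1 - q) ^ m) * hm A)"
      using c q by (simp add: mult.assoc[symmetric] ennreal_mult'[symmetric])
    also have "\<dots> \<le> ennreal (1 / (c * (1 - q) ^ m)) * (?n * emeasure lborel ?C)"
      by (intro mult_left_mono vol) simp
    also have "\<dots> = ennreal ((1 + q) / (1 - q) ^ m) * (ennreal (1 / (c * (1 + q))) * (?n * emeasure lborel ?C))"
    proof -
      have "1 / (c * (1 - q) ^ m) = (1 + q) / (1 - q) ^ m * (1 / (c * (1 + q)))" using c q by simp
      then show ?thesis using c q by (simp only: mult.assoc[symmetric]) (simp add: ennreal_mult'[symmetric])
    qed
    also have "ennreal (1 / (c * (1 + q))) * (?n * emeasure lborel ?C) = ennreal (CARD('n) / (c * (1 + q))) * emeasure lebesgue ?C"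
      using c q by (subst n_split) (auto simp: mult.assoc em)
    also have "ennreal ((1 + q) / (1 - q) ^ m) * (ennreal (CARD('n) / (c * (1 + q))) * emeasure lebesgue ?C)
        \<le> ennreal (1 + e) * emeasure \<kappa> ?C"
      using hb sub q by (intro mult_mono ennreal_leI emeasure_\<kappa>_ge mC) auto
    finally have 2: "hm A \<le> ennreal (1 + e) * emeasure \<kappa> ?C" .
    show "emeasure \<kappa> ?C \<le> ennreal (1 + e) * hm A \<and> hm A \<le> ennreal (1 + e) * emeasure \<kappa> ?C"
      using 1 2 by simp
  qed
qed

end

section \<open>The surface area measure as an image of Lebesgue measure\<close>

context convex_body
begin

abbreviation \<tau> :: "(real ^ 'n) set \<Rightarrow> (real ^ 'n) set" where "\<tau> \<equiv> reverse_spherical_image K"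

lemma \<tau>_mono: "\<omega> \<subseteq> \<omega>' \<Longrightarrow> \<tau> \<omega> \<subseteq> \<tau> \<omega>'"
  by (auto simp: reverse_spherical_image_def)

lemma \<tau>_UN: "\<tau> (\<Union>i\<in>I. \<omega> i) = (\<Union>i\<in>I. \<tau> (\<omega> i))"
  by (auto simp: reverse_spherical_image_def)

text \<open>Defined on all Borel sets of the space, so that regularity of finite Borel measures
  applies; its mass sits on the sphere.\<close>

definition normal_measure :: "(real ^ 'n) measure" where
  "normal_measure = distr \<kappa> borel \<nu>"

lemma \<nu>_measurable_\<kappa> [measurable]: "\<nu> \<in> \<kappa> \<rightarrow>\<^sub>M borel"
  using \<nu>_measurable by (simp cong: measurable_cong_sets)

lemma sets_normal_measure [simp]: "sets normal_measure = sets borel"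
  by (simp add: normal_measure_def)

lemma emeasure_normal_measure: "\<omega> \<in> sets borel \<Longrightarrow> emeasure normal_measure \<omega> = emeasure \<kappa> (\<nu> -` \<omega>)"
  unfolding normal_measure_def by (subst emeasure_distr[OF \<nu>_measurable_\<kappa>]) auto

lemma vimage_\<nu>_lebesgue: "\<omega> \<in> sets borel \<Longrightarrow> \<nu> -` \<omega> \<in> sets lebesgue"
  using measurable_sets[OF \<nu>_measurable] by simp

lemma finite_normal_measure: "finite_measure normal_measure"
  unfolding normal_measure_def
  using finite_measure.finite_measure_distr[OF finite_measure_\<kappa> \<nu>_measurable_\<kappa>] .

lemma normal_measure_less_top: "emeasure normal_measure \<omega> < top"
  using finite_measure.emeasure_finite[OF finite_normal_measure, of \<omega>] by (simp add: less_top)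

text \<open>Within \<open>K\<close> the cone over the image of \<open>\<omega>\<close> and the
  preimage of \<open>\<omega>\<close> under \<open>\<nu>\<close> differ only by singular
  points.\<close>

lemma emeasure_\<kappa>_cone:
  assumes \<omega>: "compact \<omega>" "\<omega> \<subseteq> S1"
  shows "emeasure \<kappa> (cone_upto 1 (\<tau> \<omega>)) = emeasure normal_measure \<omega>"
proof -
  have b: "\<omega> \<in> sets borel" using \<omega> by (simp add: borel_compact)
  have c: "normal_cone_set \<omega> \<in> sets lebesgue" using closed_normal_cone_set[OF \<omega>(1)] by (simp add: borel_closed)
  have v: "\<nu> -` \<omega> \<in> sets lebesgue" by (rule vimage_\<nu>_lebesgue[OF b])
  have s: "singular \<in> sets lebesgue" using singular_null by (rule null_setsD2)
  have "emeasure \<kappa> (cone_upto 1 (\<tau> \<omega>)) = emeasure \<kappa> (normal_cone_set \<omega>)"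
    unfolding cone_upto_reverse_spherical_image[OF \<omega>(2)] by (rule emeasure_\<kappa>_K[OF c])
  also have "\<dots> = emeasure \<kappa> (\<nu> -` \<omega>)"
  proof (rule antisym)
    have "emeasure \<kappa> (normal_cone_set \<omega>) \<le> emeasure \<kappa> (\<nu> -` \<omega> \<union> singular)"
      using normal_cone_set_subset v s by (intro emeasure_mono) auto
    also have "\<dots> \<le> emeasure \<kappa> (\<nu> -` \<omega>) + emeasure \<kappa> singular"
      using v s by (intro emeasure_subadditive) auto
    also have "emeasure \<kappa> singular = 0" by (rule null_sets_\<kappa>[OF singular_null])
    finally show "emeasure \<kappa> (normal_cone_set \<omega>) \<le> emeasure \<kappa> (\<nu> -` \<omega>)" by simp
    show "emeasure \<kappa> (\<nu> -` \<omega>) \<le> emeasure \<kappa> (normal_cone_set \<omega>)"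
      using vimage_\<nu>_subset c by (intro emeasure_mono) auto
  qed
  finally show ?thesis using emeasure_normal_measure[OF b] by simp
qed

lemma sphere_net:
  assumes "0 < \<delta>"
  obtains N :: nat and u where "\<And>j. j < N \<Longrightarrow> norm (u j) = 1" "S1 \<subseteq> (\<Union>j<N. cball (u j :: real ^ 'n) \<delta>)"
proof -
  obtain C where C: "C \<subseteq> S1" "finite C" "S1 \<subseteq> (\<Union>u\<in>C. ball u \<delta>)"
  proof (rule compactE_image[OF compact_sphere[of 0 1], of S1 "\<lambda>u. ball u \<delta>"])
    show "S1 \<subseteq> (\<Union>u\<in>S1. ball u \<delta>)" using assms by force
  qed auto
  obtain u where u: "bij_betw u {0..<card C} C" using ex_bij_betw_nat_finite[OF C(2)] by blast
  show ?thesis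
  proof (rule that[of "card C" u])
    show "norm (u j) = 1" if "j < card C" for j
      using bij_betwE[OF u] C(1) that by force
    show "S1 \<subseteq> (\<Union>j<card C. cball (u j) \<delta>)"
    proof
      fix x assume "x \<in> S1"
      then obtain v where v: "v \<in> C" "x \<in> ball v \<delta>" using C(3) by blast
      then obtain j where "j < card C" "u j = v" using u unfolding bij_betw_def by force
      then show "x \<in> (\<Union>j<card C. cball (u j) \<delta>)" using v by force
    qed
  qed
qed

text \<open>A crude bound whose constant is twice the number of patches. Its purpose is that small
  normal measure forces small Hausdorff measure.\<close>

lemma hm_\<tau>_compact_le:
  obtains C where "0 \<le> C" "\<And>\<omega>. compact \<omega> \<Longrightarrow> \<omega> \<subseteq> S1 \<Longrightarrow> hm (\<tau> \<omega>) \<le> ennreal C * emeasure normal_measure \<omega>"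
proof -
  obtain \<delta> where \<delta>: "0 < \<delta>"
    "\<And>u A. norm u = 1 \<Longrightarrow> compact A \<Longrightarrow> A \<subseteq> \<tau> (S1 \<inter> cball u \<delta>) \<Longrightarrow>
      emeasure \<kappa> (cone_upto 1 A) \<le> ennreal (1 + 1) * hm A \<and> hm A \<le> ennreal (1 + 1) * emeasure \<kappa> (cone_upto 1 A)"
    using patch_measure[of 1] by (metis zero_less_one)
  obtain N :: nat and u where u: "\<And>j. j < N \<Longrightarrow> norm (u j) = 1" "S1 \<subseteq> (\<Union>j<N. cball (u j) \<delta>)"
    using sphere_net[OF \<delta>(1)] by metis
  show ?thesis
  proof (rule that[of "real N * 2"])
    fix \<omega> assume \<omega>: "compact \<omega>" "\<omega> \<subseteq> S1"
    let ?W = "\<lambda>j. \<omega> \<inter> cball (u j) \<delta>"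
    have W: "compact (?W j)" "?W j \<subseteq> S1" for j using \<omega> by (auto intro: compact_Int_closed)
    have bW: "?W j \<in> sets borel" for j using W(1) by (rule borel_compact)
    have "\<omega> = (\<Union>j<N. ?W j)" using u(2) \<omega>(2) by blast
    then have "hm (\<tau> \<omega>) = hm (\<Union>j<N. \<tau> (?W j))" by (metis \<tau>_UN)
    also have "\<dots> \<le> (\<Sum>j<N. hm (\<tau> (?W j)))" by (rule hausdorff_measure_finite_subadditive) simp
    also have "\<dots> \<le> (\<Sum>j<N. ennreal 2 * emeasure normal_measure \<omega>)"
    proof (rule sum_mono)
      fix j assume "j \<in> {..<N}"
      then have "norm (u j) = 1" using u(1) by simp
      moreover have "compact (\<tau> (?W j))" by (rule compact_reverse_spherical_image[OF W])
      moreover have "\<tau> (?W j) \<subseteq> \<tau> (S1 \<inter> cball (u j) \<delta>)" using \<omega>(2) by (intro \<tau>_mono) blast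
      ultimately have "hm (\<tau> (?W j)) \<le> ennreal (1 + 1) * emeasure \<kappa> (cone_upto 1 (\<tau> (?W j)))"
        using \<delta>(2) by blast
      also have "\<dots> = ennreal 2 * emeasure normal_measure (?W j)"
        unfolding emeasure_\<kappa>_cone[OF W] by simp
      also have "\<dots> \<le> ennreal 2 * emeasure normal_measure \<omega>"
        using \<omega>(1) by (intro mult_left_mono emeasure_mono) (auto simp: borel_compact)
      finally show "hm (\<tau> (?W j)) \<le> ennreal 2 * emeasure normal_measure \<omega>" .
    qed
    also have "\<dots> = ennreal (real N * 2) * emeasure normal_measure \<omega>"
      by (simp add: ennreal_mult ennreal_of_nat_eq_real_of_nat mult.assoc)
    finally show "hm (\<tau> \<omega>) \<le> ennreal (real N * 2) * emeasure normal_measure \<omega>" .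
  qed simp
qed

text \<open>The open set is exhausted by compact shells of points whose distance to the complement lies
  between consecutive powers of two; no point belongs to more than two of them.\<close>

lemma hm_\<tau>_open_le:
  assumes G: "open G" and C: "0 \<le> C"
    and cmp: "\<And>\<omega>. compact \<omega> \<Longrightarrow> \<omega> \<subseteq> S1 \<Longrightarrow> hm (\<tau> \<omega>) \<le> ennreal C * emeasure normal_measure \<omega>"
  shows "hm (\<tau> (S1 \<inter> G)) \<le> ennreal (2 * C) * emeasure normal_measure (S1 \<inter> G)"
proof (cases "S1 \<subseteq> G")
  case True
  then have "S1 \<inter> G = S1" by blast
  then have "hm (\<tau> (S1 \<inter> G)) \<le> ennreal C * emeasure normal_measure (S1 \<inter> G)" using cmp[of S1] by simp
  also have "\<dots> \<le> ennreal (2 * C) * emeasure normal_measure (S1 \<inter> G)"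
    using C by (intro mult_right_mono ennreal_leI) auto
  finally show ?thesis .
next
  case False
  define F where "F = S1 - G"
  have F: "closed F" "F \<noteq> {}" using G False by (auto simp: F_def intro: closed_Diff)
  define d where "d x = infdist x F" for x
  have cd: "continuous_on A d" for A unfolding d_def by (intro continuous_intros)
  \<comment> \<open>The radii start at 4, above the largest distance 2 between points of the unit
    sphere.\<close>
  define r where "r i = 4 * (1/2 :: real) ^ i" for i :: nat
  have r_pos: "0 < r i" for i by (simp add: r_def)
  have r_Suc: "r (Suc i) = r i / 2" for i by (simp add: r_def)
  have r_anti: "r j \<le> r i" if "i \<le> j" for i j using that by (simp add: r_def power_decreasing)
  \<comment> \<open>The closed shells \<open>?A\<close> are compact, so the hypothesis applies to
    them; the half-open shells \<open>?B\<close> are disjoint, so their measures can be summed. Each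
    \<open>?A i\<close> lies in two consecutive \<open>?B\<close>, whence the factor 2.\<close>
  let ?A = "\<lambda>i. S1 \<inter> {x. r (Suc i) \<le> d x \<and> d x \<le> r i}"
  let ?B = "\<lambda>i. S1 \<inter> {x. r (Suc i) < d x \<and> d x \<le> r i}"
  have cA: "compact (?A i)" for i
    by (intro compact_Int_closed compact_sphere closed_Collect_conj closed_Collect_le continuous_intros cd)
  have bB: "?B i \<in> sets borel" for i
  proof -
    have "?B i = S1 \<inter> ({x. r (Suc i) < d x} \<inter> {x. d x \<le> r i})" by blast
    moreover have "open {x. r (Suc i) < d x}" "closed {x. d x \<le> r i}"
      by (intro open_Collect_less closed_Collect_le continuous_intros cd)+
    ultimately show ?thesis by (auto intro: borel_open borel_closed)
  qed
  have d_pos: "0 < d x" if "x \<in> S1 \<inter> G" for x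
    using that F infdist_pos_not_in_closed[OF F] by (auto simp: d_def F_def)
  have d_G: "x \<in> G" if "x \<in> S1" "0 < d x" for x
  proof (rule ccontr)
    assume "x \<notin> G"
    then have "x \<in> F" using that by (simp add: F_def)
    then show False using that by (simp add: d_def)
  qed
  have d_le: "d x \<le> r 0" if "x \<in> S1" for x
  proof -
    obtain y where y: "y \<in> F" using F(2) by blast
    have "d x \<le> dist x y" unfolding d_def by (rule infdist_le[OF y])
    also have "\<dots> \<le> norm x + norm y" by (simp add: dist_norm norm_triangle_ineq4)
    also have "\<dots> \<le> r 0" using that y by (simp add: F_def r_def)
    finally show ?thesis .
  qed
  have cover: "S1 \<inter> G = (\<Union>i. ?A i)"
  proof (intro equalityI subsetI)
    fix x assume x: "x \<in> S1 \<inter> G"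
    obtain m where m: "(1/2) ^ m < d x / 4"
      using real_arch_pow_inv[of "d x / 4" "1/2"] d_pos[OF x] by auto
    then have "r m < d x" by (simp add: r_def)
    then have ex: "\<exists>i. r (Suc i) \<le> d x" using r_anti[of m "Suc m"] by (intro exI[of _ m]) simp
    define i where "i = (LEAST i. r (Suc i) \<le> d x)"
    have "r (Suc i) \<le> d x" unfolding i_def by (rule LeastI_ex[OF ex])
    moreover have "d x \<le> r i"
    proof (cases i)
      case 0
      then show ?thesis using d_le x by simp
    next
      case (Suc j)
      then have "\<not> r (Suc j) \<le> d x" using not_less_Least[of j "\<lambda>i. r (Suc i) \<le> d x"] by (simp add: i_def)
      then show ?thesis using Suc by simp
    qed
    ultimately show "x \<in> (\<Union>i. ?A i)" using x by blast
  next
    fix x assume "x \<in> (\<Union>i. ?A i)"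
    then obtain i where x: "x \<in> S1" "r (Suc i) \<le> d x" by blast
    then have "0 < d x" using r_pos[of "Suc i"] by linarith
    then show "x \<in> S1 \<inter> G" using d_G x(1) by blast
  qed
  have disj: "disjoint_family ?B"
    unfolding disjoint_family_on_def
  proof (intro ballI impI)
    have *: "?B i \<inter> ?B j = {}" if "i < j" for i j
    proof -
      have "r j \<le> r (Suc i)" using that by (intro r_anti) simp
      then show ?thesis by force
    qed
    show "?B i \<inter> ?B j = {}" if "i \<noteq> j" for i j
      using *[of i j] *[of j i] that by (metis Int_commute linorder_neqE_nat)
  qed
  have "?B i \<subseteq> S1 \<inter> G" for i
  proof
    fix x assume x: "x \<in> ?B i"
    then have "0 < d x" using r_pos[of "Suc i"] by auto
    then show "x \<in> S1 \<inter> G" using d_G x by blast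
  qed
  then have UB: "(\<Union>i. ?B i) \<subseteq> S1 \<inter> G" by blast
  have bG: "S1 \<inter> G \<in> sets borel" using G by (auto intro: borel_open)
  have sumB: "(\<Sum>i. emeasure normal_measure (?B i)) \<le> emeasure normal_measure (S1 \<inter> G)"
  proof -
    have "(\<Sum>i. emeasure normal_measure (?B i)) = emeasure normal_measure (\<Union>i. ?B i)"
      using bB disj by (intro suminf_emeasure) auto
    also have "\<dots> \<le> emeasure normal_measure (S1 \<inter> G)" using UB bG by (intro emeasure_mono) auto
    finally show ?thesis .
  qed
  have sumB1: "(\<Sum>i. emeasure normal_measure (?B (Suc i))) \<le> emeasure normal_measure (S1 \<inter> G)"
  proof -
    have "(\<Sum>i. emeasure normal_measure (?B (Suc i))) = emeasure normal_measure (\<Union>i. ?B (Suc i))"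
      using bB disj by (intro suminf_emeasure) (auto simp: disjoint_family_on_def)
    also have "\<dots> \<le> emeasure normal_measure (S1 \<inter> G)" using UB bG by (intro emeasure_mono) auto
    finally show ?thesis .
  qed
  have AB: "emeasure normal_measure (?A i) \<le> emeasure normal_measure (?B i) + emeasure normal_measure (?B (Suc i))" for i
  proof -
    have "?A i \<subseteq> ?B i \<union> ?B (Suc i)"
    proof
      fix x assume x: "x \<in> ?A i"
      then have "r (Suc i) = d x \<or> r (Suc i) < d x" by auto
      moreover have "r (Suc (Suc i)) < r (Suc i)" using r_pos[of "Suc i"] r_Suc[of "Suc i"] by simp
      ultimately show "x \<in> ?B i \<union> ?B (Suc i)" using x by auto
    qed
    then have "emeasure normal_measure (?A i) \<le> emeasure normal_measure (?B i \<union> ?B (Suc i))"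
      using bB by (intro emeasure_mono) auto
    also have "\<dots> \<le> emeasure normal_measure (?B i) + emeasure normal_measure (?B (Suc i))"
      using bB by (intro emeasure_subadditive) auto
    finally show ?thesis .
  qed
  have "hm (\<tau> (S1 \<inter> G)) = hm (\<Union>i. \<tau> (?A i))" unfolding cover \<tau>_UN ..
  also have "\<dots> \<le> (\<Sum>i. hm (\<tau> (?A i)))" by (rule hausdorff_measure_countable_subadditive)
  also have "\<dots> \<le> (\<Sum>i. ennreal C * (emeasure normal_measure (?B i) + emeasure normal_measure (?B (Suc i))))"
    by (intro suminf_le order_trans[OF cmp[OF cA] mult_left_mono[OF AB]]) auto
  also have "\<dots> = ennreal C * ((\<Sum>i. emeasure normal_measure (?B i)) + (\<Sum>i. emeasure normal_measure (?B (Suc i))))"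
    by (simp add: suminf_add)
  also have "\<dots> \<le> ennreal C * (emeasure normal_measure (S1 \<inter> G) + emeasure normal_measure (S1 \<inter> G))"
    by (intro mult_left_mono add_mono sumB sumB1) simp
  also have "\<dots> = ennreal (2 * C) * emeasure normal_measure (S1 \<inter> G)"
    using C by (simp add: ennreal_mult mult_2 mult_ac distrib_left distrib_right)
  finally show ?thesis .
qed

section \<open>Upper bound for Borel sets of directions\<close>

text \<open>A compact \<open>F\<close> inside \<open>\<omega>\<close> has a compact image, to which
  the patch bound applies. The remainder has small normal measure and is enclosed in an open
  \<open>G\<close>, and the crude bound for open sets makes its contribution arbitrarily
  small.\<close>

lemma hm_\<tau>_le_patch:
  assumes e: "0 < e"
    and \<delta>: "\<And>u A. norm u = 1 \<Longrightarrow> compact A \<Longrightarrow> A \<subseteq> \<tau> (S1 \<inter> cball u \<delta>) \<Longrightarrow> hm A \<le> ennreal (1 + e) * emeasure \<kappa> (cone_upto 1 A)"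
    and u: "norm u = 1" and \<omega>: "\<omega> \<in> sets borel" "\<omega> \<subseteq> S1 \<inter> cball u \<delta>"
  shows "hm (\<tau> \<omega>) \<le> ennreal (1 + e) * emeasure normal_measure \<omega>"
proof (rule ennreal_le_epsilon)
  fix \<eta> :: real assume \<eta>: "0 < \<eta>"
  obtain C where C: "0 \<le> C" "\<And>\<omega>. compact \<omega> \<Longrightarrow> \<omega> \<subseteq> S1 \<Longrightarrow> hm (\<tau> \<omega>) \<le> ennreal C * emeasure normal_measure \<omega>"
    using hm_\<tau>_compact_le by metis
  \<comment> \<open>The open remainder will cost \<open>2 * C\<close> times
    \<open>2 * \<zeta>\<close>; the summand 1 in the denominator covers
    \<open>C = 0\<close>.\<close>
  define \<zeta> where "\<zeta> = \<eta> / (4 * C + 1)"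
  have \<zeta>: "0 < \<zeta>" "4 * C * \<zeta> \<le> \<eta>" using \<eta> C(1) by (auto simp: \<zeta>_def divide_le_eq add_nonneg_pos algebra_simps)
  have fin: "emeasure normal_measure (space normal_measure) \<noteq> \<infinity>"
    using normal_measure_less_top[of "space normal_measure"] by simp
  have appr: "emeasure normal_measure W < emeasure normal_measure W + ennreal \<zeta>" for W
    using normal_measure_less_top[of W] \<zeta>(1) by (cases "emeasure normal_measure W") (auto simp: ennreal_less_iff simp flip: ennreal_plus)
  obtain F where F: "F \<subseteq> \<omega>" "compact F" "emeasure normal_measure (\<omega> - F) \<le> ennreal \<zeta>"
  proof (cases "emeasure normal_measure \<omega> \<le> ennreal \<zeta>")
    case True
    then show thesis using that[of "{}"] by simp
  next
    case False
    have "emeasure normal_measure \<omega> - ennreal \<zeta> < emeasure normal_measure \<omega>"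
      using False \<zeta>(1) normal_measure_less_top[of \<omega>]
      by (cases "emeasure normal_measure \<omega>") (auto simp: ennreal_minus ennreal_less_iff)
    also have "\<dots> = (SUP K \<in> {K. K \<subseteq> \<omega> \<and> compact K}. emeasure normal_measure K)"
      by (rule inner_regular[OF _ fin \<omega>(1)]) simp
    finally obtain F where F: "F \<subseteq> \<omega>" "compact F" "emeasure normal_measure \<omega> - ennreal \<zeta> < emeasure normal_measure F"
      unfolding less_SUP_iff by blast
    have "emeasure normal_measure (\<omega> - F) = emeasure normal_measure \<omega> - emeasure normal_measure F"
      using F \<omega>(1) normal_measure_less_top[of F] by (intro emeasure_Diff) (auto simp: borel_compact)
    also have "\<dots> \<le> ennreal \<zeta>"
    proof -
      obtain s t where st: "emeasure normal_measure F = ennreal s" "0 \<le> s" "emeasure normal_measure \<omega> = ennreal t" "0 \<le> t"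
        using normal_measure_less_top[of F] normal_measure_less_top[of \<omega>]
        by (cases "emeasure normal_measure F"; cases "emeasure normal_measure \<omega>") auto
      have "ennreal (t - \<zeta>) < ennreal s" using F(3) st \<zeta>(1) by (simp add: ennreal_minus)
      then have "t - \<zeta> < s" using st(2) by (meson ennreal_leI not_le)
      then show ?thesis using st by (simp add: ennreal_minus ennreal_leI)
    qed
    finally show thesis using that[OF F(1,2)] by blast
  qed
  have bF: "\<omega> - F \<in> sets borel" using \<omega>(1) F(2) by (auto simp: borel_compact)
  have "(INF U \<in> {U. \<omega> - F \<subseteq> U \<and> open U}. emeasure normal_measure U) < emeasure normal_measure (\<omega> - F) + ennreal \<zeta>"
    using outer_regular[OF _ fin bF] appr[of "\<omega> - F"] by simp
  then obtain G where G: "\<omega> - F \<subseteq> G" "open G" "emeasure normal_measure G < emeasure normal_measure (\<omega> - F) + ennreal \<zeta>"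
    unfolding INF_less_iff by blast
  have "emeasure normal_measure (S1 \<inter> G) \<le> emeasure normal_measure G"
    using G(2) by (intro emeasure_mono) auto
  also have "\<dots> \<le> ennreal \<zeta> + ennreal \<zeta>"
    using less_imp_le[OF G(3)] add_right_mono[OF F(3), of "ennreal \<zeta>"] by (rule order_trans)
  also have "\<dots> = ennreal (2 * \<zeta>)" using \<zeta>(1) by (simp flip: ennreal_plus)
  finally have small: "emeasure normal_measure (S1 \<inter> G) \<le> ennreal (2 * \<zeta>)" .
  have FS: "F \<subseteq> S1" "F \<subseteq> S1 \<inter> cball u \<delta>" using F(1) \<omega>(2) by auto
  have "hm (\<tau> \<omega>) \<le> hm (\<tau> F \<union> \<tau> (S1 \<inter> G))"
  proof (rule hausdorff_measure_mono)
    have "\<omega> \<subseteq> F \<union> (S1 \<inter> G)" using G(1) \<omega>(2) by blast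
    from \<tau>_mono[OF this] show "\<tau> \<omega> \<subseteq> \<tau> F \<union> \<tau> (S1 \<inter> G)"
      by (auto simp: reverse_spherical_image_def)
  qed
  also have "\<dots> \<le> hm (\<tau> F) + hm (\<tau> (S1 \<inter> G))" by (rule hausdorff_measure_Un)
  also have "hm (\<tau> F) \<le> ennreal (1 + e) * emeasure \<kappa> (cone_upto 1 (\<tau> F))"
    by (rule \<delta>[OF u compact_reverse_spherical_image[OF F(2) FS(1)] \<tau>_mono[OF FS(2)]])
  also have "\<dots> = ennreal (1 + e) * emeasure normal_measure F" by (simp only: emeasure_\<kappa>_cone[OF F(2) FS(1)])
  also have "\<dots> \<le> ennreal (1 + e) * emeasure normal_measure \<omega>"
    using F(1) \<omega>(1) by (intro mult_left_mono emeasure_mono) auto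
  also have "hm (\<tau> (S1 \<inter> G)) \<le> ennreal (2 * C) * emeasure normal_measure (S1 \<inter> G)"
    by (rule hm_\<tau>_open_le[OF G(2) C])
  also have "\<dots> \<le> ennreal (2 * C) * ennreal (2 * \<zeta>)" by (intro mult_left_mono small) simp
  also have "\<dots> \<le> ennreal \<eta>" using \<zeta> C(1) by (simp add: ennreal_mult'[symmetric] ennreal_leI mult_ac)
  finally show "hm (\<tau> \<omega>) \<le> ennreal (1 + e) * emeasure normal_measure \<omega> + ennreal \<eta>"
    by (simp add: add_left_mono add_right_mono)
qed

lemma small_partition:
  assumes "0 < \<delta>"
  obtains N :: nat and u D where "\<And>j. j < N \<Longrightarrow> norm (u j) = 1" "\<And>j. D j \<in> sets borel"
    "\<And>j. D j \<subseteq> cball (u j :: real ^ 'n) \<delta>" "disjoint_family D" "S1 \<subseteq> (\<Union>j<N. D j)"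
proof -
  obtain N :: nat and u where u: "\<And>j. j < N \<Longrightarrow> norm (u j) = 1" "S1 \<subseteq> (\<Union>j<N. cball (u j :: real ^ 'n) \<delta>)"
    using sphere_net[OF assms] by metis
  show ?thesis
  proof (rule that[of N u "disjointed (\<lambda>j. cball (u j) \<delta>)"])
    show "S1 \<subseteq> (\<Union>j<N. disjointed (\<lambda>j. cball (u j) \<delta>) j)"
      using u(2) finite_UN_disjointed_eq[of "\<lambda>j. cball (u j) \<delta>" N] by (simp add: lessThan_atLeast0)
  qed (use u disjoint_family_disjointed disjointed_subset in \<open>auto simp: disjointed_def\<close>)
qed

text \<open>Subadditivity of the Hausdorff measure over a partition into small patches; finiteness
  of the normal measure lets the factor \<open>1 + e\<close> tend to 1.\<close>

lemma hm_\<tau>_le: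
  assumes \<omega>: "\<omega> \<in> sets borel" "\<omega> \<subseteq> S1"
  shows "hm (\<tau> \<omega>) \<le> emeasure normal_measure \<omega>"
proof -
  have step: "hm (\<tau> \<omega>) \<le> ennreal (1 + e) * emeasure normal_measure \<omega>" if e: "0 < e" for e
  proof -
    obtain \<delta> where \<delta>: "0 < \<delta>"
      "\<And>u A. norm u = 1 \<Longrightarrow> compact A \<Longrightarrow> A \<subseteq> \<tau> (S1 \<inter> cball u \<delta>) \<Longrightarrow>
        emeasure \<kappa> (cone_upto 1 A) \<le> ennreal (1 + e) * hm A \<and> hm A \<le> ennreal (1 + e) * emeasure \<kappa> (cone_upto 1 A)"
      using patch_measure[OF e] by metis
    obtain N :: nat and u D where D: "\<And>j. j < N \<Longrightarrow> norm (u j) = 1" "\<And>j. D j \<in> sets borel"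
      "\<And>j. D j \<subseteq> cball (u j) \<delta>" "disjoint_family D" "S1 \<subseteq> (\<Union>j<N. D j)"
      using small_partition[OF \<delta>(1)] by metis
    let ?W = "\<lambda>j. \<omega> \<inter> D j"
    have eq: "\<omega> = (\<Union>j<N. ?W j)" using D(5) \<omega>(2) by blast
    then have "hm (\<tau> \<omega>) = hm (\<Union>j<N. \<tau> (?W j))" by (metis \<tau>_UN)
    also have "\<dots> \<le> (\<Sum>j<N. hm (\<tau> (?W j)))" by (rule hausdorff_measure_finite_subadditive) simp
    also have "\<dots> \<le> (\<Sum>j<N. ennreal (1 + e) * emeasure normal_measure (?W j))"
    proof (rule sum_mono)
      fix j assume j: "j \<in> {..<N}"
      show "hm (\<tau> (?W j)) \<le> ennreal (1 + e) * emeasure normal_measure (?W j)"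
        using D(1,2,3) \<delta>(2) \<omega> j by (intro hm_\<tau>_le_patch[OF e, of \<delta> "u j"]) auto
    qed
    also have "\<dots> = ennreal (1 + e) * (\<Sum>j<N. emeasure normal_measure (?W j))" by (simp add: sum_distrib_left)
    also have "(\<Sum>j<N. emeasure normal_measure (?W j)) = emeasure normal_measure (\<Union>j<N. ?W j)"
      using \<omega>(1) D(2,4) by (intro sum_emeasure) (auto simp: disjoint_family_on_def)
    finally show ?thesis using eq by simp
  qed
  obtain m where m: "emeasure normal_measure \<omega> = ennreal m" "0 \<le> m"
    using normal_measure_less_top[of \<omega>] by (cases "emeasure normal_measure \<omega>") auto
  show ?thesis
  proof (rule ennreal_le_epsilon)
    fix \<eta> :: real assume \<eta>: "0 < \<eta>"
    have "hm (\<tau> \<omega>) \<le> ennreal (1 + \<eta> / (m + 1)) * ennreal m"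
      using step[of "\<eta> / (m + 1)"] \<eta> m by (simp add: add_nonneg_pos)
    also have "\<dots> = ennreal ((1 + \<eta> / (m + 1)) * m)" using \<eta> m by (simp add: ennreal_mult)
    also have "\<dots> \<le> ennreal (m + \<eta>)"
    proof (rule ennreal_leI)
      have "\<eta> / (m + 1) * m \<le> \<eta>" using \<eta> m(2) by (simp add: divide_le_eq)
      then show "(1 + \<eta> / (m + 1)) * m \<le> m + \<eta>" by (simp add: distrib_right)
    qed
    also have "\<dots> = emeasure normal_measure \<omega> + ennreal \<eta>" using m \<eta> by simp
    finally show "hm (\<tau> \<omega>) \<le> emeasure normal_measure \<omega> + ennreal \<eta>" .
  qed
qed

text \<open>The density of \<open>\<kappa>\<close> is at most \<open>n / inner_radius\<close>, so
  inner regularity carries over from Lebesgue measure.\<close>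

lemma lebesgue_inner_compact_\<kappa>:
  assumes E: "E \<in> sets lebesgue" "E \<subseteq> K" and e: "0 < e"
  obtains B where "compact B" "B \<subseteq> E" "emeasure \<kappa> E \<le> emeasure \<kappa> B + ennreal e"
proof -
  define c where "c = CARD('n) / inner_radius"
  have c: "0 < c" using inner_radius(1) by (simp add: c_def)
  obtain B where B: "closed B" "B \<subseteq> E" "emeasure lebesgue (E - B) < ennreal (e / c)"
    using sets_lebesgue_inner_closed[OF E(1), of "e / c"] e c by (metis divide_pos_pos)
  have cB: "compact B" using B(1,2) E(2) compact_K by (metis closed_Int_compact inf.absorb_iff1 order_trans)
  have mB: "B \<in> sets lebesgue" using cB by (simp add: borel_compact)
  have "emeasure \<kappa> E \<le> emeasure \<kappa> (B \<union> (E - B))" using E mB by (intro emeasure_mono) auto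
  also have "\<dots> \<le> emeasure \<kappa> B + emeasure \<kappa> (E - B)" using E mB by (intro emeasure_subadditive) auto
  also have "emeasure \<kappa> (E - B) \<le> ennreal c * emeasure lebesgue (E - B)"
    unfolding c_def using E mB by (intro emeasure_\<kappa>_le_inner_radius) auto
  also have "\<dots> \<le> ennreal c * ennreal (e / c)" using B(3) by (intro mult_left_mono) auto
  also have "\<dots> = ennreal e" using c e by (simp add: ennreal_mult'[symmetric])
  finally show ?thesis using that[OF cB B(2)] by (simp add: add_left_mono)
qed

section \<open>Lower bound for the total area\<close>

text \<open>Compact parts of the sets of points in \<open>K\<close> with normal in
  \<open>D j\<close> are projected radially to the boundary. The selected normal is constant on
  rays, so the projections have selected normals in disjoint sets and are themselves disjoint; being
  compact, they have Hausdorff measures that sum to at most that of the whole boundary.\<close>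

lemma total_le_hm:
  assumes e: "0 < e"
  shows "emeasure \<kappa> UNIV \<le> ennreal (1 + e) * hm (\<tau> S1) + ennreal e"
proof -
  obtain \<delta> where \<delta>: "0 < \<delta>"
    "\<And>u A. norm u = 1 \<Longrightarrow> compact A \<Longrightarrow> A \<subseteq> \<tau> (S1 \<inter> cball u \<delta>) \<Longrightarrow>
      emeasure \<kappa> (cone_upto 1 A) \<le> ennreal (1 + e) * hm A \<and> hm A \<le> ennreal (1 + e) * emeasure \<kappa> (cone_upto 1 A)"
    using patch_measure[OF e] by metis
  obtain N :: nat and u D where D: "\<And>j. j < N \<Longrightarrow> norm (u j) = 1" "\<And>j. D j \<in> sets borel"
    "\<And>j. D j \<subseteq> cball (u j) \<delta>" "disjoint_family D" "S1 \<subseteq> (\<Union>j<N. D j)"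
    using small_partition[OF \<delta>(1)] by metis
  have nullset: "{0 :: real ^ 'n} \<in> null_sets lebesgue"
    using negligible_sing[of "0 :: real ^ 'n"] by (simp only: negligible_iff_null_sets)
  \<comment> \<open>The origin is removed because the radial projection divides by the
    gauge.\<close>
  define E where "E j = (K - {0}) \<inter> \<nu> -` D j" for j
  have mE: "E j \<in> sets lebesgue" for j
    unfolding E_def by (intro sets.Int sets.Diff K_lebesgue vimage_\<nu>_lebesgue D(2) null_setsD2[OF nullset])
  have EK: "E j \<subseteq> K" for j by (auto simp: E_def)
  have "\<exists>B. compact B \<and> B \<subseteq> E j \<and> emeasure \<kappa> (E j) \<le> emeasure \<kappa> B + ennreal (e / (N + 1))" for j
  proof -
    have "0 < e / real (N + 1)" using e by simp
    from lebesgue_inner_compact_\<kappa>[OF mE[of j] EK[of j] this] show ?thesis by blast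
  qed
  then obtain B where B: "\<And>j. compact (B j)" "\<And>j. B j \<subseteq> E j"
    "\<And>j. emeasure \<kappa> (E j) \<le> emeasure \<kappa> (B j) + ennreal (e / (N + 1))"
    by metis
  define A where "A j = (\<lambda>x. (1 / gauge_fun x) *\<^sub>R x) ` B j" for j
  have Bg: "0 < gauge_fun x" "gauge_fun x \<le> 1" "\<nu> x \<in> D j" if "x \<in> B j" for x j
    using B(2)[of j] that gauge_pos[of x] gauge_le_1_iff[of x] by (auto simp: E_def)
  have cA: "compact (A j)" for j
    unfolding A_def using Bg(1)
    by (intro compact_continuous_image[OF _ B(1)] continuous_intros continuous_on_gauge) force
  have A_pt: "gauge_fun y = 1 \<and> \<nu> y \<in> D j" if "y \<in> A j" for y j
  proof -
    obtain x where x: "x \<in> B j" "y = (1 / gauge_fun x) *\<^sub>R x" using \<open>y \<in> A j\<close> by (auto simp: A_def)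
    then show ?thesis using Bg[OF x(1)] by (simp add: gauge_scale \<nu>_scale)
  qed
  have A_\<tau>: "A j \<subseteq> \<tau> (S1 \<inter> D j)" for j
  proof
    fix y assume "y \<in> A j"
    from A_pt[OF this] have "gauge_fun y = 1" "\<nu> y \<in> S1 \<inter> D j" by auto
    then show "y \<in> \<tau> (S1 \<inter> D j)"
      using is_normal_\<nu>[of y] by (auto simp: reverse_spherical_image_eq normal_cone_set_def)
  qed
  have disj: "disjoint_family_on A {..<N}"
    unfolding disjoint_family_on_def
  proof (intro ballI impI)
    fix i j :: nat assume "i \<noteq> j"
    then have "D i \<inter> D j = {}" using D(4) by (auto simp: disjoint_family_on_def)
    then show "A i \<inter> A j = {}" using A_pt by blast
  qed
  have BC: "B j \<subseteq> cone_upto 1 (A j)" for j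
  proof
    fix x assume x: "x \<in> B j"
    have "x = gauge_fun x *\<^sub>R ((1 / gauge_fun x) *\<^sub>R x)" using Bg(1)[OF x] by simp
    moreover have "(1 / gauge_fun x) *\<^sub>R x \<in> A j" using x by (auto simp: A_def)
    ultimately show "x \<in> cone_upto 1 (A j)"
      using Bg(1,2)[OF x] unfolding cone_upto_def by (metis (mono_tags, lifting) less_imp_le mem_Collect_eq)
  qed
  have "emeasure \<kappa> UNIV = emeasure \<kappa> K" using emeasure_\<kappa>_K[of UNIV] by simp
  also have "\<dots> \<le> emeasure \<kappa> ({0} \<union> (\<Union>j<N. E j))"
  proof (rule emeasure_mono)
    show "K \<subseteq> {0} \<union> (\<Union>j<N. E j)"
    proof
      fix x assume x: "x \<in> K"
      have "\<nu> x \<in> S1" by simp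
      then obtain j where "j < N" "\<nu> x \<in> D j" using D(5) by blast
      then show "x \<in> {0} \<union> (\<Union>j<N. E j)" using x by (auto simp: E_def)
    qed
    show "{0} \<union> (\<Union>j<N. E j) \<in> sets \<kappa>"
      unfolding sets_\<kappa> by (intro sets.Un sets.finite_UN mE null_setsD2[OF nullset] finite_lessThan)
  qed
  also have "\<dots> \<le> emeasure \<kappa> {0} + emeasure \<kappa> (\<Union>j<N. E j)"
    using mE null_setsD2[OF nullset] by (intro emeasure_subadditive) auto
  also have "emeasure \<kappa> {0} = 0" by (rule null_sets_\<kappa>[OF nullset])
  also have "0 + emeasure \<kappa> (\<Union>j<N. E j) \<le> (\<Sum>j<N. emeasure \<kappa> (E j))"
    using mE by (simp, intro emeasure_subadditive_finite) auto
  also have "\<dots> \<le> (\<Sum>j<N. ennreal (1 + e) * hm (A j) + ennreal (e / (N + 1)))"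
  proof (rule sum_mono)
    fix j assume j: "j \<in> {..<N}"
    have "emeasure \<kappa> (E j) \<le> emeasure \<kappa> (B j) + ennreal (e / (N + 1))" by (rule B(3))
    also have "emeasure \<kappa> (B j) \<le> emeasure \<kappa> (cone_upto 1 (A j))"
      using BC compact_cone_upto[OF cA] by (intro emeasure_mono) (auto simp: borel_compact)
    also have "\<dots> \<le> ennreal (1 + e) * hm (A j)"
    proof -
      have "A j \<subseteq> \<tau> (S1 \<inter> cball (u j) \<delta>)" using A_\<tau>[of j] \<tau>_mono[of "S1 \<inter> D j" "S1 \<inter> cball (u j) \<delta>"] D(3)[of j] by blast
      then show ?thesis using \<delta>(2)[OF _ cA] D(1) j by blast
    qed
    finally show "emeasure \<kappa> (E j) \<le> ennreal (1 + e) * hm (A j) + ennreal (e / (N + 1))"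
      by (simp add: add_right_mono)
  qed
  also have "\<dots> = ennreal (1 + e) * (\<Sum>j<N. hm (A j)) + (\<Sum>j<N. ennreal (e / (N + 1)))"
    by (simp only: sum.distrib sum_distrib_left)
  also have "\<dots> \<le> ennreal (1 + e) * hm (\<tau> S1) + ennreal e"
  proof (intro add_mono mult_left_mono)
    have "(\<Sum>j<N. hm (A j)) \<le> hm (\<Union>j<N. A j)"
      using cA disj by (intro hausdorff_measure_disjoint_compact) auto
    also have "\<dots> \<le> hm (\<tau> S1)"
      using A_\<tau> \<tau>_mono[of "S1 \<inter> D _" S1] by (intro hausdorff_measure_mono) blast
    finally show "(\<Sum>j<N. hm (A j)) \<le> hm (\<tau> S1)" .
    have "(\<Sum>j<N. ennreal (e / (N + 1))) = ennreal (N * (e / (N + 1)))"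
      using e by (subst sum_ennreal) auto
    also have "\<dots> \<le> ennreal e" using e by (intro ennreal_leI) (simp add: divide_le_eq)
    finally show "(\<Sum>j<N. ennreal (e / (N + 1))) \<le> ennreal e" .
  qed simp
  finally show ?thesis .
qed

lemma total_le: "emeasure \<kappa> UNIV \<le> hm (\<tau> S1)"
proof -
  have "hm (\<tau> S1) \<le> emeasure normal_measure S1" by (rule hm_\<tau>_le) auto
  also have "\<dots> < top" by (rule normal_measure_less_top)
  finally obtain m where m: "hm (\<tau> S1) = ennreal m" "0 \<le> m" by (cases "hm (\<tau> S1)") auto
  show ?thesis
  proof (rule ennreal_le_epsilon)
    fix \<eta> :: real assume \<eta>: "0 < \<eta>"
    define e where "e = \<eta> / (m + 1)"
    have e: "0 < e" "e * (m + 1) = \<eta>" using \<eta> m(2) by (auto simp: e_def add_nonneg_pos)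
    have "emeasure \<kappa> UNIV \<le> ennreal (1 + e) * ennreal m + ennreal e"
      using total_le_hm[OF e(1)] m(1) by simp
    also have "\<dots> = ennreal ((1 + e) * m + e)" using e(1) m(2) by (simp add: ennreal_mult)
    also have "(1 + e) * m + e = m + \<eta>" using e(2) by (simp add: algebra_simps)
    finally show "emeasure \<kappa> UNIV \<le> hm (\<tau> S1) + ennreal \<eta>" using m \<eta> by simp
  qed
qed

lemma normal_measure_S1: "emeasure normal_measure S1 = emeasure \<kappa> UNIV"
proof -
  have "\<nu> -` S1 = UNIV" by auto
  then show ?thesis by (simp add: emeasure_normal_measure)
qed

text \<open>With upper bounds for \<open>\<omega>\<close> and for its complement, a deficit on
  \<open>\<omega>\<close> would be a deficit on the whole sphere, against the lower bound there.
  Finiteness allows the complement to be cancelled.\<close>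

theorem hm_\<tau>_eq:
  assumes \<omega>: "\<omega> \<in> sets borel" "\<omega> \<subseteq> S1"
  shows "hm (\<tau> \<omega>) = emeasure normal_measure \<omega>"
proof (rule antisym)
  show "hm (\<tau> \<omega>) \<le> emeasure normal_measure \<omega>" by (rule hm_\<tau>_le[OF \<omega>])
  have c: "S1 - \<omega> \<in> sets borel" "S1 - \<omega> \<subseteq> S1" using \<omega> by auto
  have "emeasure normal_measure \<omega> + emeasure normal_measure (S1 - \<omega>) = emeasure normal_measure S1"
    using \<omega> c plus_emeasure[of \<omega> normal_measure "S1 - \<omega>"] by (simp add: Un_absorb1)
  also have "\<dots> \<le> hm (\<tau> S1)" unfolding normal_measure_S1 by (rule total_le)
  also have "\<dots> = hm (\<tau> (\<omega> \<union> (S1 - \<omega>)))" using \<omega> by (simp add: Un_absorb1)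
  also have "\<dots> \<le> hm (\<tau> \<omega> \<union> \<tau> (S1 - \<omega>))"
    by (intro hausdorff_measure_mono) (auto simp: reverse_spherical_image_def)
  also have "\<dots> \<le> hm (\<tau> \<omega>) + hm (\<tau> (S1 - \<omega>))" by (rule hausdorff_measure_Un)
  also have "\<dots> \<le> hm (\<tau> \<omega>) + emeasure normal_measure (S1 - \<omega>)" by (intro add_left_mono hm_\<tau>_le c)
  finally show "emeasure normal_measure \<omega> \<le> hm (\<tau> \<omega>)"
    using normal_measure_less_top[of "S1 - \<omega>"] by (auto simp: add.commute)
qed

text \<open>On the Borel sets of the sphere the defining set function agrees with an actual measure,
  so \<open>measure_of\<close> returns that measure.\<close>

theorem surface_area_measure_eq: "surface_area_measure K = distr \<kappa> (restrict_space borel S1) \<nu>"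
proof -
  let ?M = "distr \<kappa> (restrict_space borel S1) \<nu>"
  have \<nu>: "\<nu> \<in> \<kappa> \<rightarrow>\<^sub>M restrict_space borel S1"
    by (intro measurable_restrict_space2) auto
  have "surface_area_measure K = measure_of (space ?M) (sets ?M) (\<lambda>\<omega>. hm (\<tau> \<omega>))"
    by (simp add: surface_area_measure_def space_restrict_space)
  also have "\<dots> = measure_of (space ?M) (sets ?M) (emeasure ?M)"
  proof (rule measure_of_eq)
    show "sets ?M \<subseteq> Pow (space ?M)" by (rule sets.space_closed)
    fix \<omega> assume "\<omega> \<in> sigma_sets (space ?M) (sets ?M)"
    then have "\<omega> \<in> sets ?M" by (simp only: sets.sigma_sets_eq)
    then have \<omega>: "\<omega> \<in> sets (restrict_space borel S1)" by simp
    then have b: "\<omega> \<in> sets borel" "\<omega> \<subseteq> S1" by (auto simp: sets_restrict_space)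
    have "emeasure ?M \<omega> = emeasure \<kappa> (\<nu> -` \<omega>)" using \<omega> by (subst emeasure_distr[OF \<nu>]) auto
    then show "hm (\<tau> \<omega>) = emeasure ?M \<omega>" using hm_\<tau>_eq[OF b] emeasure_normal_measure[OF b(1)] by simp
  qed
  also have "\<dots> = ?M" by (rule measure_of_of_measure)
  finally show ?thesis .
qed

text \<open>The factor \<open>n / h (\<nu> x)\<close> is the density of \<open>\<kappa>\<close>; it
  will cancel against the factor \<open>h\<close> in the Orlicz integrand.\<close>

theorem integral_surface_area_measure:
  fixes f :: "real ^ 'n \<Rightarrow> real"
  assumes f: "f \<in> borel_measurable (restrict_space borel S1)"
  shows "(LINT u|surface_area_measure K. f u) = (LINT x|lebesgue_on K. CARD('n) * (f (\<nu> x) / h (\<nu> x)))"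
proof -
  have \<nu>: "\<nu> \<in> \<kappa> \<rightarrow>\<^sub>M restrict_space borel S1"
    by (intro measurable_restrict_space2) auto
  have \<nu>': "\<nu> \<in> lebesgue \<rightarrow>\<^sub>M restrict_space borel S1"
    by (intro measurable_restrict_space2 \<nu>_measurable) auto
  have fm: "(\<lambda>x. f (\<nu> x)) \<in> borel_measurable lebesgue" by (rule measurable_compose[OF \<nu>' f])
  have hmes: "(\<lambda>x. h (\<nu> x)) \<in> borel_measurable lebesgue" by (rule measurable_compose[OF \<nu>_measurable h_measurable])
  have dens: "(\<lambda>x. indicator K x * (CARD('n) / h (\<nu> x))) \<in> borel_measurable lebesgue"
    using hmes K_lebesgue by (intro borel_measurable_times borel_measurable_indicator borel_measurable_divide) auto
  have \<kappa>: "\<kappa> = density lebesgue (\<lambda>x. ennreal (indicator K x * (CARD('n) / h (\<nu> x))))"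
    unfolding \<kappa>_def by (intro arg_cong[where f="density lebesgue"] ext) (simp add: indicator_def)
  have "(LINT u|surface_area_measure K. f u) = (LINT x|\<kappa>. f (\<nu> x))"
    unfolding surface_area_measure_eq by (rule integral_distr[OF \<nu> f])
  also have "\<dots> = (LINT x|lebesgue. (indicator K x * (CARD('n) / h (\<nu> x))) *\<^sub>R f (\<nu> x))"
    unfolding \<kappa> by (rule integral_density[OF fm dens]) (simp add: less_imp_le)
  also have "\<dots> = (LINT x|lebesgue. indicator K x *\<^sub>R (CARD('n) * (f (\<nu> x) / h (\<nu> x))))"
    by (intro Bochner_Integration.integral_cong) (auto simp: indicator_def)
  also have "\<dots> = (LINT x|lebesgue_on K. CARD('n) * (f (\<nu> x) / h (\<nu> x)))"
    by (rule integral_restrict_space[symmetric]) simp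
  finally show ?thesis .
qed

end

section \<open>Minkowski's first inequality\<close>

text \<open>The constant \<open>4 ^ n\<close> is chosen for the recursion
  \<open>n + 4 ^ n + 4 ^ n \<le> 4 ^ (n + 1)\<close>.\<close>

lemma power_le_quadratic:
  fixes y :: real
  assumes "\<bar>y\<bar> \<le> 1"
  shows "(1 + y) ^ n \<le> 1 + real n * y + 4 ^ n * y\<^sup>2"
proof (induction n)
  case (Suc n)
  have "(1 + y) ^ Suc n \<le> (1 + y) * (1 + real n * y + 4 ^ n * y\<^sup>2)"
    using Suc assms by (simp add: mult_left_mono)
  also have "\<dots> = 1 + real (Suc n) * y + (real n * y\<^sup>2 + 4 ^ n * y\<^sup>2 + 4 ^ n * (y * y\<^sup>2))"
    by (simp add: algebra_simps power2_eq_square)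
  also have "real n * y\<^sup>2 + 4 ^ n * y\<^sup>2 + 4 ^ n * (y * y\<^sup>2) \<le> 4 ^ Suc n * y\<^sup>2"
  proof -
    have "real n \<le> 2 ^ n" using of_nat_less_two_power[of n, where ?'a=real] by simp
    also have "(2::real) ^ n \<le> 4 ^ n" by (intro power_mono) auto
    finally have "real n \<le> 4 ^ n" .
    then have "real n * y\<^sup>2 \<le> 4 ^ n * y\<^sup>2" by (rule mult_right_mono) simp
    moreover have "y * y\<^sup>2 \<le> 1 * y\<^sup>2" using assms by (intro mult_right_mono) auto
    then have "4 ^ n * (y * y\<^sup>2) \<le> 4 ^ n * y\<^sup>2" by simp
    moreover have "0 \<le> 4 ^ n * y\<^sup>2" "4 ^ Suc n * y\<^sup>2 = 4 * (4 ^ n * y\<^sup>2)" by simp_all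
    ultimately show ?thesis by linarith
  qed
  finally show ?case by simp
qed simp

context convex_body
begin

text \<open>Approximating the radial bound \<open>\<psi>\<close> from above by a function with finitely many values
  reduces the polar coordinate formula to the scaling of volumes.\<close>

lemma radial_volume_bound:
  fixes \<psi> :: "real ^ 'n \<Rightarrow> real"
  assumes meas: "\<psi> \<in> borel_measurable lebesgue" and B: "\<And>x. 0 \<le> \<psi> x" "\<And>x. \<psi> x \<le> B"
    and hom: "\<And>s x. 0 < s \<Longrightarrow> \<psi> (s *\<^sub>R x) = \<psi> x"
    and E: "E \<in> sets lebesgue" "\<And>x. x \<in> E \<Longrightarrow> gauge_fun x \<le> \<psi> x" and N: "0 < N"
  shows "emeasure lebesgue E \<le> (\<integral>\<^sup>+x. ennreal ((\<psi> x + 1 / real N) ^ CARD('n)) \<partial>lebesgue_on K)"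
proof -
  \<comment> \<open>Rounding up to the next multiple of \<open>1 / N\<close>; the added 1 keeps the
    level positive, so that scaling by it can be inverted.\<close>
  define lev where "lev x = nat \<lfloor>real N * \<psi> x\<rfloor> + 1" for x
  define J where "J = nat \<lfloor>real N * B\<rfloor> + 1"
  have lev: "\<psi> x \<le> lev x / N" "lev x / N \<le> \<psi> x + 1 / N" "1 \<le> lev x" "lev x \<le> J" for x
  proof -
    have nn: "0 \<le> real N * \<psi> x" using B(1) by simp
    have l: "real (lev x) = of_int \<lfloor>real N * \<psi> x\<rfloor> + 1" using nn by (simp add: lev_def)
    have "real N * \<psi> x \<le> lev x" "lev x \<le> real N * \<psi> x + 1" unfolding l by linarith+
    then show "\<psi> x \<le> lev x / N" "lev x / N \<le> \<psi> x + 1 / N" using N by (auto simp: field_simps)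
    show "1 \<le> lev x" by (simp add: lev_def)
    have "real N * \<psi> x \<le> real N * B" using B(2) by (intro mult_left_mono) auto
    then show "lev x \<le> J" unfolding lev_def J_def by (intro add_mono nat_mono floor_mono) auto
  qed
  have lev_hom: "lev (s *\<^sub>R x) = lev x" if "0 < s" for s x using hom[OF that] by (simp add: lev_def)
  have lev_meas: "lev \<in> lebesgue \<rightarrow>\<^sub>M count_space UNIV"
    unfolding lev_def using meas by measurable
  define P where "P j = {x \<in> K. lev x = j}" for j
  have P: "P j \<in> sets lebesgue" for j
  proof -
    have "P j = K \<inter> (lev -` {j} \<inter> space lebesgue)" by (auto simp: P_def)
    then show ?thesis using measurable_sets[OF lev_meas, of "{j}"] K_lebesgue by auto
  qed
  have scaled: "(*\<^sub>R) (real j / N) ` P j \<in> sets lebesgue" if "1 \<le> j" for j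
  proof -
    have c: "0 < real j / N" using that N by simp
    have "(*\<^sub>R) (real j / N) ` P j = (*\<^sub>R) (1 / (real j / N)) -` P j \<inter> space lebesgue"
    proof (intro equalityI subsetI)
      fix x assume "x \<in> (*\<^sub>R) (1 / (real j / N)) -` P j \<inter> space lebesgue"
      then show "x \<in> (*\<^sub>R) (real j / N) ` P j"
        using c by (intro image_eqI[of _ _ "(1 / (real j / N)) *\<^sub>R x"]) auto
    qed (use c in auto)
    then show ?thesis using measurable_sets[OF lebesgue_measurable_scaling P] by simp
  qed
  \<comment> \<open>The level is constant on open rays, so dividing \<open>x\<close> by its own
    level factor lands in \<open>K\<close> within the same level set.\<close>
  have "E \<subseteq> (\<Union>j\<in>{1..J}. (*\<^sub>R) (real j / N) ` P j)"
  proof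
    fix x assume x: "x \<in> E"
    define c where "c = real (lev x) / N"
    have c: "0 < c" using lev(3)[of x] N by (simp add: c_def)
    have "gauge_fun x \<le> c" using E(2)[OF x] lev(1)[of x] by (simp add: c_def)
    then have "gauge_fun ((1 / c) *\<^sub>R x) \<le> 1" using c by (simp add: gauge_scale divide_le_eq)
    then have "(1 / c) *\<^sub>R x \<in> P (lev x)" using c by (simp add: P_def gauge_le_1_iff lev_hom)
    then have "c *\<^sub>R ((1 / c) *\<^sub>R x) \<in> (*\<^sub>R) c ` P (lev x)" by (rule imageI)
    then have "x \<in> (*\<^sub>R) (real (lev x) / N) ` P (lev x)" using c unfolding c_def[symmetric] by simp
    then show "x \<in> (\<Union>j\<in>{1..J}. (*\<^sub>R) (real j / N) ` P j)" using lev(3,4)[of x] by (intro UN_I[of "lev x"]) simp_all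
  qed
  then have "emeasure lebesgue E \<le> emeasure lebesgue (\<Union>j\<in>{1..J}. (*\<^sub>R) (real j / N) ` P j)"
    using scaled by (intro emeasure_mono sets.finite_UN) auto
  also have "\<dots> \<le> (\<Sum>j\<in>{1..J}. emeasure lebesgue ((*\<^sub>R) (real j / N) ` P j))"
    using scaled by (intro emeasure_subadditive_finite) auto
  also have "\<dots> = (\<Sum>j\<in>{1..J}. ennreal ((real j / N) ^ CARD('n)) * emeasure lebesgue (P j))"
    by (simp add: emeasure_lebesgue_scaleR_image)
  also have "\<dots> = (\<Sum>j\<in>{1..J}. \<integral>\<^sup>+x. ennreal ((real j / N) ^ CARD('n)) * indicator (P j) x \<partial>lebesgue)"
    using P by (intro sum.cong) (auto simp: nn_integral_cmult_indicator)
  also have "\<dots> = (\<integral>\<^sup>+x. (\<Sum>j\<in>{1..J}. ennreal ((real j / N) ^ CARD('n)) * indicator (P j) x) \<partial>lebesgue)"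
    using P by (intro nn_integral_sum[symmetric] borel_measurable_times_ennreal borel_measurable_indicator) auto
  also have "\<dots> \<le> (\<integral>\<^sup>+x. ennreal ((\<psi> x + 1 / real N) ^ CARD('n)) * indicator K x \<partial>lebesgue)"
  proof (intro nn_integral_mono)
    fix x
    have "(\<Sum>j\<in>{1..J}. ennreal ((real j / N) ^ CARD('n)) * indicator (P j) x)
        = (\<Sum>j\<in>{1..J}. if j = lev x then ennreal ((real j / N) ^ CARD('n)) * indicator K x else 0)"
      by (intro sum.cong) (auto simp: P_def indicator_def)
    also have "\<dots> = ennreal ((real (lev x) / N) ^ CARD('n)) * indicator K x"
      using lev(3,4)[of x] by (subst sum.delta) auto
    also have "\<dots> \<le> ennreal ((\<psi> x + 1 / real N) ^ CARD('n)) * indicator K x"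
      using lev(2)[of x] by (intro mult_right_mono ennreal_leI power_mono) auto
    finally show "(\<Sum>j\<in>{1..J}. ennreal ((real j / N) ^ CARD('n)) * indicator (P j) x)
        \<le> ennreal ((\<psi> x + 1 / real N) ^ CARD('n)) * indicator K x" .
  qed
  also have "\<dots> = (\<integral>\<^sup>+x. ennreal ((\<psi> x + 1 / real N) ^ CARD('n)) \<partial>lebesgue_on K)"
    by (rule nn_integral_restrict_space[symmetric]) simp
  finally show ?thesis .
qed

abbreviation vol :: "(real ^ 'n) set \<Rightarrow> real" where "vol \<equiv> measure lebesgue"

lemma vol_K_pos: "0 < vol K"
proof -
  have "0 < measure lebesgue (cball (0 :: real ^ 'n) inner_radius)"
    using inner_radius(1) by (simp add: content_cball_pos)
  also have "\<dots> \<le> vol K" using inner_radius(2) compact_K by (intro measure_mono_fmeasurable lmeasurable_compact) auto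
  finally show ?thesis .
qed

lemma finite_measure_K: "finite_measure (lebesgue_on K)"
  by (rule finite_measure_lebesgue_on[OF lmeasurable_compact[OF compact_K]])

lemma measure_lebesgue_on_K: "measure (lebesgue_on K) K = vol K"
  by (subst measure_restrict_space) auto

lemma integrable_K:
  fixes f :: "real ^ 'n \<Rightarrow> real"
  assumes "f \<in> borel_measurable lebesgue" "\<And>x. \<bar>f x\<bar> \<le> B"
  shows "integrable (lebesgue_on K) f"
  using assms by (intro finite_measure.integrable_const_bound[OF finite_measure_K, of _ B] measurable_restrict_space1) auto

lemma integral_const_K: "(LINT x|lebesgue_on K. c) = vol K * (c :: real)"
  by (simp add: measure_lebesgue_on_K)

lemma integrable_const_K: "integrable (lebesgue_on K) (\<lambda>x. c :: real)"
  by (rule finite_measure.integrable_const[OF finite_measure_K])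

lemma integral_affine_K:
  fixes f :: "real ^ 'n \<Rightarrow> real"
  assumes f: "integrable (lebesgue_on K) f"
  shows "(LINT x|lebesgue_on K. a + b * f x + c) = vol K * a + b * (LINT x|lebesgue_on K. f x) + vol K * c"
proof -
  have bf: "integrable (lebesgue_on K) (\<lambda>x. b * f x)" using f by simp
  have "(LINT x|lebesgue_on K. a + b * f x + c) = (LINT x|lebesgue_on K. a + b * f x) + (LINT x|lebesgue_on K. c)"
    by (rule Bochner_Integration.integral_add[OF Bochner_Integration.integrable_add[OF integrable_const_K bf] integrable_const_K])
  also have "(LINT x|lebesgue_on K. a + b * f x) = (LINT x|lebesgue_on K. a) + (LINT x|lebesgue_on K. b * f x)"
    by (rule Bochner_Integration.integral_add[OF integrable_const_K bf])
  finally show ?thesis by (simp only: integral_const_K) simp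
qed

section \<open>The ratio of support functions along the normals\<close>

definition ratio :: "(real ^ 'n) set \<Rightarrow> real ^ 'n \<Rightarrow> real" where
  "ratio L x = support_fun L (\<nu> x) / h (\<nu> x)"

lemma ratio_measurable:
  assumes "compact L" "L \<noteq> {}"
  shows "ratio L \<in> borel_measurable lebesgue"
proof -
  have "support_fun L \<in> borel_measurable borel"
    by (intro borel_measurable_continuous_onI continuous_on_support_fun assms)
  then have "(\<lambda>u. support_fun L u / h u) \<in> borel_measurable borel" by (intro borel_measurable_divide h_measurable)
  from measurable_compose[OF \<nu>_measurable this] show ?thesis by (simp add: ratio_def[abs_def])
qed

lemma ratio_nonneg: "compact L \<Longrightarrow> 0 \<in> L \<Longrightarrow> 0 \<le> ratio L x"
  using support_fun_upper[of L 0 "\<nu> x"] h_\<nu>_pos[of x] unfolding ratio_def by (intro divide_nonneg_pos) auto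

lemma ratio_bounded:
  assumes L: "compact L" "L \<noteq> {}"
  obtains B where "0 < B" "\<And>x. ratio L x \<le> B"
proof -
  obtain R where R: "0 < R" "\<And>y. y \<in> L \<Longrightarrow> norm y \<le> R"
    using compact_imp_bounded[OF L(1)] by (meson bounded_pos)
  show ?thesis
  proof (rule that[of "R / inner_radius"])
    fix x
    obtain y where y: "y \<in> L" "\<nu> x \<bullet> y = support_fun L (\<nu> x)" using support_fun_attained[OF L] by blast
    have "support_fun L (\<nu> x) \<le> R" using norm_cauchy_schwarz[of "\<nu> x" y] R(2)[OF y(1)] y(2) by simp
    then show "ratio L x \<le> R / inner_radius"
      unfolding ratio_def using h_ge[of "\<nu> x"] inner_radius(1) R(1) by (intro frac_le) auto
  qed (use R inner_radius in simp)
qed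

lemma ratio_scale: "0 < s \<Longrightarrow> ratio L (s *\<^sub>R x) = ratio L x"
  by (simp add: ratio_def \<nu>_scale)

section \<open>Volumes of convex combinations of \<open>K\<close> and \<open>L\<close>\<close>

definition mix :: "(real ^ 'n) set \<Rightarrow> real \<Rightarrow> (real ^ 'n) set" where
  "mix L t = (\<lambda>(x, y). (1 - t) *\<^sub>R x + t *\<^sub>R y) ` (K \<times> L)"

lemma compact_mix: "compact L \<Longrightarrow> compact (mix L t)"
  unfolding mix_def case_prod_beta
  by (intro compact_continuous_image compact_Times compact_K continuous_intros)

text \<open>It is enough to test the single direction \<open>\<nu> z\<close>, in which the gauge of
  \<open>z\<close> is attained.\<close>

lemma gauge_mix_le:
  assumes L: "compact L" and t: "0 \<le> t" "t \<le> 1" and z: "z \<in> mix L t"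
  shows "gauge_fun z \<le> 1 + t * (ratio L z - 1)"
proof -
  obtain x y where xy: "x \<in> K" "y \<in> L" "z = (1 - t) *\<^sub>R x + t *\<^sub>R y" using z by (auto simp: mix_def)
  have "\<nu> z \<bullet> z \<le> (1 - t) * h (\<nu> z) + t * support_fun L (\<nu> z)"
    unfolding xy(3) inner_add_right inner_scaleR_right using t h_upper[OF xy(1)] support_fun_upper[OF L xy(2)]
    by (intro add_mono mult_left_mono) auto
  then have "gauge_fun z \<le> ((1 - t) * h (\<nu> z) + t * support_fun L (\<nu> z)) / h (\<nu> z)"
    unfolding gauge_eq_\<nu>[of z] by (intro divide_right_mono less_imp_le[OF h_\<nu>_pos])
  also have "\<dots> = 1 + t * (ratio L z - 1)"
  proof -
    have "((1 - t) * a + t * b) / a = 1 + t * (b / a - 1)" if "0 < a" for a b :: real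
      using that by (simp add: field_simps)
    then show ?thesis unfolding ratio_def using h_\<nu>_pos by blast
  qed
  finally show ?thesis .
qed

text \<open>A midpoint of \<open>K\<close> and the combination with weight \<open>s\<close> involves
  two points of \<open>K\<close>. Convexity merges them into one, where \<open>w\<close> is the
  share of \<open>x\<close> in their total weight \<open>1 - s / 2\<close>; the point of
  \<open>L\<close> keeps weight \<open>s / 2\<close>.\<close>

lemma emeasure_mix_half:
  assumes L: "compact L" and s: "0 \<le> s" "s \<le> 1"
  shows "emeasure lborel K * emeasure lborel (mix L s) \<le> (emeasure lborel (mix L (s / 2)))\<^sup>2"
proof (rule brunn_minkowski_midpoint)
  fix x z assume x: "x \<in> K" and "z \<in> mix L s"
  then obtain x' y where y: "x' \<in> K" "y \<in> L" "z = (1 - s) *\<^sub>R x' + s *\<^sub>R y" by (auto simp: mix_def)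
  define w where "w = (1/2) / (1 - s/2)"
  have s2: "0 < 1 - s / 2" using s by simp
  have w: "0 \<le> w" "w \<le> 1" using s by (auto simp: w_def)
  have w2: "(1 - s/2) * w = 1/2" "(1 - s/2) * (1 - w) = (1 - s) / 2" using s2 by (auto simp: w_def field_simps)
  have "w *\<^sub>R x + (1 - w) *\<^sub>R x' \<in> K" using convexD[OF convex_K x y(1), of w "1 - w"] w by simp
  moreover have "(1/2) *\<^sub>R (x + z) = (1 - s/2) *\<^sub>R (w *\<^sub>R x + (1 - w) *\<^sub>R x') + (s/2) *\<^sub>R y"
    unfolding scaleR_add_right scaleR_scaleR w2 y(3) by (simp add: algebra_simps)
  ultimately show "(1/2) *\<^sub>R (x + z) \<in> mix L (s / 2)" using y(2) by (force simp: mix_def)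
qed (use L compact_mix compact_K in \<open>auto simp: borel_compact\<close>)

text \<open>Measured by the logarithm of its volume relative to \<open>vol K\<close>, the
  combination with weight \<open>s / 2\<close> has at least half the value of the one with weight
  \<open>s\<close>; the bound thus descends from weight 1 along the powers of 1/2.\<close>

lemma vol_mix:
  assumes L: "compact L" "0 < vol L"
  shows "0 < vol (mix L ((1/2) ^ m)) \<and> (1/2) ^ m * ln (vol L / vol K) \<le> ln (vol (mix L ((1/2) ^ m)) / vol K)"
proof (induction m)
  case 0
  have "mix L 1 = L" using K_ne by (force simp: mix_def)
  then show ?case using L by simp
next
  case (Suc m)
  let ?v = "vol (mix L ((1/2) ^ m))" and ?w = "vol (mix L ((1/2) ^ Suc m))"
  have em: "emeasure lborel E = ennreal (vol E)" if "compact E" for E :: "(real ^ 'n) set"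
    using emeasure_compact_finite[OF that] that
    by (subst emeasure_eq_ennreal_measure) (auto simp: measure_completion borel_compact)
  have "ennreal (vol K * ?v) \<le> ennreal (?w\<^sup>2)"
    using emeasure_mix_half[OF L(1), of "(1/2) ^ m"] power_le_one[of "1/2 :: real" m]
    by (simp add: em compact_K compact_mix[OF L(1)] ennreal_mult ennreal_power)
  then have sq: "vol K * ?v \<le> ?w\<^sup>2" by (subst (asm) ennreal_le_iff) auto
  have v: "0 < ?v" "(1/2) ^ m * ln (vol L / vol K) \<le> ln (?v / vol K)" using Suc by auto
  then have "0 < ?w\<^sup>2" using sq vol_K_pos by (smt (verit) mult_pos_pos)
  then have w: "0 < ?w" by (simp add: less_le)
  have "ln (?v / vol K) = ln ((vol K * ?v) / (vol K)\<^sup>2)" using vol_K_pos by (simp add: power2_eq_square)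
  also have "\<dots> \<le> ln ((?w / vol K)\<^sup>2)"
    using sq v(1) vol_K_pos w by (subst ln_le_cancel_iff) (auto simp: power_divide divide_right_mono)
  also have "\<dots> = 2 * ln (?w / vol K)" using w vol_K_pos by (simp add: ln_realpow)
  finally show ?case using v(2) w by simp
qed

text \<open>One constant \<open>C\<close> serves twice, as coefficient of the second-order error and
  as threshold: the second alternative of the conclusion says that the weight is not yet
  small.\<close>

lemma vol_mix_le:
  assumes L: "compact L" "0 \<in> L"
  obtains C where "\<And>m. 0 < m \<Longrightarrow> vol (mix L ((1/2) ^ m)) - vol K
    \<le> CARD('n) * ((1/2) ^ m * ((LINT x|lebesgue_on K. ratio L x) - vol K)) + (1/4) ^ m * C
      \<or> 1 < (1/2) ^ m * C"
proof -
  have Lne: "L \<noteq> {}" using L(2) by blast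
  obtain B where B: "0 < B" "\<And>x. ratio L x \<le> B" using ratio_bounded[OF L(1) Lne] by metis
  define C where "C = (CARD('n) + 4 ^ CARD('n) * (B + 2)\<^sup>2) * vol K + (B + 2)"
  have Cge: "B + 2 \<le> C" "(CARD('n) + 4 ^ CARD('n) * (B + 2)\<^sup>2) * vol K \<le> C"
    using B(1) vol_K_pos by (auto simp: C_def)
  show ?thesis
  proof (rule that[of C])
    fix m :: nat assume m: "0 < m"
    define t where "t = (1/2 :: real) ^ m"
    have t: "0 < t" "t \<le> 1" "t\<^sup>2 = (1/4) ^ m"
      unfolding power2_eq_square t_def by (simp_all add: power_le_one flip: power_mult_distrib)
    show "vol (mix L ((1/2) ^ m)) - vol K
      \<le> CARD('n) * ((1/2) ^ m * ((LINT x|lebesgue_on K. ratio L x) - vol K)) + (1/4) ^ m * C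
      \<or> 1 < (1/2) ^ m * C"
    proof (rule disjCI)
      assume "\<not> 1 < (1/2) ^ m * C"
      then have tC: "t * C \<le> 1" by (simp add: t_def)
      then have tB: "t * (B + 2) \<le> 1" using Cge(1) t(1) by (meson mult_left_mono less_imp_le order_trans)
      \<comment> \<open>With \<open>1 / N\<close> equal to the square of \<open>t\<close>, the
        discretization error of the radial bound is itself of second order.\<close>
      define N where "N = (4::nat) ^ m"
      have N: "0 < N" "1 / real N = t\<^sup>2" by (auto simp: N_def t(3) power_divide)
      define y where "y x = t * (ratio L x - 1) + t\<^sup>2" for x
      have t2: "t\<^sup>2 \<le> t" using mult_left_mono[OF t(2), of t] t(1) unfolding power2_eq_square by simp
      have y: "\<bar>y x\<bar> \<le> t * (B + 2)" for x
      proof -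
        have "\<bar>y x\<bar> \<le> t * \<bar>ratio L x - 1\<bar> + t\<^sup>2" unfolding y_def using t abs_triangle_ineq[of "t * (ratio L x - 1)" "t\<^sup>2"] by (simp add: abs_mult)
        also have "\<bar>ratio L x - 1\<bar> \<le> B + 1" using B(1) B(2)[of x] ratio_nonneg[OF L, of x] by linarith
        then have "t * \<bar>ratio L x - 1\<bar> + t\<^sup>2 \<le> t * (B + 1) + t" using t t2 by (intro add_mono mult_left_mono) auto
        finally show ?thesis by (simp add: algebra_simps)
      qed
      have y1: "\<bar>y x\<bar> \<le> 1" for x using y[of x] tB by linarith
      have ymeas: "y \<in> borel_measurable lebesgue"
        unfolding y_def[abs_def] using ratio_measurable[OF L(1) Lne] by measurable
      have int_y: "integrable (lebesgue_on K) y" using y1 by (intro integrable_K[OF ymeas, of 1]) auto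
      have int_r: "integrable (lebesgue_on K) (ratio L)"
        using B(2) ratio_nonneg[OF L] by (intro integrable_K[OF ratio_measurable[OF L(1) Lne], of B]) (auto simp: abs_le_iff intro: order_trans[of _ 0] less_imp_le[OF B(1)])
      have nn: "0 \<le> 1 + y x" for x using y1[of x] by linarith
      have int_p: "integrable (lebesgue_on K) (\<lambda>x. (1 + y x) ^ CARD('n))"
      proof (rule integrable_K[of _ "2 ^ CARD('n)"])
        show "(\<lambda>x. (1 + y x) ^ CARD('n)) \<in> borel_measurable lebesgue" using ymeas by measurable
        show "\<bar>(1 + y x) ^ CARD('n)\<bar> \<le> 2 ^ CARD('n)" for x
          unfolding power_abs using y1[of x] by (intro power_mono) auto
      qed
      have cm: "compact (mix L t)" by (rule compact_mix[OF L(1)])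
      have "emeasure lebesgue (mix L t) \<le> (\<integral>\<^sup>+x. ennreal ((1 + t * (ratio L x - 1) + 1 / real N) ^ CARD('n)) \<partial>lebesgue_on K)"
      proof (rule radial_volume_bound[where B="1 + B"])
        show "(\<lambda>x. 1 + t * (ratio L x - 1)) \<in> borel_measurable lebesgue"
          using ratio_measurable[OF L(1) Lne] by measurable
        fix x
        have "0 \<le> t * ratio L x" using t ratio_nonneg[OF L] by simp
        then show "0 \<le> 1 + t * (ratio L x - 1)" using t(2) by (simp add: algebra_simps)
        have "t * ratio L x \<le> 1 * B" using t B ratio_nonneg[OF L] by (intro mult_mono) auto
        then show "1 + t * (ratio L x - 1) \<le> 1 + B" using t by (simp add: algebra_simps)
      next
        show "1 + t * (ratio L (s *\<^sub>R x) - 1) = 1 + t * (ratio L x - 1)" if "0 < s" for s x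
          using ratio_scale[OF that] by simp
        show "gauge_fun x \<le> 1 + t * (ratio L x - 1)" if "x \<in> mix L t" for x
          using t by (intro gauge_mix_le L that) auto
      qed (use cm N in \<open>auto simp: borel_compact\<close>)
      also have "\<dots> = (\<integral>\<^sup>+x. ennreal ((1 + y x) ^ CARD('n)) \<partial>lebesgue_on K)"
        by (simp add: y_def N(2) add.assoc)
      also have "\<dots> = ennreal (LINT x|lebesgue_on K. (1 + y x) ^ CARD('n))"
        using nn by (intro nn_integral_eq_integral int_p) auto
      finally have "ennreal (vol (mix L t)) \<le> ennreal (LINT x|lebesgue_on K. (1 + y x) ^ CARD('n))"
        using emeasure_compact_finite[OF cm] cm by (subst emeasure_eq_ennreal_measure[symmetric]) (auto simp: borel_compact)
      then have "vol (mix L t) \<le> (LINT x|lebesgue_on K. (1 + y x) ^ CARD('n))"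
        using nn by (subst (asm) ennreal_le_iff) (auto intro!: integral_nonneg)
      also have "\<dots> \<le> (LINT x|lebesgue_on K. 1 + CARD('n) * y x + 4 ^ CARD('n) * (t * (B + 2))\<^sup>2)"
      proof (rule integral_mono[OF int_p])
        show "integrable (lebesgue_on K) (\<lambda>x. 1 + CARD('n) * y x + 4 ^ CARD('n) * (t * (B + 2))\<^sup>2)"
          using int_y finite_measure.integrable_const[OF finite_measure_K] by (intro Bochner_Integration.integrable_add) auto
        fix x
        have "(y x)\<^sup>2 \<le> (t * (B + 2))\<^sup>2" using y[of x] by (metis abs_ge_zero power2_abs power_mono)
        then have "4 ^ CARD('n) * (y x)\<^sup>2 \<le> 4 ^ CARD('n) * (t * (B + 2))\<^sup>2" by simp
        then show "(1 + y x) ^ CARD('n) \<le> 1 + CARD('n) * y x + 4 ^ CARD('n) * (t * (B + 2))\<^sup>2"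
          using power_le_quadratic[OF y1[of x], of "CARD('n)"] by linarith
      qed
      also have "\<dots> = vol K + CARD('n) * (LINT x|lebesgue_on K. y x) + vol K * (4 ^ CARD('n) * (t * (B + 2))\<^sup>2)"
        by (subst integral_affine_K[OF int_y]) simp
      also have "(LINT x|lebesgue_on K. y x) = t * ((LINT x|lebesgue_on K. ratio L x) - vol K) + vol K * t\<^sup>2"
      proof -
        have "y x = (- t) + t * ratio L x + t\<^sup>2" for x by (simp add: y_def algebra_simps)
        then show ?thesis by (simp only: integral_affine_K[OF int_r]) (simp add: algebra_simps)
      qed
      finally have "vol (mix L t) - vol K \<le> CARD('n) * (t * ((LINT x|lebesgue_on K. ratio L x) - vol K))
          + t\<^sup>2 * ((CARD('n) + 4 ^ CARD('n) * (B + 2)\<^sup>2) * vol K)"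
        unfolding power_mult_distrib[of t "B + 2"] by (simp add: algebra_simps)
      also have "\<dots> \<le> CARD('n) * (t * ((LINT x|lebesgue_on K. ratio L x) - vol K)) + t\<^sup>2 * C"
        using Cge(2) by (intro add_left_mono mult_left_mono) auto
      finally show "vol (mix L ((1/2) ^ m)) - vol K
        \<le> CARD('n) * ((1/2) ^ m * ((LINT x|lebesgue_on K. ratio L x) - vol K)) + (1/4) ^ m * C"
        unfolding t(3) by (simp only: t_def)
    qed
  qed
qed

text \<open>The volume of the combination is bounded below by Brunn--Minkowski and above by the
  radial estimate; dividing by \<open>t\<close> and letting it tend to 0 compares the first-order
  terms. The logarithm stems from the product form and loses information unless the volumes
  agree.\<close>

lemma minkowski_log:
  assumes L: "compact L" "0 \<in> L" "0 < vol L"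
  shows "vol K * ln (vol L / vol K) \<le> CARD('n) * ((LINT x|lebesgue_on K. ratio L x) - vol K)"
proof -
  obtain C where C: "\<And>m. 0 < m \<Longrightarrow> vol (mix L ((1/2) ^ m)) - vol K
    \<le> CARD('n) * ((1/2) ^ m * ((LINT x|lebesgue_on K. ratio L x) - vol K)) + (1/4) ^ m * C
      \<or> 1 < (1/2) ^ m * C"
    using vol_mix_le[OF L(1,2)] by blast
  let ?D = "CARD('n) * ((LINT x|lebesgue_on K. ratio L x) - vol K)"
  have lim: "(\<lambda>m. (1/2 :: real) ^ m * C) \<longlonglongrightarrow> 0 * C" by (intro tendsto_intros) auto
  then have "eventually (\<lambda>m. (1/2) ^ m * C < 1) sequentially" by (intro order_tendstoD(2)) auto
  then have "eventually (\<lambda>m. vol K * ln (vol L / vol K) \<le> ?D + (1/2) ^ m * C) sequentially"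
    using eventually_gt_at_top[of "0 :: nat"]
  proof eventually_elim
    case (elim m)
    define t where "t = (1/2 :: real) ^ m"
    have t: "0 < t" by (simp add: t_def)
    have t2: "(1/4) ^ m = t * t" by (simp add: t_def flip: power_mult_distrib)
    let ?v = "vol (mix L t)"
    have v: "0 < ?v" "t * ln (vol L / vol K) \<le> ln (?v / vol K)"
      using vol_mix[OF L(1,3), of m] by (auto simp: t_def)
    have "ln (?v / vol K) \<le> ?v / vol K - 1" using v(1) vol_K_pos by (intro ln_le_minus_one) auto
    then have "vol K * (t * ln (vol L / vol K)) \<le> vol K * (?v / vol K - 1)"
      using v(2) vol_K_pos by (intro mult_left_mono) auto
    also have "\<dots> = ?v - vol K" using vol_K_pos by (simp add: algebra_simps)
    also have "\<dots> \<le> CARD('n) * (t * ((LINT x|lebesgue_on K. ratio L x) - vol K)) + t * t * C"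
      using C[OF elim(2)] elim(1) by (simp add: t_def[symmetric] t2)
    finally have "t * (vol K * ln (vol L / vol K)) \<le> t * (?D + t * C)" by (simp add: algebra_simps)
    then show ?case using t by (simp add: t_def)
  qed
  moreover have "(\<lambda>m. ?D + (1/2) ^ m * C) \<longlonglongrightarrow> ?D + 0" using lim by (intro tendsto_intros) auto
  ultimately show ?thesis by (auto dest: tendsto_lowerbound)
qed

lemma ratio_scaled_set:
  assumes L: "compact L" "L \<noteq> {}" and s: "0 < s"
  shows "ratio ((*\<^sub>R) s ` L) x = s * ratio L x"
proof -
  obtain y where y: "y \<in> L" "\<nu> x \<bullet> y = support_fun L (\<nu> x)" using support_fun_attained[OF L] by blast
  have cs: "compact ((*\<^sub>R) s ` L)" "(*\<^sub>R) s ` L \<noteq> {}" using L by (auto intro: compact_scaling)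
  obtain z where z: "z \<in> (*\<^sub>R) s ` L" "\<nu> x \<bullet> z = support_fun ((*\<^sub>R) s ` L) (\<nu> x)" using support_fun_attained[OF cs] by blast
  have "support_fun ((*\<^sub>R) s ` L) (\<nu> x) \<le> s * support_fun L (\<nu> x)"
  proof -
    obtain w where w: "w \<in> L" "z = s *\<^sub>R w" using z(1) by blast
    have "s * (\<nu> x \<bullet> w) \<le> s * support_fun L (\<nu> x)"
      using support_fun_upper[OF L(1) w(1)] s by (intro mult_left_mono) auto
    then show ?thesis using z(2) w(2) by simp
  qed
  moreover have "s * support_fun L (\<nu> x) \<le> support_fun ((*\<^sub>R) s ` L) (\<nu> x)"
    using support_fun_upper[OF cs(1) imageI[OF y(1)], of "\<nu> x"] y(2) by simp
  ultimately show ?thesis by (simp add: ratio_def)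
qed

text \<open>Scaling \<open>L\<close> to the volume of \<open>K\<close> makes the logarithm vanish,
  and both sides are homogeneous of degree one in \<open>L\<close>. If \<open>L\<close> has volume
  0, the left side is 0.\<close>

theorem minkowski_first_inequality:
  assumes L: "compact L" "0 \<in> L"
  shows "root CARD('n) (vol L / vol K) * vol K \<le> (LINT x|lebesgue_on K. ratio L x)"
proof (cases "vol L = 0")
  case True
  then show ?thesis using ratio_nonneg[OF L] dim_ge_2 by (simp add: integral_nonneg)
next
  case False
  then have VL: "0 < vol L" by (simp add: zero_less_measure_iff)
  have Lne: "L \<noteq> {}" using L(2) by blast
  define d where "d = root CARD('n) (vol L / vol K)"
  have d: "0 < d" "d ^ CARD('n) = vol L / vol K" using VL vol_K_pos by (auto simp: d_def)
  let ?L = "(*\<^sub>R) (1 / d) ` L"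
  have "vol ?L = vol K" using d VL vol_K_pos by (simp add: measure_lebesgue_scaleR_image power_divide)
  moreover have "vol K * ln (vol ?L / vol K) \<le> CARD('n) * ((LINT x|lebesgue_on K. ratio ?L x) - vol K)"
    using L d VL \<open>vol ?L = vol K\<close> vol_K_pos by (intro minkowski_log compact_scaling) auto
  ultimately have "0 \<le> CARD('n) * ((LINT x|lebesgue_on K. ratio ?L x) - vol K)"
    using vol_K_pos by simp
  then have "vol K \<le> (LINT x|lebesgue_on K. ratio ?L x)" by (simp add: zero_le_mult_iff)
  also have "\<dots> = (LINT x|lebesgue_on K. ratio L x) / d"
    using d by (simp add: ratio_scaled_set[OF L(1) Lne])
  finally show ?thesis using d(1) by (simp add: d_def[symmetric] le_divide_eq mult.commute)
qed

end

section \<open>The Orlicz--Minkowski inequality\<close>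

lemma small_scale_exists:
  fixes y :: "'a::real_normed_vector"
  assumes "0 < e"
  shows "\<exists>s>0. s * norm y < e"
proof (intro exI conjI)
  have t: "0 < norm y + 1" by (simp add: add_nonneg_pos)
  show "0 < e / (norm y + 1)" using assms t by simp
  show "e / (norm y + 1) * norm y < e" using assms t by (simp add: pos_divide_less_eq)
qed

context convex_body
begin

text \<open>The support function inequality at the point \<open>z - s y\<close> holds for almost every \<open>z\<close>, hence by
  continuity for every \<open>z\<close>; taking \<open>z = s y\<close> bounds the gauge of \<open>y\<close>.\<close>

lemma subset_dilate_if_ratio_AE:
  assumes L: "compact L" and d: "0 \<le> d" and ae: "AE x in lebesgue_on K. ratio L x = d" and y: "y \<in> L"
  shows "gauge_fun y \<le> d"
proof -
  have ae': "AE x in lebesgue. x \<in> K \<longrightarrow> ratio L x = d"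
    using ae by (subst (asm) AE_restrict_space_iff) auto
  \<comment> \<open>The value of the ratio is known only on \<open>K\<close>, so \<open>y\<close> is
    first shrunk into the interior of \<open>K\<close>.\<close>
  obtain s where s: "0 < s" "s *\<^sub>R y \<in> interior K"
  proof -
    obtain e where e: "0 < e" "ball 0 e \<subseteq> K" using zero_interior by (auto simp: mem_interior)
    obtain s where s: "0 < s" "s * norm y < e" using small_scale_exists[OF e(1)] by blast
    then have "s *\<^sub>R y \<in> ball 0 e" by simp
    moreover have "ball 0 e \<subseteq> interior K" using e(2) by (simp add: interior_maximal)
    ultimately show thesis using that s by blast
  qed
  \<comment> \<open>The interior points that violate the almost everywhere inequality form an open
    null set, which must be empty.\<close>
  let ?U = "interior K \<inter> {z. gauge_fun (z - s *\<^sub>R y) < gauge_fun z - s * d}"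
  have "open ?U"
    by (intro open_Int open_interior open_Collect_less continuous_intros continuous_on_gauge
        continuous_on_compose2[OF continuous_on_gauge[of UNIV]]) auto
  moreover have "negligible ?U"
  proof -
    have "AE x in lebesgue. x \<notin> ?U"
      using ae'
    proof eventually_elim
      case (elim z)
      show ?case
      proof
        assume z: "z \<in> ?U"
        then have "ratio L z = d" using elim interior_subset by auto
        then have "support_fun L (\<nu> z) = d * h (\<nu> z)" using h_\<nu>_pos[of z] by (simp add: ratio_def field_simps)
        then have "\<nu> z \<bullet> y \<le> d * h (\<nu> z)" using support_fun_upper[OF L y, of "\<nu> z"] by simp
        then have yd: "(\<nu> z \<bullet> y) / h (\<nu> z) \<le> d" by (simp add: divide_le_eq)
        have "gauge_fun z - s * ((\<nu> z \<bullet> y) / h (\<nu> z)) = (\<nu> z \<bullet> (z - s *\<^sub>R y)) / h (\<nu> z)"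
          by (simp add: gauge_eq_\<nu>[of z] inner_diff_right diff_divide_distrib)
        also have "\<dots> \<le> gauge_fun (z - s *\<^sub>R y)" by (intro gauge_upper') simp
        finally have "gauge_fun z - s * ((\<nu> z \<bullet> y) / h (\<nu> z)) \<le> gauge_fun (z - s *\<^sub>R y)" .
        moreover have "s * ((\<nu> z \<bullet> y) / h (\<nu> z)) \<le> s * d" using yd s(1) by (intro mult_left_mono) auto
        ultimately show False using z by auto
      qed
    qed
    then show ?thesis
      unfolding negligible_iff_null_sets using \<open>open ?U\<close>
      by (subst AE_iff_null_sets) (auto simp: borel_open)
  qed
  ultimately have "?U = {}" using open_not_negligible by blast
  then have "\<not> gauge_fun (s *\<^sub>R y - s *\<^sub>R y) < gauge_fun (s *\<^sub>R y) - s * d" using s(2) by blast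
  then have "s * gauge_fun y \<le> s * d" using s(1) by (simp add: gauge_scale)
  then show ?thesis using s(1) by simp
qed

text \<open>\<open>L\<close> is a closed subset of the dilate with the same volume, so a missing
  interior point would cost an open set of positive volume. Interior points are dense in the dilate
  by its convexity.\<close>

lemma eq_dilate_if_vol_eq:
  assumes L: "compact L" "\<And>y. y \<in> L \<Longrightarrow> gauge_fun y \<le> d" and d: "0 < d" and v: "vol L = d ^ CARD('n) * vol K"
  shows "L = (*\<^sub>R) d ` K"
proof
  let ?dK = "(*\<^sub>R) d ` K"
  show sub: "L \<subseteq> ?dK"
  proof
    fix y assume y: "y \<in> L"
    have "gauge_fun ((1 / d) *\<^sub>R y) \<le> 1" using L(2)[OF y] d by (simp add: gauge_scale divide_le_eq)
    then show "y \<in> ?dK" using d by (intro image_eqI[of _ _ "(1 / d) *\<^sub>R y"]) (auto simp: gauge_le_1_iff)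
  qed
  have cd: "compact ?dK" by (intro compact_scaling compact_K)
  have "vol (?dK - L) = vol ?dK - vol L"
    using cd L(1) sub by (intro measurable_measure_Diff lmeasurable_compact) (auto simp: borel_compact)
  also have "\<dots> = 0" using v d by (simp add: measure_lebesgue_scaleR_image)
  finally have "negligible (?dK - L)"
    using fmeasurable_Diff[OF lmeasurable_compact[OF cd], of L] L(1)
    by (simp add: negligible_iff_measure borel_compact)
  then have "negligible (interior ?dK - L)" by (rule negligible_subset) (use interior_subset in blast)
  moreover have "open (interior ?dK - L)" using L(1) by (intro open_Diff open_interior compact_imp_closed)
  ultimately have "interior ?dK - L = {}" using open_not_negligible by blast
  then have "interior ?dK \<subseteq> L" by blast
  then have "closure (interior ?dK) \<subseteq> L" using L(1) by (intro closure_minimal compact_imp_closed)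
  moreover have "closure (interior ?dK) = closure ?dK"
  proof (rule convex_closure_interior)
    show "convex ?dK" by (intro convex_scaling convex_K)
    have "open ((*\<^sub>R) d ` interior K)" using d by (intro open_scaling) auto
    then have "(*\<^sub>R) d ` interior K \<subseteq> interior ?dK" by (intro interior_maximal image_mono interior_subset)
    then show "interior ?dK \<noteq> {}" using zero_interior by blast
  qed
  ultimately show "?dK \<subseteq> L" using cd by (simp add: closure_closed compact_imp_closed)
qed

text \<open>A continuous function on the sphere attains its maximum \<open>b\<close>, and openness
  makes \<open>b\<close> smaller than \<open>a\<close>. The ratios thus stay in
  \<open>[0, b]\<close>, on which \<open>\<phi>\<close> is bounded even if it blows up at
  \<open>a\<close>.\<close>

lemma ratio_strict_bound:
  assumes L: "compact L" "0 \<in> L" and sub: "L \<subseteq> interior (ext_dilate a K)" and a: "0 < a"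
  obtains b where "0 \<le> b" "ereal b < a" "\<And>u. norm u = 1 \<Longrightarrow> support_fun L u / h u \<le> b"
proof -
  have Lne: "L \<noteq> {}" using L(2) by blast
  have "continuous_on S1 (\<lambda>u. support_fun L u / h u)"
    using h_pos by (intro continuous_intros continuous_on_h continuous_on_support_fun L(1) Lne) force
  from continuous_attains_sup[OF compact_sphere _ this] obtain v
    where v: "norm v = 1" "\<And>u. norm u = 1 \<Longrightarrow> support_fun L u / h u \<le> support_fun L v / h v" by auto
  show ?thesis
  proof (rule that[of "support_fun L v / h v"])
    show "0 \<le> support_fun L v / h v"
      using support_fun_upper[OF L, of v] h_pos[OF v(1)] by (intro divide_nonneg_pos) auto
    show "ereal (support_fun L v / h v) < a"
    proof (cases "a = \<infinity>")
      case False
      then obtain r where r: "a = ereal r" "0 < r" using a by (cases a) auto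
      obtain y where y: "y \<in> L" "v \<bullet> y = support_fun L v" using support_fun_attained[OF L(1) Lne] by blast
      have "y \<in> interior ((*\<^sub>R) r ` K)" using y(1) sub r by (auto simp: ext_dilate_def)
      then obtain e where e: "0 < e" "ball y e \<subseteq> (*\<^sub>R) r ` K" by (auto simp: mem_interior)
      \<comment> \<open>The point \<open>y\<close> can be pushed outward by a factor
        \<open>1 + s\<close> inside \<open>r\<close> times \<open>K\<close>, which makes the support
        inequality strict.\<close>
      obtain s where s: "0 < s" "s * norm y < e" using small_scale_exists[OF e(1)] by blast
      then have "(1 + s) *\<^sub>R y \<in> ball y e" by (simp add: scaleR_add_left dist_norm)
      then obtain x where x: "x \<in> K" "(1 + s) *\<^sub>R y = r *\<^sub>R x" using e(2) by blast
      have "(1 + s) * (v \<bullet> y) = r * (v \<bullet> x)" using arg_cong[OF x(2), of "\<lambda>z. v \<bullet> z"] by simp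
      also have "\<dots> \<le> r * h v" using r h_upper[OF x(1)] by (intro mult_left_mono) auto
      finally have le: "(1 + s) * (v \<bullet> y) \<le> r * h v" .
      have rh: "0 < r * h v" using r(2) h_pos[OF v(1)] by simp
      have "v \<bullet> y < r * h v"
      proof (cases "0 < v \<bullet> y")
        case True
        then have "1 * (v \<bullet> y) < (1 + s) * (v \<bullet> y)" using s by (intro mult_strict_right_mono) auto
        then show ?thesis using le by simp
      qed (use rh in simp)
      then show ?thesis using h_pos[OF v(1)] y(2) r(1) by (simp add: divide_less_eq)
    qed simp
  qed (use v in auto)
qed

end

section \<open>Convex functions of one variable\<close>

text \<open>On \<open>[0, y]\<close> the function lies below its chord, which rises from 0 to
  \<open>\<phi> y\<close>.\<close>

lemma convex_nonneg_mono:
  fixes \<phi> :: "real \<Rightarrow> real"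
  assumes conv: "convex_on I \<phi>" and I: "0 \<in> I" "y \<in> I" and 0: "\<phi> 0 = 0" "0 \<le> \<phi> y" and xy: "0 \<le> x" "x \<le> y"
  shows "\<phi> x \<le> \<phi> y"
proof (cases "y = 0")
  case False
  then have y: "0 < y" using xy by simp
  have "\<phi> ((1 - x / y) *\<^sub>R 0 + (x / y) *\<^sub>R y) \<le> (1 - x / y) * \<phi> 0 + (x / y) * \<phi> y"
    using xy y I by (intro convex_onD[OF conv]) (auto simp: divide_le_eq)
  then have "\<phi> x \<le> (x / y) * \<phi> y" using y 0 by simp
  also have "\<dots> \<le> 1 * \<phi> y" using xy y 0 by (intro mult_right_mono) (auto simp: divide_le_eq)
  finally show ?thesis by simp
qed (use xy in simp)

lemma convex_supporting_slope:
  fixes \<phi> :: "real \<Rightarrow> real"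
  assumes conv: "convex_on I \<phi>" and d: "d \<in> interior I"
  obtains k where "\<And>x. x \<in> I \<Longrightarrow> \<phi> d + k * (x - d) \<le> \<phi> x"
  using convex_le_Inf_differential[OF conv d] by blast

text \<open>If the line touched the graph at \<open>x\<close> as well, strict convexity would put
  the graph below the line at the midpoint of \<open>d\<close> and \<open>x\<close>.\<close>

lemma strictly_convex_on_imp_strict_support:
  fixes \<phi> :: "real \<Rightarrow> real"
  assumes sc: "strictly_convex_on I \<phi>" and k: "\<And>x. x \<in> I \<Longrightarrow> \<phi> d + k * (x - d) \<le> \<phi> x"
    and d: "d \<in> I" and x: "x \<in> I" "x \<noteq> d"
  shows "\<phi> d + k * (x - d) < \<phi> x"
proof -
  let ?m = "(1 - 1/2) * d + (1/2) * x"
  have I: "convex I" using sc by (simp add: strictly_convex_on_def)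
  have "?m \<in> I" using convexD[OF I d x(1), of "1/2" "1/2"] by simp
  then have "\<phi> d + k * (?m - d) \<le> \<phi> ?m" by (rule k)
  moreover have "\<phi> ?m < (1 - 1/2) * \<phi> d + (1/2) * \<phi> x"
    using conjunct2[OF sc[unfolded strictly_convex_on_def], rule_format, OF d x(1) x(2)[symmetric], of "1/2"] by simp
  ultimately show ?thesis by (simp add: algebra_simps)
qed

section \<open>The inequality for the Orlicz mean and its equality case\<close>

theorem lemma9p1:
  fixes a :: ereal and I :: "real set" and \<phi> :: "real \<Rightarrow> real"
    and K L :: "(real ^ 'n) set"
  assumes "CARD('n) \<ge> 2"
    and "0 < a" and "I = {x. 0 \<le> x \<and> ereal x < a}"
    and "\<And>x. x \<in> I \<Longrightarrow> 0 \<le> \<phi> x" and "convex_on I \<phi>" and "\<phi> 0 = 0"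
    and "compact K" and "convex K" and "compact L" and "convex L"
    and "0 \<in> interior K" and "0 \<in> L" and "L \<subseteq> interior (ext_dilate a K)"
  shows "(1 / (real CARD('n) * measure lebesgue K) *
           (LINT u|surface_area_measure K.
              \<phi> (support_fun L u / support_fun K u) * support_fun K u)
         \<ge> \<phi> (root CARD('n) (measure lebesgue L / measure lebesgue K))) \<and>
    (strictly_convex_on I \<phi> \<longrightarrow>
         (1 / (real CARD('n) * measure lebesgue K) *
           (LINT u|surface_area_measure K.
              \<phi> (support_fun L u / support_fun K u) * support_fun K u)
         = \<phi> (root CARD('n) (measure lebesgue L / measure lebesgue K))
          \<longleftrightarrow> dilatates K L \<or> L = {0}))"
proof -
  interpret convex_body K using assms by unfold_locales auto
  have Lne: "L \<noteq> {}" using assms(12) by blast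
  define V where "V = vol K"
  have V: "0 < V" using vol_K_pos by (simp add: V_def)
  define d where "d = root CARD('n) (vol L / V)"
  have n0: "0 < CARD('n)" by simp
  have d0: "0 \<le> d" using V by (simp add: d_def)
  have d_pow: "vol L = d ^ CARD('n) * V" using V by (simp add: d_def)
  obtain b where b: "0 \<le> b" "ereal b < a" "\<And>u. norm u = 1 \<Longrightarrow> support_fun L u / h u \<le> b"
    using ratio_strict_bound[OF assms(9,12,13,2)] by blast
  have I_iff: "x \<in> I \<longleftrightarrow> 0 \<le> x \<and> ereal x < a" for x by (simp add: assms(3))
  have I_le: "x \<in> I" if "0 \<le> x" "x \<le> b" for x
    using that b(2) by (auto simp: I_iff intro: le_less_trans[of _ "ereal b"])
  have I0: "0 \<in> I" and Ib: "b \<in> I" using I_le b(1) by auto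
  let ?r = "ratio L"
  have r: "0 \<le> ?r x" "?r x \<le> b" for x
    using ratio_nonneg[OF assms(9,12)] b(3)[of "\<nu> x"] by (auto simp: ratio_def)
  have rI: "?r x \<in> I" for x using r I_le by blast
  have mono: "\<phi> x \<le> \<phi> y" if "0 \<le> x" "x \<le> y" "y \<in> I" for x y
    using that by (intro convex_nonneg_mono[OF assms(5) I0 _ assms(6)] assms(4))
  \<comment> \<open>The hypotheses describe \<open>\<phi>\<close> on \<open>I\<close> only; clamping
    the argument to \<open>[0, b]\<close> gives a monotone function on the whole line, hence a Borel
    measurable one.\<close>
  define \<phi>' where "\<phi>' x = \<phi> (max 0 (min x b))" for x
  have \<phi>'_eq: "\<phi>' x = \<phi> x" if "0 \<le> x" "x \<le> b" for x using that by (simp add: \<phi>'_def)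
  have "mono \<phi>'" unfolding \<phi>'_def using b(1) by (intro monoI mono I_le) auto
  then have \<phi>'_meas: "\<phi>' \<in> borel_measurable borel" by (rule borel_measurable_mono)
  have r_meas: "?r \<in> borel_measurable lebesgue" by (rule ratio_measurable[OF assms(9) Lne])
  have \<phi>r_eq: "\<phi> (?r x) = \<phi>' (?r x)" for x using \<phi>'_eq[OF r] by simp
  have \<phi>r_meas: "(\<lambda>x. \<phi> (?r x)) \<in> borel_measurable lebesgue"
    unfolding \<phi>r_eq by (rule measurable_compose[OF r_meas \<phi>'_meas])
  have \<phi>r_bound: "0 \<le> \<phi> (?r x)" "\<phi> (?r x) \<le> \<phi> b" for x
    using assms(4)[OF rI] mono[OF r Ib] by auto
  have int_\<phi>: "integrable (lebesgue_on K) (\<lambda>x. \<phi> (?r x))"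
    using \<phi>r_bound by (intro integrable_K[OF \<phi>r_meas, of "\<phi> b"]) (auto simp: abs_le_iff intro: order_trans[of _ 0])
  have int_r: "integrable (lebesgue_on K) ?r"
    using r b(1) by (intro integrable_K[OF r_meas, of b]) (auto simp: abs_le_iff intro: order_trans[of _ 0])
  have sm: "(LINT u|surface_area_measure K. \<phi> (support_fun L u / h u) * h u)
      = CARD('n) * (LINT x|lebesgue_on K. \<phi> (?r x))"
  proof -
    have cont: "continuous_on S1 (\<lambda>u. support_fun L u / h u)"
      using h_pos by (intro continuous_intros continuous_on_h continuous_on_support_fun assms(9) Lne) force
    have "(\<lambda>u. \<phi>' (support_fun L u / h u) * h u) \<in> borel_measurable (restrict_space borel S1)"
      by (intro borel_measurable_times measurable_compose[OF borel_measurable_continuous_on_restrict[OF cont] \<phi>'_meas]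
          borel_measurable_continuous_on_restrict continuous_on_h)
    moreover have eq: "\<phi> (support_fun L u / h u) = \<phi>' (support_fun L u / h u)" if "norm u = 1" for u
      using b(3)[OF that] support_fun_upper[OF assms(9,12), of u] h_pos[OF that]
      by (intro \<phi>'_eq[symmetric] divide_nonneg_pos) auto
    ultimately have "(\<lambda>u. \<phi> (support_fun L u / h u) * h u) \<in> borel_measurable (restrict_space borel S1)"
      by (subst measurable_cong[where g="\<lambda>u. \<phi>' (support_fun L u / h u) * h u"]) (auto simp: space_restrict_space)
    from integral_surface_area_measure[OF this] show ?thesis
      using h_\<nu>_pos by (simp add: ratio_def less_imp_neq[OF h_\<nu>_pos, symmetric])
  qed
  define J where "J = (LINT x|lebesgue_on K. \<phi> (?r x)) / V"
  have lhs: "1 / (real CARD('n) * vol K) * (LINT u|surface_area_measure K. \<phi> (support_fun L u / h u) * h u) = J"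
    unfolding sm J_def V_def by simp
  have avg: "d * V \<le> (LINT x|lebesgue_on K. ?r x)"
    using minkowski_first_inequality[OF assms(9,12)] by (simp add: d_def V_def)
  \<comment> \<open>The mean of the ratio lies between \<open>d\<close> and \<open>b\<close>, which
    places \<open>d\<close> in \<open>I\<close>.\<close>
  have "(LINT x|lebesgue_on K. ?r x) \<le> (LINT x|lebesgue_on K. b)"
    by (intro integral_mono int_r integrable_const_K r)
  then have "d * V \<le> b * V" using avg by (simp only: integral_const_K V_def) (simp add: mult.commute)
  then have db: "d \<le> b" using V by simp
  have dI: "d \<in> I" using I_le d0 db by blast
  have d_interior: "d \<in> interior I" if "0 < d"
  proof -
    \<comment> \<open>The gap between \<open>b\<close> and \<open>a\<close> leaves room to the right
      of \<open>d\<close>, so only the left endpoint 0 could fail to be interior.\<close>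
    obtain c where c: "ereal b < ereal c" "ereal c < a" using ereal_dense2[OF b(2)] by blast
    have "{0<..<c} \<subseteq> I"
    proof
      fix x assume x: "x \<in> {0<..<c}"
      then have "ereal x < ereal c" by simp
      then have "ereal x < a" using c(2) by (rule less_trans)
      then show "x \<in> I" using x by (simp add: I_iff)
    qed
    then have "{0<..<c} \<subseteq> interior I" by (simp add: interior_maximal)
    then show ?thesis using that db c(1) by auto
  qed
  \<comment> \<open>The slope has to be nonnegative because the mean of the ratio is bounded only
    from below. For \<open>d > 0\<close> this follows by evaluating the line at 0; for
    \<open>d = 0\<close> the horizontal line supports.\<close>
  have slope: "\<exists>k\<ge>0. \<forall>x\<in>I. \<phi> d + k * (x - d) \<le> \<phi> x"
  proof (cases "0 < d")
    case True
    obtain k where k: "\<And>x. x \<in> I \<Longrightarrow> \<phi> d + k * (x - d) \<le> \<phi> x"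
      using convex_supporting_slope[OF assms(5) d_interior[OF True]] by blast
    have "\<phi> d \<le> k * d" using k[OF I0] assms(6) by simp
    then have "0 \<le> k * d" using assms(4)[OF dI] by simp
    then have "0 \<le> k" using True by (simp add: zero_le_mult_iff)
    then show ?thesis using k by blast
  next
    case False
    then have "d = 0" using d0 by simp
    then show ?thesis using assms(4,6) by (intro exI[of _ 0]) auto
  qed
  then obtain k where k: "0 \<le> k" "\<And>x. x \<in> I \<Longrightarrow> \<phi> d + k * (x - d) \<le> \<phi> x" by blast
  have int_lin: "integrable (lebesgue_on K) (\<lambda>x. \<phi> d + k * (?r x - d))"
    using int_r integrable_const_K by (intro Bochner_Integration.integrable_add integrable_mult_right Bochner_Integration.integrable_diff)
  have lin: "(LINT x|lebesgue_on K. \<phi> d + k * (?r x - d)) = V * \<phi> d + k * ((LINT x|lebesgue_on K. ?r x) - d * V)"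
  proof -
    have "\<phi> d + k * (?r x - d) = \<phi> d + k * ?r x + (- (k * d))" for x by (simp add: algebra_simps)
    then show ?thesis by (simp only: integral_affine_K[OF int_r]) (simp add: V_def algebra_simps)
  qed
  have lin_ge: "V * \<phi> d \<le> (LINT x|lebesgue_on K. \<phi> d + k * (?r x - d))"
    unfolding lin using avg k(1) by simp
  have lin_le: "(LINT x|lebesgue_on K. \<phi> d + k * (?r x - d)) \<le> (LINT x|lebesgue_on K. \<phi> (?r x))"
    by (intro integral_mono int_lin int_\<phi> k(2) rI)
  have ineq: "\<phi> d \<le> J"
    using lin_ge lin_le V by (simp add: J_def le_divide_eq mult.commute)
  have equality: "J = \<phi> d \<longleftrightarrow> dilatates K L \<or> L = {0}" if sc: "strictly_convex_on I \<phi>"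
  proof
    assume "J = \<phi> d"
    then have tot: "(LINT x|lebesgue_on K. \<phi> (?r x)) = V * \<phi> d" using V by (simp add: J_def field_simps)
    \<comment> \<open>The gap between \<open>\<phi>\<close> and its supporting line is nonnegative,
      and equality makes its integral vanish; strict convexity then pins the ratio to
      \<open>d\<close>.\<close>
    let ?g = "\<lambda>x. \<phi> (?r x) - (\<phi> d + k * (?r x - d))"
    have int_g: "integrable (lebesgue_on K) ?g" by (rule Bochner_Integration.integrable_diff[OF int_\<phi> int_lin])
    have g_nonneg: "0 \<le> ?g x" for x using k(2)[OF rI] by simp
    have "(LINT x|lebesgue_on K. ?g x) = (LINT x|lebesgue_on K. \<phi> (?r x)) - (LINT x|lebesgue_on K. \<phi> d + k * (?r x - d))"
      by (rule Bochner_Integration.integral_diff[OF int_\<phi> int_lin])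
    then have "(LINT x|lebesgue_on K. ?g x) \<le> 0" using tot lin_ge by simp
    moreover have "0 \<le> (LINT x|lebesgue_on K. ?g x)" by (rule Bochner_Integration.integral_nonneg[OF g_nonneg])
    ultimately have "(LINT x|lebesgue_on K. ?g x) = 0" by simp
    then have "AE x in lebesgue_on K. ?g x = 0"
      using integral_nonneg_eq_0_iff_AE[OF int_g] g_nonneg by simp
    then have ae: "AE x in lebesgue_on K. ?r x = d"
    proof eventually_elim
      case (elim x)
      then show ?case using strictly_convex_on_imp_strict_support[OF sc k(2) dI rI[of x]] by (cases "?r x = d") auto
    qed
    have gy: "gauge_fun y \<le> d" if "y \<in> L" for y by (rule subset_dilate_if_ratio_AE[OF assms(9) d0 ae that])
    show "dilatates K L \<or> L = {0}"
    proof (cases "0 < d")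
      case True
      have "L = (*\<^sub>R) d ` K" by (intro eq_dilate_if_vol_eq assms(9) gy True d_pow[unfolded V_def])
      then show ?thesis using True by (auto simp: dilatates_def)
    next
      case False
      \<comment> \<open>Here \<open>d = 0\<close>, and the gauge bound leaves only the
        origin.\<close>
      then have "gauge_fun y \<le> 0" if "y \<in> L" for y using gy[OF that] by simp
      then have "y = 0" if "y \<in> L" for y using that gauge_pos[of y] by force
      then show ?thesis using assms(12) by blast
    qed
  next
    assume "dilatates K L \<or> L = {0}"
    \<comment> \<open>In both cases the ratio is constant; \<open>t = 0\<close> represents
      \<open>L = {0}\<close>.\<close>
    then obtain t where t: "0 \<le> t" "\<And>x. ?r x = t" "vol L = t ^ CARD('n) * V"
    proof
      assume "dilatates K L"
      then obtain t where t: "0 < t" "L = (*\<^sub>R) t ` K" by (auto simp: dilatates_def)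
      have "?r x = t" for x
        using ratio_scaled_set[OF compact_K K_ne t(1), of x] t(2) h_\<nu>_pos[of x] by (simp add: ratio_def)
      moreover have "vol L = t ^ CARD('n) * V" using t by (simp add: measure_lebesgue_scaleR_image V_def)
      ultimately show thesis using that[of t] t(1) by simp
    next
      assume L0: "L = {0}"
      have "?r x = 0" for x by (simp add: ratio_def support_fun_def L0)
      moreover have "vol L = 0" using L0 by simp
      ultimately show thesis using that[of 0] by simp
    qed
    have "d = t" using t(1,3) V by (simp add: d_def real_root_power_cancel)
    then have "J = (LINT x|lebesgue_on K. \<phi> d) / V" by (simp add: J_def t(2))
    also have "\<dots> = \<phi> d" using V by (simp only: integral_const_K V_def) simp
    finally show "J = \<phi> d" .
  qed
  show ?thesis
    unfolding lhs using ineq equality by (simp add: d_def V_def)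
qed

end
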